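(* For $\mathcal D$-almost all $s$ let $\mathfrak L_s$ be a (possibly infinite) algebraic extension of $\mathfrak F_s$ with $\mathfrak L_s\subseteq\mathfrak F_s^{alg}$, and let $\mathfrak L=\prod_s\mathfrak L_s/\mathcal D$. Then: (i) if $[\mathfrak L_s:\mathfrak F_s]=n_s<\infty$ for $\mathcal D$-almost all $s$ and only finitely many positive integers $k$ satisfy $\{s: k\mid n_s\}\in\mathcal D$, then $\mathfrak L_{alg}$ is a finite extension of $\mathbb F$ and $\mathfrak L_{sep}$ is a finite separable extension of $\mathbb F$; (ii) if $\mathfrak L_s/\mathfrak F_s$ is separable for $\mathcal D$-almost all $s$, then $\mathfrak L_{alg}$ is separable over $\mathbb F$ and $\mathfrak L_{alg}=\mathfrak L_{sep}$; (iii) if there is no prime $p$ with $\{s:\operatorname{char}\mathbb F_s=p\}\in\mathcal D$, then $\mathfrak L_{alg}$ is separable over $\mathbb F$ and $\mathfrak L_{alg}=\mathfrak L_{sep}$.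
   Context: Let $S$ be an infinite set, $\mathcal D$ a nonprincipal ultrafilter on $S$; ultraproducts $\prod_sA_s/\mathcal D$ consist of tuples modulo agreement on a set in $\mathcal D$, classes written $\mathrm{ulim}_sa_s$, componentwise operations; "for $\mathcal D$-almost all $s$" means on a set in $\mathcal D$. For each $s$ let $\mathbb F_s$ be a field, $\mathfrak F_s=\mathbb F_s(t)$; $\mathfrak K=\prod_s\mathbb F_s/\mathcal D$, $\mathbb F=\mathfrak K(t)$, viewed inside $\mathcal U(\mathbb F)=\prod_s\mathfrak F_s/\mathcal D$ via $\sum_i(\mathrm{ulim}_sa_{i,s})t^i\mapsto\mathrm{ulim}_s\sum_ia_{i,s}t^i$. Fix algebraic closures $\mathfrak F_s^{alg}$; $\mathbb F^{alg}$ is the set of elements of $\prod_s\mathfrak F_s^{alg}/\mathcal D$ algebraic over $\mathbb F$, and $\mathbb F^{sep}\subseteq\mathbb F^{alg}$ the separable closure. For $\mathfrak L=\prod_s\mathfrak L_s/\mathcal D$ with $\mathfrak F_s\subseteq\mathfrak L_s\subseteq\mathfrak F_s^{alg}$, the algebraic part is $\mathfrak L_{alg}=\mathfrak L\cap\mathbb F^{alg}$ and the separable part is $\mathfrak L_{sep}=\mathfrak L\cap\mathbb F^{sep}$. *)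

theory Defs
  imports "HOL-Algebra.Algebraic_Closure" "HOL-Algebra.Generated_Fields"
    "HOL-Computational_Algebra.Primes"
begin

text \<open>The index set S is the universe of the type 's (assumed infinite in the theorem);
  an ultrafilter on S is a filter D on 's that is proper and decides every subset.
  "For D-almost all s" is "eventually P D".\<close>

definition is_ultrafilter :: "'s filter \<Rightarrow> bool" where
  "is_ultrafilter D \<longleftrightarrow> D \<noteq> bot \<and> (\<forall>P. eventually P D \<or> eventually (\<lambda>s. \<not> P s) D)"

definition nonprincipal :: "'s filter \<Rightarrow> bool" where
  "nonprincipal D \<longleftrightarrow> (\<forall>a. \<not> eventually (\<lambda>s. s = a) D)"

definition ucls :: "'s filter \<Rightarrow> ('s \<Rightarrow> 'b) \<Rightarrow> ('s \<Rightarrow> 'b) set" where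
  "ucls D f = {g. eventually (\<lambda>s. g s = f s) D}"

definition ultraprod :: "'s filter \<Rightarrow> ('s \<Rightarrow> 'b ring) \<Rightarrow> ('s \<Rightarrow> 'b) set ring" where
  "ultraprod D R =
    \<lparr> carrier = {ucls D f | f. \<forall>s. f s \<in> carrier (R s)},
      monoid.mult = (\<lambda>A B. {h. \<exists>f\<in>A. \<exists>g\<in>B. eventually (\<lambda>s. h s = f s \<otimes>\<^bsub>R s\<^esub> g s) D}),
      one = ucls D (\<lambda>s. \<one>\<^bsub>R s\<^esub>),
      zero = ucls D (\<lambda>s. \<zero>\<^bsub>R s\<^esub>),
      add = (\<lambda>A B. {h. \<exists>f\<in>A. \<exists>g\<in>B. eventually (\<lambda>s. h s = f s \<oplus>\<^bsub>R s\<^esub> g s) D}) \<rparr>"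

definition ultraset :: "'s filter \<Rightarrow> ('s \<Rightarrow> 'b ring) \<Rightarrow> ('s \<Rightarrow> 'b set) \<Rightarrow> ('s \<Rightarrow> 'b) set set" where
  "ultraset D R L = {ucls D f | f. (\<forall>s. f s \<in> carrier (R s)) \<and> eventually (\<lambda>s. f s \<in> L s) D}"

text \<open>Here K s is (a copy of) the field F_s and t s the transcendental t, both inside the
  algebraically closed field \<Omega> s = F_s(t)^alg.  The element
  \<Sum>_i (ulim a_i) t^i / \<Sum>_i (ulim b_i) t^i of \<KK>(t) is mapped to
  ulim_s (\<Sum>_i a_{i,s} t^i) / (\<Sum>_i b_{i,s} t^i); the denominator is nonzero in \<KK>[t]
  iff some coefficient ulim b_i is nonzero, i.e. b_{i,s} \<noteq> 0 for D-almost all s.\<close>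
definition ratfun_embed ::
  "'s filter \<Rightarrow> ('s \<Rightarrow> 'b ring) \<Rightarrow> ('s \<Rightarrow> 'b set) \<Rightarrow> ('s \<Rightarrow> 'b) \<Rightarrow> ('s \<Rightarrow> 'b) set set" where
  "ratfun_embed D \<Omega> K t =
    {ucls D (\<lambda>s. (\<Oplus>\<^bsub>\<Omega> s\<^esub> i\<in>{..n}. a i s \<otimes>\<^bsub>\<Omega> s\<^esub> (t s [^]\<^bsub>\<Omega> s\<^esub> i))
                 \<otimes>\<^bsub>\<Omega> s\<^esub> inv\<^bsub>\<Omega> s\<^esub> (\<Oplus>\<^bsub>\<Omega> s\<^esub> i\<in>{..n}. b i s \<otimes>\<^bsub>\<Omega> s\<^esub> (t s [^]\<^bsub>\<Omega> s\<^esub> i)))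
     | (n::nat) a b. (\<forall>i s. a i s \<in> K s \<and> b i s \<in> K s) \<and> (\<exists>i\<le>n. eventually (\<lambda>s. b i s \<noteq> \<zero>\<^bsub>\<Omega> s\<^esub>) D)}"

definition ratfun_field :: "'b ring \<Rightarrow> 'b set \<Rightarrow> 'b \<Rightarrow> 'b set" where
  "ratfun_field \<Omega> K t = generate_field \<Omega> (K \<union> {t})"

text \<open>An element x of R is separable over the subfield K if it is algebraic over K and its
  minimal polynomial (Irr K x) has no multiple root in R (R will be algebraically closed).\<close>
definition separable_elem :: "'b ring \<Rightarrow> 'b set \<Rightarrow> 'b \<Rightarrow> bool" where
  "separable_elem R K x \<longleftrightarrow> \<not> ring.transcendental R K x \<and>
     (\<forall>a\<in>carrier R. ring.alg_mult R (ring.Irr R K x) a \<le> 1)"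

definition char_of :: "'b ring \<Rightarrow> nat" where
  "char_of R = (if \<exists>n::nat>0. [n] \<cdot>\<^bsub>R\<^esub> \<one>\<^bsub>R\<^esub> = \<zero>\<^bsub>R\<^esub>
                then (LEAST n::nat. n > 0 \<and> [n] \<cdot>\<^bsub>R\<^esub> \<one>\<^bsub>R\<^esub> = \<zero>\<^bsub>R\<^esub>) else 0)"

definition alg_closure_in :: "('s \<Rightarrow> 'b) set ring \<Rightarrow> ('s \<Rightarrow> 'b) set set \<Rightarrow> ('s \<Rightarrow> 'b) set set" where
  "alg_closure_in U F = {x \<in> carrier U. \<not> ring.transcendental U F x}"

definition sep_closure_in :: "('s \<Rightarrow> 'b) set ring \<Rightarrow> ('s \<Rightarrow> 'b) set set \<Rightarrow> ('s \<Rightarrow> 'b) set set" where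
  "sep_closure_in U F = {x \<in> alg_closure_in U F. separable_elem U F x}"

end

theory Submission
  imports Defs
begin

text \<open>The key point is that elements of a finite extension of \<KK>(t) inside the ultraproduct
  which are linearly independent over \<KK>(t) have components that are linearly independent over
  K_s(t_s) for almost all s.  Let w_1, ..., w_M be a basis of such an extension, scaled so that every
  product w_i w_j is a combination of the w_k with coefficients in \<KK>[t] of degree at most c.  For
  every fixed B the elements t^a w_i with a at most B are almost everywhere independent over K_s.
  Choose B with M(B+1) > (M-1)(B+c+1) and put r = B+c+1.  If the w_i spanned a space of dimension less
  than M over K_s(t_s), then R = K_s[t_s] w_1 + ... + K_s[t_s] w_M would have dim R/t^r R at most
  (M-1)r < M(B+1), so some nonzero combination f of the t^a w_i with a at most B would be t^r g with g in R.
  But f^k = t^(rk) g^k has degree at most k(r-1) + B, which for large k contradicts that g^k lies in R.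

  Hence the degrees of the finite subextensions of the algebraic part divide n_s for almost all s,
  so they are bounded in case (i).  If x is inseparable, then the characteristic is a prime p,
  which settles (iii), and some powers of x are independent over \<KK>(t) while their p-th powers are
  dependent.  For the components of x this is excluded by MacLane's criterion when they are separable,
  which settles (ii).  The same criterion shows that the separable elements form a field.\<close>

section \<open>Spans with coefficients in a subset\<close>

text \<open>The obstacle is degree. Los's theorem transfers a relation only if its length and its
  degree are fixed in advance, and K(t) sits inside the ultraproduct of the K_s(t_s) as a part that
  is in general smaller: elements of that ultraproduct may have components whose degrees have no
  common bound. So independence over K(t) only says that, for each prescribed degree, almost all
  components satisfy no relation of that degree. In general this is too weak: if n_s exceeds every
  fixed bound for almost all s, then 1 and the class of t_s^(n_s) are independent over K(t),
  although their components are dependent for every s. What rescues finite extensions is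
  multiplication: for a list whose products stay in its own span, one suitable degree already
  excludes all relations. The opposite passage, from the components to the ultraproduct, meets no
  such obstacle, because freeness over a larger set of coefficients is the stronger
  statement.\<close>

context cring
begin

lemma Span_Nil [simp]: "Span A [] = {\<zero>}"
  by simp

text \<open>The coefficient set is arbitrary here. The sets that matter consist of polynomials of
  bounded degree, which form an additive group but no ring. Hence additive closure appears below as
  a \<open>subgroup\<close> hypothesis, and multiplication leads into another coefficient
  set.\<close>

lemma Span_Cons_iff:
  "v \<in> Span A (w # ws) \<longleftrightarrow> (\<exists>a \<in> A. \<exists>u \<in> Span A ws. v = a \<otimes> w \<oplus> u)"
  by (simp add: line_extension_mem_iff)

lemma Span_Cons: "Span A (w # ws) = line_extension A w (Span A ws)"
  by simp

declare Span.simps [simp del]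

lemma Span_mono:
  "A \<subseteq> B \<Longrightarrow> Span A ws \<subseteq> Span B ws"
  by (induction ws) (auto simp: Span_Cons_iff, blast)

lemma Span_zero:
  assumes "\<zero> \<in> A" "set ws \<subseteq> carrier R"
  shows "\<zero> \<in> Span A ws"
  using assms(2)
proof (induction ws)
  case (Cons w ws)
  then have "\<zero> = \<zero> \<otimes> w \<oplus> \<zero>" "\<zero> \<in> Span A ws" by auto
  then show ?case unfolding Span_Cons_iff using assms(1) by blast
qed simp

lemma Span_smult:
  assumes "\<And>a. a \<in> A \<Longrightarrow> b \<otimes> a \<in> C" and "b \<in> carrier R" "A \<subseteq> carrier R" "set ws \<subseteq> carrier R"
    and "v \<in> Span A ws"
  shows "b \<otimes> v \<in> Span C ws"
  using assms(4,5)
proof (induction ws arbitrary: v)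
  case (Cons w ws)
  then obtain a u where au: "a \<in> A" "u \<in> Span A ws" "v = a \<otimes> w \<oplus> u"
    unfolding Span_Cons_iff by blast
  moreover have "u \<in> carrier R" "a \<in> carrier R" "w \<in> carrier R"
    using au Cons.prems(1) Span_in_carrier[OF assms(3), of ws] assms(3) by auto
  ultimately have "b \<otimes> v = (b \<otimes> a) \<otimes> w \<oplus> b \<otimes> u"
    using assms(2) by (simp add: r_distr m_assoc)
  moreover have "b \<otimes> a \<in> C" "b \<otimes> u \<in> Span C ws" using au assms(1) Cons by auto
  ultimately show ?case unfolding Span_Cons_iff by blast
qed (use assms in simp)

lemma Span_is_subgroup:
  assumes "subgroup A (add_monoid R)" "set ws \<subseteq> carrier R"
  shows "subgroup (Span A ws) (add_monoid R)"
  using assms(2)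
proof (induction ws)
  case Nil
  then show ?case using normal_imp_subgroup[OF add.one_is_normal] by simp
next
  case (Cons w ws)
  then have IH: "subgroup (Span A ws) (add_monoid R)" and w: "w \<in> carrier R" by auto
  have "subgroup (A #> w) (add_monoid R)"
  proof (rule add.subgroupI)
    show "A #> w \<subseteq> carrier R" 
      using add.subgroupE(1)[OF assms(1)] w by (auto simp: r_coset_def)
    show "A #> w \<noteq> {}" using add.subgroupE(2)[OF assms(1)] by (auto simp: r_coset_def)
  next
    fix x assume "x \<in> A #> w"
    then obtain a where "a \<in> A" "x = a \<otimes> w" by (auto simp: r_coset_def)
    then show "\<ominus> x \<in> A #> w"
      using add.subgroupE(1,3)[OF assms(1)] w by (auto simp: r_coset_def intro!: bexI[of _ "\<ominus> a"] l_minus[symmetric])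
  next
    fix x y assume "x \<in> A #> w" "y \<in> A #> w"
    then obtain a b where "a \<in> A" "x = a \<otimes> w" "b \<in> A" "y = b \<otimes> w" by (auto simp: r_coset_def)
    then show "x \<oplus> y \<in> A #> w"
      using add.subgroupE(1,4)[OF assms(1)] w
      by (auto simp: r_coset_def intro!: bexI[of _ "a \<oplus> b"] l_distr[symmetric])
  qed
  with IH show ?case
    by (simp add: Span_Cons line_extension_def set_add_def add.mult_subgroups)
qed

lemma Span_mem:
  assumes "\<zero> \<in> A" "A \<subseteq> carrier R" "set ws \<subseteq> carrier R" "w \<in> set ws" "a \<in> A"
  shows "a \<otimes> w \<in> Span A ws"
  using assms(3,4)
proof (induction ws)
  case (Cons u us)
  have ac: "a \<in> carrier R" using assms by auto
  show ?case
  proof (cases "w = u")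
    case True
    have "a \<otimes> w = a \<otimes> u \<oplus> \<zero>" using True ac Cons.prems by auto
    moreover have "\<zero> \<in> Span A us" using Span_zero assms(1) Cons.prems by simp
    ultimately show ?thesis unfolding Span_Cons_iff using assms(5) by blast
  next
    case False
    then have "a \<otimes> w \<in> Span A us" using Cons by auto
    moreover have "a \<otimes> w = \<zero> \<otimes> u \<oplus> a \<otimes> w" using ac Cons.prems by auto
    ultimately show ?thesis unfolding Span_Cons_iff using assms(1) by blast
  qed
qed simp

text \<open>Three coefficient sets keep track of degrees: if A and B are the polynomials of degree
  at most m and n, then C is the set for m + n. Since the coefficients pass through, only the
  generators \<open>ws\<close> have to be multiplied by x.\<close>

lemma Span_mult:
  assumes A: "A \<subseteq> carrier R" and B: "B \<subseteq> carrier R" and C: "subgroup C (add_monoid R)"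
    and AB: "\<And>a b. a \<in> A \<Longrightarrow> b \<in> B \<Longrightarrow> a \<otimes> b \<in> C"
    and ws: "set ws \<subseteq> carrier R" and us: "set us \<subseteq> carrier R" and x: "x \<in> carrier R"
    and mult: "\<And>w. w \<in> set ws \<Longrightarrow> w \<otimes> x \<in> Span B us"
    and v: "v \<in> Span A ws"
  shows "v \<otimes> x \<in> Span C us"
  using ws mult v
proof (induction ws arbitrary: v)
  case Nil
  then show ?case using x Span_zero[OF _ us] subgroup.one_closed[OF C] by simp
next
  case (Cons w ws)
  then obtain a u where au: "a \<in> A" "u \<in> Span A ws" "v = a \<otimes> w \<oplus> u"
    unfolding Span_Cons_iff by blast
  have cs: "u \<in> carrier R" "a \<in> carrier R" "w \<in> carrier R"
    using au Cons.prems(1) Span_in_carrier[OF A, of ws] A by auto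
  then have "v \<otimes> x = a \<otimes> (w \<otimes> x) \<oplus> u \<otimes> x"
    using au x by (simp add: l_distr m_assoc)
  moreover have "a \<otimes> (w \<otimes> x) \<in> Span C us"
    using Span_smult[of B a C us "w \<otimes> x"] AB au cs B us Cons.prems(2) by auto
  moreover have "u \<otimes> x \<in> Span C us" using Cons au by auto
  ultimately show ?case using add.subgroupE(4)[OF Span_is_subgroup[OF C us]] by simp
qed

lemma combine_in_Span:
  "length qs = length ws \<Longrightarrow> set qs \<subseteq> A \<Longrightarrow> combine qs ws \<in> Span A ws"
proof (induction qs ws rule: list_induct2)
  case (Cons q qs w ws)
  then show ?case by (simp only: Span_Cons_iff combine.simps) auto
qed simp

lemma Span_imp_combine:
  "v \<in> Span A ws \<Longrightarrow> \<exists>qs. length qs = length ws \<and> set qs \<subseteq> A \<and> v = combine qs ws"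
proof (induction ws arbitrary: v)
  case (Cons w ws)
  then obtain a u where au: "a \<in> A" "u \<in> Span A ws" "v = a \<otimes> w \<oplus> u"
    unfolding Span_Cons_iff by blast
  with Cons obtain qs where "length qs = length ws" "set qs \<subseteq> A" "u = combine qs ws" by blast
  with au show ?case by (intro exI[of _ "a # qs"]) auto
qed simp

text \<open>For a subfield A this is linear independence over A.  It also makes sense for the set A of
  polynomials in t of degree at most n, where it only excludes relations of bounded degree.\<close>

fun free_over :: "'a set \<Rightarrow> 'a list \<Rightarrow> bool" where
  "free_over A [] \<longleftrightarrow> True"
| "free_over A (w # ws) \<longleftrightarrow> (\<forall>a \<in> A. a \<otimes> w \<in> Span A ws \<longrightarrow> a = \<zero>) \<and> free_over A ws"

text \<open>The values at t of polynomials of degree at most n, in Horner form. A Horner step is one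
  linear expression p t + k, so induction on n splits off the constant term, and transfer to
  ultraproducts repeats a single step, \<open>us_linear\<close>.\<close>

primrec poly_vals :: "'a set \<Rightarrow> 'a \<Rightarrow> nat \<Rightarrow> 'a set" where
  "poly_vals K t 0 = K"
| "poly_vals K t (Suc n) = {p \<otimes> t \<oplus> k | p k. p \<in> poly_vals K t n \<and> k \<in> K}"

lemma poly_vals_carrier:
  "K \<subseteq> carrier R \<Longrightarrow> t \<in> carrier R \<Longrightarrow> poly_vals K t n \<subseteq> carrier R"
  by (induction n) auto

lemma free_over_mono: "B \<subseteq> A \<Longrightarrow> free_over A ws \<Longrightarrow> free_over B ws"
proof (induction ws)
  case (Cons w ws)
  then show ?case using subsetD[OF Span_mono[OF Cons.prems(1), of ws]] by auto
qed simp

end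

section \<open>Relations of bounded degree over a rational function field\<close>

locale transcendental_elem = field R + K: subfield K R for R (structure) and K +
  fixes t
  assumes t_closed [simp, intro]: "t \<in> carrier R"
    and t_transcendental: "transcendental K t"
begin

lemma K_subfield: "subfield K R" ..

abbreviation P :: "nat \<Rightarrow> 'a set" where "P \<equiv> poly_vals K t"
definition T :: "'a set" where "T = simple_extension K t"

lemma K_carrier: "K \<subseteq> carrier R" using subfieldE(3)[OF K_subfield] .

lemma T_subring: "subring T R"
  unfolding T_def using simple_extension_is_subring[OF subfieldE(1)[OF K_subfield] t_closed] .

lemmas K_ring = subringE[OF subfieldE(1)[OF K_subfield]]
lemmas T_ring = subringE[OF T_subring]

lemma K_in_T: "K \<subseteq> T"
  unfolding T_def using simple_extension_incl[OF K_carrier t_closed] .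

lemma t_in_T: "t \<in> T"
  unfolding T_def using simple_extension_mem[OF subfieldE(1)[OF K_subfield] t_closed] .

lemma subgroup_K: "subgroup K (add_monoid R)"
  using subring.axioms(1)[OF subfieldE(1)[OF K_subfield]] .

lemma subgroup_T: "subgroup T (add_monoid R)"
  using subring.axioms(1)[OF T_subring] .

lemma P_T: "P n \<subseteq> T"
proof (induction n)
  case (Suc n)
  then show ?case using K_in_T t_in_T T_ring(6,7) by (auto simp: poly_vals.simps(2)) blast
qed (simp add: K_in_T)

lemma P_carrier: "P n \<subseteq> carrier R" using P_T T_ring(1) by blast

lemma P_Suc_iff: "x \<in> P (Suc n) \<longleftrightarrow> (\<exists>p \<in> P n. \<exists>k \<in> K. x = p \<otimes> t \<oplus> k)" by auto

declare poly_vals.simps(2) [simp del]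

lemma subgroup_P: "subgroup (P n) (add_monoid R)"
proof (induction n)
  case 0 then show ?case by (simp add: subgroup_K)
next
  case (Suc n)
  note Pn = add.subgroupE[OF Suc] and Kn = add.subgroupE[OF subgroup_K]
  show ?case
  proof (rule add.subgroupI)
    show "P (Suc n) \<subseteq> carrier R" by (rule P_carrier)
    show "P (Suc n) \<noteq> {}" using Pn(2) Kn(2) P_Suc_iff by blast
  next
    fix x assume "x \<in> P (Suc n)"
    then obtain p k where pk: "p \<in> P n" "k \<in> K" "x = p \<otimes> t \<oplus> k" unfolding P_Suc_iff by blast
    then have "p \<in> carrier R" "k \<in> carrier R" using P_carrier K_carrier by auto
    then have "\<ominus> x = (\<ominus> p) \<otimes> t \<oplus> (\<ominus> k)" using pk t_closed by algebra
    then show "\<ominus> x \<in> P (Suc n)" unfolding P_Suc_iff using Pn(3) Kn(3) pk by blast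
  next
    fix x y assume "x \<in> P (Suc n)" "y \<in> P (Suc n)"
    then obtain p k p' k' where pk: "p \<in> P n" "k \<in> K" "x = p \<otimes> t \<oplus> k"
      "p' \<in> P n" "k' \<in> K" "y = p' \<otimes> t \<oplus> k'" unfolding P_Suc_iff by blast
    then have "p \<in> carrier R" "k \<in> carrier R" "p' \<in> carrier R" "k' \<in> carrier R"
      using P_carrier K_carrier by auto
    then have "x \<oplus> y = (p \<oplus> p') \<otimes> t \<oplus> (k \<oplus> k')" using pk t_closed by algebra
    then show "x \<oplus> y \<in> P (Suc n)" unfolding P_Suc_iff using Pn(4) Kn(4) pk by blast
  qed
qed

lemma P_zero: "\<zero> \<in> P n" using subgroup.one_closed[OF subgroup_P] by simp

lemma K_in_P: "K \<subseteq> P n"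
proof (cases n)
  case (Suc m)
  have "k = \<zero> \<otimes> t \<oplus> k" if "k \<in> K" for k using that K_carrier by auto
  then show ?thesis unfolding Suc using P_zero[of m] P_Suc_iff by blast
qed simp

lemma P_mono: "m \<le> n \<Longrightarrow> P m \<subseteq> P n"
proof (induction m arbitrary: n)
  case 0 then show ?case using K_in_P by simp
next
  case (Suc m)
  then obtain n' where n: "n = Suc n'" "m \<le> n'" by (metis Suc_le_D Suc_le_mono)
  with Suc have "P m \<subseteq> P n'" by simp
  then show ?case unfolding n(1) using P_Suc_iff by blast
qed

lemma P_times_t: "x \<in> P n \<Longrightarrow> x \<otimes> t \<in> P (Suc n)"
proof -
  assume x: "x \<in> P n"
  then have "x \<in> carrier R" using P_carrier by blast
  then have "x \<otimes> t = x \<otimes> t \<oplus> \<zero>" by simp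
  with x K_ring(2) show ?thesis unfolding P_Suc_iff by blast
qed

lemma P_times_K: "k \<in> K \<Longrightarrow> x \<in> P n \<Longrightarrow> k \<otimes> x \<in> P n"
proof (induction n arbitrary: x)
  case 0 then show ?case using K_ring(6) by simp
next
  case (Suc n)
  then obtain p l where pk: "p \<in> P n" "l \<in> K" "x = p \<otimes> t \<oplus> l" unfolding P_Suc_iff by blast
  then have c: "p \<in> carrier R" "k \<in> carrier R" "l \<in> carrier R" using P_carrier K_carrier Suc by auto
  have "k \<otimes> x = (k \<otimes> p) \<otimes> t \<oplus> k \<otimes> l"
    using pk(3) c t_closed by algebra
  then show ?case unfolding P_Suc_iff using Suc K_ring(6) pk by blast
qed

lemma P_mult: "x \<in> P m \<Longrightarrow> y \<in> P n \<Longrightarrow> x \<otimes> y \<in> P (m + n)"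
proof (induction m arbitrary: x)
  case 0 then show ?case using P_times_K by simp
next
  case (Suc m)
  then obtain p l where pk: "p \<in> P m" "l \<in> K" "x = p \<otimes> t \<oplus> l" unfolding P_Suc_iff by blast
  then have c: "p \<in> carrier R" "l \<in> carrier R" "y \<in> carrier R" using P_carrier K_carrier Suc by auto
  have "x \<otimes> y = (p \<otimes> y) \<otimes> t \<oplus> l \<otimes> y" using pk(3) c t_closed by algebra
  moreover have "(p \<otimes> y) \<otimes> t \<in> P (Suc (m + n))" using P_times_t Suc pk by blast
  moreover have "l \<otimes> y \<in> P (Suc (m + n))"
    using P_times_K[OF pk(2), OF subsetD[OF P_mono Suc.prems(2), of "Suc (m + n)"]] by simp
  ultimately show ?case using add.subgroupE(4)[OF subgroup_P] by simp
qed

lemma T_eq: "T = (\<Union>n. P n)"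
proof
  show "T \<subseteq> (\<Union>n. P n)"
  proof
    fix x assume "x \<in> T"
    then show "x \<in> (\<Union>n. P n)" unfolding T_def
    proof (induction rule: simple_extension.induct)
      case zero then show ?case using P_zero by blast
    next
      case (lin k1 k2)
      then obtain n where "k1 \<in> P n" by blast
      then show ?case using lin P_Suc_iff by (intro UN_I[of "Suc n"]) blast+
    qed
  qed
qed (use P_T in blast)

lemma T_in_P: assumes "x \<in> T" obtains n where "x \<in> P n" using assms T_eq by blast

text \<open>Later arguments use transcendence of t in this form. If the polynomial q has value p at
  t, then appending k to its coefficient list gives a polynomial vanishing at t. Nothing is left of
  it after normalization, so k is zero and q has no leading coefficient.\<close>

lemma horner_zero:
  assumes "p \<in> T" "k \<in> K" "p \<otimes> t \<oplus> k = \<zero>"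
  shows "p = \<zero>" "k = \<zero>"
proof -
  obtain q where q: "q \<in> carrier (K[X])" "p = eval q t"
    using assms(1) simple_extension_as_eval_img[OF K_carrier t_closed] unfolding T_def by blast
  have sq: "set q \<subseteq> K" using polynomial_incl q(1) univ_poly_carrier by blast
  then have sq': "set q \<subseteq> carrier R" using K_carrier by blast
  have "eval (normalize (q @ [k])) t = \<zero>"
    using eval_normalize[of "q @ [k]" t] eval_append_aux[OF sq' _ t_closed, of k] sq' assms K_carrier q
    by auto
  moreover have "normalize (q @ [k]) \<in> carrier (K[X])"
    using normalize_gives_polynomial[of "q @ [k]" K] sq assms(2) univ_poly_carrier by auto
  ultimately have nil: "normalize (q @ [k]) = []"
    using eval_transcendental[of K t] t_transcendental by (simp add: over_def)
  show "k = \<zero>"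
  proof -
    have "coeff (q @ [k]) 0 = \<zero>" using normalize_coeff[of "q @ [k]"] nil by simp
    then show ?thesis using append_coeff[of q "[k]"] by simp
  qed
  have "q = []"
  proof (rule ccontr)
    assume "q \<noteq> []"
    then have "lead_coeff q \<noteq> \<zero>" using q(1) unfolding univ_poly_carrier[symmetric] polynomial_def by auto
    then show False using nil \<open>q \<noteq> []\<close> by (cases q) auto
  qed
  then show "p = \<zero>" using q by simp
qed

lemma t_nonzero: "t \<noteq> \<zero>"
  using horner_zero[of \<one> \<zero>] T_ring(3) K_ring(2) by auto

end

section \<open>Combinations of list entries, scaling and dimension of spans\<close>

context cring
begin

lemma Span_least:
  assumes "subgroup Z (add_monoid R)" "\<And>a w. a \<in> A \<Longrightarrow> w \<in> set ws \<Longrightarrow> a \<otimes> w \<in> Z"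
  shows "Span A ws \<subseteq> Z"
  using assms(2)
proof (induction ws)
  case Nil
  then show ?case using subgroup.one_closed[OF assms(1)] by simp
next
  case (Cons w ws)
  then have "Span A ws \<subseteq> Z" "\<And>a. a \<in> A \<Longrightarrow> a \<otimes> w \<in> Z" by auto
  then show ?case using add.subgroupE(4)[OF assms(1)] unfolding Span_Cons_iff subset_iff by blast
qed

lemma combine_append_split:
  assumes "length as = length us" "set as \<subseteq> carrier R" "set us \<subseteq> carrier R"
    "set bs \<subseteq> carrier R" "set vs \<subseteq> carrier R" "x \<in> carrier R" "w \<in> carrier R"
  shows "combine (as @ x # bs) (us @ w # vs) = x \<otimes> w \<oplus> combine (as @ bs) (us @ vs)"
proof -
  have c: "combine as us \<in> carrier R" "combine bs vs \<in> carrier R" using assms by auto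
  have "combine (as @ x # bs) (us @ w # vs) = combine as us \<oplus> (x \<otimes> w \<oplus> combine bs vs)"
    using combine_append[of as us "x # bs" "w # vs"] assms by simp
  also have "\<dots> = x \<otimes> w \<oplus> (combine as us \<oplus> combine bs vs)"
    using c assms by (simp add: a_lcomm)
  finally show ?thesis using combine_append[of as us bs vs] assms by simp
qed

text \<open>No linearity of f and g is asked for: a splitting of each entry splits every combination
  with fixed coefficients. This permits remainders and quotients that are chosen entry by
  entry.\<close>

lemma combine_map_add_smult:
  assumes "set ks \<subseteq> carrier R" "set xs \<subseteq> V" "a \<in> carrier R"
    "\<And>x. x \<in> V \<Longrightarrow> f x \<in> carrier R" "\<And>x. x \<in> V \<Longrightarrow> g x \<in> carrier R"
    "\<And>x. x \<in> V \<Longrightarrow> x = f x \<oplus> a \<otimes> g x" "length ks = length xs"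
  shows "combine ks xs = combine ks (map f xs) \<oplus> a \<otimes> combine ks (map g xs)"
  using assms(7,1,2)
proof (induction ks xs rule: list_induct2)
  case Nil
  then show ?case using assms by simp
next
  case (Cons k ks x xs)
  have c: "f x \<in> carrier R" "g x \<in> carrier R" "k \<in> carrier R" using Cons.prems assms by auto
  have d: "combine ks (map f xs) \<in> carrier R" "combine ks (map g xs) \<in> carrier R"
    using Cons.prems assms(4,5) by (auto intro!: combine_in_carrier simp: subset_iff)
  have "combine (k # ks) (x # xs) =
      k \<otimes> (f x \<oplus> a \<otimes> g x) \<oplus> (combine ks (map f xs) \<oplus> a \<otimes> combine ks (map g xs))"
    using Cons assms(6)[of x] by simp
  also have "\<dots> = (k \<otimes> f x \<oplus> combine ks (map f xs)) \<oplus> a \<otimes> (k \<otimes> g x \<oplus> combine ks (map g xs))"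
    using c d assms(3) by algebra
  finally show ?case by simp
qed

end

context domain
begin

lemma Span_map_mult:
  assumes "K \<subseteq> carrier R" "set us \<subseteq> carrier R" "a \<in> carrier R"
  shows "Span K (map (\<lambda>x. x \<otimes> a) us) = (\<lambda>x. x \<otimes> a) ` Span K us"
  using assms(2)
proof (induction us)
  case Nil
  then show ?case using assms by simp
next
  case (Cons u us)
  have sub: "Span K us \<subseteq> carrier R" "K \<subseteq> carrier R"
    using Cons.prems assms(1) Span_in_carrier[OF assms(1), of us] by auto
  have eq: "k \<otimes> (u \<otimes> a) \<oplus> v \<otimes> a = (k \<otimes> u \<oplus> v) \<otimes> a" if "k \<in> K" "v \<in> Span K us" for k v
  proof -
    have "k \<in> carrier R" "v \<in> carrier R" "u \<in> carrier R" using that sub Cons.prems by auto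
    then show ?thesis using assms(3) by algebra
  qed
  show ?case
  proof (intro equalityI subsetI)
    fix x assume "x \<in> Span K (map (\<lambda>x. x \<otimes> a) (u # us))"
    then obtain k v where kv: "k \<in> K" "v \<in> Span K (map (\<lambda>x. x \<otimes> a) us)" "x = k \<otimes> (u \<otimes> a) \<oplus> v"
      unfolding list.map Span_Cons_iff by blast
    then obtain v' where "v' \<in> Span K us" "v = v' \<otimes> a" using Cons by auto
    with kv eq have "x = (k \<otimes> u \<oplus> v') \<otimes> a" "k \<otimes> u \<oplus> v' \<in> Span K (u # us)"
      unfolding Span_Cons_iff by auto
    then show "x \<in> (\<lambda>x. x \<otimes> a) ` Span K (u # us)" by blast
  next
    fix x assume "x \<in> (\<lambda>x. x \<otimes> a) ` Span K (u # us)"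
    then obtain y where "y \<in> Span K (u # us)" "x = y \<otimes> a" by (rule imageE)
    then obtain k v where kv: "k \<in> K" "v \<in> Span K us" "x = (k \<otimes> u \<oplus> v) \<otimes> a"
      unfolding Span_Cons_iff by blast
    then have "x = k \<otimes> (u \<otimes> a) \<oplus> v \<otimes> a" using eq by simp
    moreover have "v \<otimes> a \<in> Span K (map (\<lambda>x. x \<otimes> a) us)" using kv Cons by auto
    ultimately show "x \<in> Span K (map (\<lambda>x. x \<otimes> a) (u # us))"
      using kv unfolding list.map Span_Cons_iff by blast
  qed
qed

lemma independent_map_mult:
  assumes "subfield K R" "a \<in> carrier R" "a \<noteq> \<zero>" "independent K us"
  shows "independent K (map (\<lambda>x. x \<otimes> a) us)"
  using assms(4)
proof (induction us rule: list.induct)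
  case Nil
  show ?case by simp
next
  case (Cons u us)
  note u = independent_backwards[OF Cons.prems]
  have us: "set us \<subseteq> carrier R" using independent_in_carrier[OF u(2)] .
  have sub: "Span K us \<subseteq> carrier R" using us subfieldE(3)[OF assms(1)] Span_in_carrier by auto
  have "u \<otimes> a \<notin> Span K (map (\<lambda>x. x \<otimes> a) us)"
  proof
    assume "u \<otimes> a \<in> Span K (map (\<lambda>x. x \<otimes> a) us)"
    then obtain v where v: "v \<in> Span K us" "u \<otimes> a = v \<otimes> a"
      unfolding Span_map_mult[OF subfieldE(3)[OF assms(1)] us assms(2)] by blast
    then have "u = v" using m_rcancel[OF assms(3,2) u(3)] sub by blast
    with v u(1) show False by simp
  qed
  then show ?case using Cons.IH[OF u(2)] u(3) assms(2) li_Cons by simp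
qed

lemma independent_map_multD:
  assumes "subfield K R" "a \<in> carrier R"
  shows "set us \<subseteq> carrier R \<Longrightarrow> independent K (map (\<lambda>x. x \<otimes> a) us) \<Longrightarrow> independent K us"
proof (induction us rule: list.induct)
  case Nil
  show ?case by simp
next
  case (Cons u us)
  have i: "u \<otimes> a \<notin> Span K (map (\<lambda>x. x \<otimes> a) us)" "independent K (map (\<lambda>x. x \<otimes> a) us)"
    using independent_backwards(1,2)[of K "u \<otimes> a"] Cons.prems(2) by simp_all
  have us: "set us \<subseteq> carrier R" "u \<in> carrier R" using Cons.prems(1) by auto
  have "u \<notin> Span K us" using i(1) unfolding Span_map_mult[OF subfieldE(3)[OF assms(1)] us(1) assms(2)] by blast
  then show ?case using Cons.IH[OF us(1) i(2)] us(2) by (rule li_Cons[rotated])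
qed

lemma Span_dimension_le:
  assumes "subfield K R" "set us \<subseteq> carrier R"
  shows "\<exists>m \<le> length us. dimension m K (Span K us)"
  using assms(2)
proof (induction us)
  case Nil then show ?case by auto
next
  case (Cons u us)
  then obtain m where m: "m \<le> length us" "dimension m K (Span K us)" by auto
  show ?case
  proof (cases "u \<in> Span K us")
    case True
    have "Span K (u # us) = Span K us"
    proof
      show "Span K (u # us) \<subseteq> Span K us"
        using mono_Span_subset[OF assms(1), of "u # us" us] True Cons.prems
          Span_base_incl[OF assms(1), of us] by simp
      show "Span K us \<subseteq> Span K (u # us)" using mono_Span[OF assms(1)] Cons.prems by simp
    qed
    with m show ?thesis by (intro exI[of _ m]) auto
  next
    case False
    have "dimension (Suc m) K (Span K (u # us))"
      using Suc_dim[OF _ False m(2)] Cons.prems by (simp add: Span_Cons)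
    with m(1) show ?thesis by (intro exI[of _ "Suc m"]) auto
  qed
qed

end

section \<open>Divisibility by powers of t against bounds on the degree\<close>

context transcendental_elem
begin

lemma T_carrier: "T \<subseteq> carrier R" using T_ring(1) .

lemma T_Suc: "q \<in> T \<Longrightarrow> \<exists>q' \<in> T. \<exists>k \<in> K. q = q' \<otimes> t \<oplus> k"
proof -
  assume "q \<in> T"
  then obtain n where "q \<in> P n" by (rule T_in_P)
  then have "q \<in> P (Suc n)" using P_mono[of n "Suc n"] by auto
  then show ?thesis unfolding P_Suc_iff using P_T by blast
qed

lemma t_pow_nonzero: "t [^] (m::nat) \<noteq> \<zero>"
  by (induction m) (auto simp: integral_iff t_nonzero)

lemma T_pow: "t [^] (m::nat) \<in> T"
  by (induction m) (auto simp: T_ring(3,6) t_in_T)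

text \<open>A nonzero polynomial is not divisible by a power of t beyond its degree. Each induction
  step removes the constant term by \<open>horner_zero\<close> and cancels one factor t, which
  lowers m and n together.\<close>

lemma pow_t_mult_in_P:
  assumes "q \<in> T" "t [^] m \<otimes> q \<in> P n" "n < m"
  shows "q = \<zero>"
  using assms(2,3)
proof (induction n arbitrary: m)
  case 0
  then obtain m' where m: "m = Suc m'" by (cases m) auto
  have q: "q \<in> carrier R" using assms T_carrier by blast
  define k where "k = t [^] m \<otimes> q"
  have k: "k \<in> K" using 0 k_def by simp
  then have kc: "k \<in> carrier R" using K_carrier by blast
  have "(t [^] m' \<otimes> q) \<otimes> t = k" unfolding k_def m using q by (simp add: m_ac)
  then have "(t [^] m' \<otimes> q) \<otimes> t \<oplus> (\<ominus> k) = \<zero>" using kc r_neg by simp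
  moreover have "t [^] m' \<otimes> q \<in> T" using T_pow assms(1) T_ring(6) by blast
  ultimately have "t [^] m' \<otimes> q = \<zero>" using horner_zero(1) K_ring(5)[OF k] by blast
  then show ?case using integral_iff[of "t [^] m'" q] q t_pow_nonzero by auto
next
  case (Suc n)
  then obtain m' where m: "m = Suc m'" "n < m'" by (cases m) auto
  have q: "q \<in> carrier R" using assms T_carrier by blast
  obtain p k where pk: "p \<in> P n" "k \<in> K" "t [^] m \<otimes> q = p \<otimes> t \<oplus> k"
    using Suc.prems unfolding P_Suc_iff by blast
  then have c: "p \<in> carrier R" "k \<in> carrier R" using P_carrier K_carrier by auto
  define x where "x = t [^] m' \<otimes> q"
  have x: "x \<in> carrier R" using q x_def by simp
  have "x \<in> T" unfolding x_def using T_pow assms(1) T_ring(6) by blast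
  then have d: "x \<oplus> (\<ominus> p) \<in> T" using T_ring(5,7) pk(1) P_T by blast
  have "x \<otimes> t = p \<otimes> t \<oplus> k" using pk(3) q unfolding m x_def by (simp add: m_ac)
  then have "(x \<oplus> (\<ominus> p)) \<otimes> t \<oplus> (\<ominus> k) = \<zero>" using x c t_closed by algebra
  then have "x \<oplus> (\<ominus> p) = \<zero>" using horner_zero(1)[OF d K_ring(5)[OF pk(2)]] by simp
  then have "x = p" using x c minus_equality minus_minus by (metis add.inv_closed)
  then show ?case using Suc.IH[of m'] m pk x_def by simp
qed

lemma finite_Span_T_in_P:
  assumes "finite W"
  shows "W \<subseteq> Span T ws \<Longrightarrow> \<exists>n. W \<subseteq> Span (P n) ws"
  using assms
proof induction
  case (insert x W)
  have "\<exists>e. v \<in> Span (P e) us" if "v \<in> Span T us" for v us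
    using that
  proof (induction us arbitrary: v)
    case (Cons u us)
    then obtain b x where bx: "b \<in> T" "x \<in> Span T us" "v = b \<otimes> u \<oplus> x" unfolding Span_Cons_iff by blast
    obtain e e' where e: "b \<in> P e" "x \<in> Span (P e') us" using Cons.IH[OF bx(2)] T_in_P[OF bx(1)] by metis
    have "b \<in> P (max e e')" "x \<in> Span (P (max e e')) us"
      using subsetD[OF P_mono e(1)] subsetD[OF Span_mono[OF P_mono] e(2)] by auto
    then show ?case using bx(3) unfolding Span_Cons_iff by blast
  qed auto
  then obtain e where e: "x \<in> Span (P e) ws" using insert.prems by blast
  obtain n where n: "W \<subseteq> Span (P n) ws" using insert by blast
  have "insert x W \<subseteq> Span (P (max e n)) ws"
    using subsetD[OF Span_mono[OF P_mono] e, of "max e n"] subset_trans[OF n Span_mono[OF P_mono], of "max e n"] by simp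
  then show ?case by blast
qed simp

text \<open>The list may be dependent over K(t), so coefficients are not unique and n < m alone is
  not enough; C absorbs the loss. If a nonzero multiple a w lies in the span of the other entries,
  multiplying by a eliminates w and raises degrees by a constant. Otherwise the coefficient of w is
  unique and \<open>pow_t_mult_in_P\<close> applies to it.\<close>

lemma Span_pow_gap:
  assumes "set ws \<subseteq> carrier R"
  shows "\<exists>C. \<forall>n m y. y \<in> Span T ws \<longrightarrow> t [^] m \<otimes> y \<in> Span (P n) ws \<longrightarrow> n + C < m \<longrightarrow> y = \<zero>"
  using assms
proof (induction ws)
  case Nil
  then show ?case by auto
next
  case (Cons w ws)
  then obtain C where "\<forall>n m y. y \<in> Span T ws \<longrightarrow> t [^] m \<otimes> y \<in> Span (P n) ws \<longrightarrow> n + C < m \<longrightarrow> y = \<zero>"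
    by auto
  then have C: "\<And>n m y. \<lbrakk>y \<in> Span T ws; t [^] m \<otimes> y \<in> Span (P n) ws; n + C < m\<rbrakk> \<Longrightarrow> y = \<zero>"
    by blast
  have w: "w \<in> carrier R" and ws: "set ws \<subseteq> carrier R" using Cons.prems by auto
  note ST = Span_in_carrier[OF T_carrier ws] and SP = Span_in_carrier[OF P_carrier ws]
  note SgT = add.subgroupE[OF Span_is_subgroup[OF subgroup_T ws]]
  note SgP = add.subgroupE[OF Span_is_subgroup[OF subgroup_P ws]]
  have PT: "Span (P n) ws \<subseteq> Span T ws" for n using Span_mono[OF P_T] .
  have smultT: "a \<otimes> v \<in> Span T ws" if "a \<in> T" "v \<in> Span T ws" for a v
    using Span_smult[of T a T ws v] that T_ring(6) T_carrier ws by blast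
  show ?case
  proof (cases "\<exists>a \<in> T. a \<noteq> \<zero> \<and> a \<otimes> w \<in> Span T ws")
    case True
    then obtain a where a: "a \<in> T" "a \<noteq> \<zero>" "a \<otimes> w \<in> Span T ws" by blast
    \<comment> \<open>One e bounds the degree of a and the degrees of the coefficients of a w, so
      multiplication by a raises the bound n to n + e in both summands.\<close>
    have "\<exists>e. a \<otimes> w \<in> Span (P e) ws \<and> a \<in> P e"
    proof -
      obtain e where "a \<otimes> w \<in> Span (P e) ws" using finite_Span_T_in_P[of "{a \<otimes> w}" ws] a(3) by auto
      moreover obtain e' where "a \<in> P e'" using a T_in_P by meson
      ultimately show ?thesis using P_mono[of e' "max e e'"] Span_mono[OF P_mono[of e "max e e'"], of ws]
        by (intro exI[of _ "max e e'"]) auto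
    qed
    then obtain e where e: "a \<otimes> w \<in> Span (P e) ws" "a \<in> P e" by blast
    have ac: "a \<in> carrier R" using a T_carrier by blast
    have "y = \<zero>" if y: "y \<in> Span T (w # ws)" "t [^] m \<otimes> y \<in> Span (P n) (w # ws)" "n + (C + e) < m" for n m y
    proof -
      obtain b x where bx: "b \<in> T" "x \<in> Span T ws" "y = b \<otimes> w \<oplus> x" using y(1) unfolding Span_Cons_iff by blast
      obtain b' x' where bx': "b' \<in> P n" "x' \<in> Span (P n) ws" "t [^] m \<otimes> y = b' \<otimes> w \<oplus> x'"
        using y(2) unfolding Span_Cons_iff by blast
      have c: "b \<in> carrier R" "x \<in> carrier R" "b' \<in> carrier R" "x' \<in> carrier R" "y \<in> carrier R"
      proof -
        show "b \<in> carrier R" "x \<in> carrier R" "b' \<in> carrier R" "x' \<in> carrier R"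
          using bx(1,2) bx'(1,2) ST SP T_carrier P_carrier by blast+
        then show "y \<in> carrier R" using bx(3) w by simp
      qed
      have "a \<otimes> y = b \<otimes> (a \<otimes> w) \<oplus> a \<otimes> x" using bx c ac w by algebra
      then have 1: "a \<otimes> y \<in> Span T ws" using smultT a bx SgT(4) by simp
      have "t [^] m \<otimes> (a \<otimes> y) = a \<otimes> (t [^] m \<otimes> y)" using c ac by (simp add: m_lcomm)
      also have "\<dots> = b' \<otimes> (a \<otimes> w) \<oplus> a \<otimes> x'" unfolding bx'(3) using c ac w by algebra
      also have "\<dots> \<in> Span (P (n + e)) ws"
      proof (rule SgP(4))
        show "b' \<otimes> (a \<otimes> w) \<in> Span (P (n + e)) ws"
          using Span_smult[of "P e" b' "P (n + e)" ws "a \<otimes> w"] P_mult[OF bx'(1)] c P_carrier ws e by blast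
        show "a \<otimes> x' \<in> Span (P (n + e)) ws"
          using Span_smult[of "P n" a "P (n + e)" ws x'] P_mult[OF e(2), of _ n] ac P_carrier ws bx'
          by (simp add: add.commute)
      qed
      finally have "a \<otimes> y = \<zero>" using C[OF 1, of m "n + e"] y(3) by simp
      then show "y = \<zero>" using a ac c integral by blast
    qed
    then show ?thesis by (intro exI[of _ "C + e"]) auto
  next
    case False
    have "y = \<zero>" if y: "y \<in> Span T (w # ws)" "t [^] m \<otimes> y \<in> Span (P n) (w # ws)" "n + C < m" for n m y
    proof -
      obtain b x where bx: "b \<in> T" "x \<in> Span T ws" "y = b \<otimes> w \<oplus> x" using y(1) unfolding Span_Cons_iff by blast
      obtain b' x' where bx': "b' \<in> P n" "x' \<in> Span (P n) ws" "t [^] m \<otimes> y = b' \<otimes> w \<oplus> x'"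
        using y(2) unfolding Span_Cons_iff by blast
      have c: "b \<in> carrier R" "x \<in> carrier R" "b' \<in> carrier R" "x' \<in> carrier R" "y \<in> carrier R"
        "t [^] m \<in> carrier R"
      proof -
        show "b \<in> carrier R" "x \<in> carrier R" "b' \<in> carrier R" "x' \<in> carrier R"
          using bx(1,2) bx'(1,2) ST SP T_carrier P_carrier by blast+
        then show "y \<in> carrier R" "t [^] m \<in> carrier R" using bx(3) w by simp_all
      qed
      \<comment> \<open>Two expressions for t^m y are compared. The difference of the two
        coefficients of w carries w into the span of the other entries, so in the present case it
        vanishes.\<close>
      have "(t [^] m \<otimes> b \<oplus> \<ominus> b') \<otimes> w = x' \<oplus> \<ominus> (t [^] m \<otimes> x)"
      proof -
        have "(t [^] m \<otimes> b \<oplus> \<ominus> b') \<otimes> w =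
            t [^] m \<otimes> (b \<otimes> w \<oplus> x) \<oplus> \<ominus> (b' \<otimes> w) \<oplus> \<ominus> (t [^] m \<otimes> x)"
          using c w by algebra
        also have "t [^] m \<otimes> (b \<otimes> w \<oplus> x) = b' \<otimes> w \<oplus> x'" using bx bx' by simp
        also have "(b' \<otimes> w \<oplus> x') \<oplus> \<ominus> (b' \<otimes> w) \<oplus> \<ominus> (t [^] m \<otimes> x) = x' \<oplus> \<ominus> (t [^] m \<otimes> x)"
          using c w by algebra
        finally show ?thesis .
      qed
      moreover have "x' \<oplus> \<ominus> (t [^] m \<otimes> x) \<in> Span T ws"
        using SgT(3,4) smultT[OF T_pow bx(2)] bx'(2) PT by blast
      moreover have "t [^] m \<otimes> b \<oplus> \<ominus> b' \<in> T" using T_pow bx bx' T_ring(5,6,7) P_T by blast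
      ultimately have "t [^] m \<otimes> b \<oplus> \<ominus> b' = \<zero>" using False by auto
      then have e: "t [^] m \<otimes> b = b'" using c by (metis m_closed minus_equality minus_minus add.inv_closed)
      then have b: "b = \<zero>" using pow_t_mult_in_P[OF bx(1), of m n] bx'(1) y(3) by simp
      then have yx: "y = x" using bx c w by simp
      moreover have "b' = \<zero>" using e b c by simp
      then have "t [^] m \<otimes> x = x'" using bx'(3) yx c w by simp
      ultimately show "y = \<zero>" using C[OF bx(2), of m n] bx'(2) y(3) by simp
    qed
    then show ?thesis by (intro exI[of _ C]) auto
  qed
qed

lemma Span_T_smult:
  assumes "a \<in> T" "v \<in> Span T ws" "set ws \<subseteq> carrier R"
  shows "a \<otimes> v \<in> Span T ws"
  using Span_smult[of T a T ws v] assms T_ring(6) T_carrier by blast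

lemma combine_relation_split:
  assumes "length qs = length ws" "set qs \<subseteq> T" "set ws \<subseteq> carrier R" "combine qs ws = \<zero>" "x \<in> set qs"
  shows "\<exists>us w vs. ws = us @ w # vs \<and> x \<otimes> w \<in> Span T (us @ vs)"
proof -
  obtain as bs where qs: "qs = as @ x # bs" using split_list[OF assms(5)] by blast
  define us where "us = take (length as) ws"
  define w where "w = ws ! length as"
  define vs where "vs = drop (Suc (length as)) ws"
  have l: "length as < length ws" using qs assms(1) by simp
  then have ws: "ws = us @ w # vs" unfolding us_def w_def vs_def by (rule id_take_nth_drop)
  have lu: "length as = length us" "length bs = length vs" using l qs assms(1) unfolding us_def vs_def by auto
  have c: "set as \<subseteq> carrier R" "set bs \<subseteq> carrier R" "x \<in> carrier R" "set us \<subseteq> carrier R"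
    "set vs \<subseteq> carrier R" "w \<in> carrier R" using assms(2,3) qs ws T_carrier by auto
  have "x \<otimes> w \<oplus> combine (as @ bs) (us @ vs) = \<zero>"
    using combine_append_split[of as us bs vs x w] lu c assms(4) qs ws by simp
  then have "x \<otimes> w = \<ominus> combine (as @ bs) (us @ vs)"
    using c by (intro minus_equality[symmetric]) auto
  moreover have "combine (as @ bs) (us @ vs) \<in> Span T (us @ vs)"
    using combine_in_Span[of "as @ bs" "us @ vs" T] lu qs assms(2) by simp
  ultimately have "x \<otimes> w \<in> Span T (us @ vs)"
    using add.subgroupE(3)[OF Span_is_subgroup[OF subgroup_T, of "us @ vs"]] c by auto
  then show ?thesis using ws by blast
qed

text \<open>Dividing a relation by the largest possible power of t leaves a coefficient whose constant term
  k does not vanish.\<close>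

lemma primitive_relation:
  assumes "set ws \<subseteq> carrier R"
  shows "length qs = length ws \<Longrightarrow> set qs \<subseteq> P n \<Longrightarrow> combine qs ws = \<zero> \<Longrightarrow> \<exists>q \<in> set qs. q \<noteq> \<zero> \<Longrightarrow>
    \<exists>us w vs k q. ws = us @ w # vs \<and> k \<in> K \<and> k \<noteq> \<zero> \<and> q \<in> T \<and> (q \<otimes> t \<oplus> k) \<otimes> w \<in> Span T (us @ vs)"
proof (induction n arbitrary: qs)
  case 0
  then obtain k where k: "k \<in> set qs" "k \<noteq> \<zero>" by blast
  then have kK: "k \<in> K" using 0 by auto
  obtain us w vs where *: "ws = us @ w # vs" "k \<otimes> w \<in> Span T (us @ vs)"
    using combine_relation_split[of qs ws k] 0 assms subset_trans[OF _ K_in_T] k by auto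
  have "\<zero> \<otimes> t \<oplus> k = k" using kK K_carrier by auto
  then have "(\<zero> \<otimes> t \<oplus> k) \<otimes> w \<in> Span T (us @ vs)" using *(2) by simp
  then show ?case using *(1) kK k(2) T_ring(2) by blast
next
  case (Suc n)
  have PT: "set qs \<subseteq> T" using subset_trans[OF Suc.prems(2) P_T] .
  show ?case
  proof (cases "\<exists>x \<in> set qs. \<exists>q \<in> T. \<exists>k \<in> K. x = q \<otimes> t \<oplus> k \<and> k \<noteq> \<zero>")
    case True
    then obtain x q k where x: "x \<in> set qs" "q \<in> T" "k \<in> K" "x = q \<otimes> t \<oplus> k" "k \<noteq> \<zero>" by blast
    then show ?thesis using combine_relation_split[OF Suc.prems(1) PT assms Suc.prems(3) x(1)] by blast
  next
    case False
    \<comment> \<open>No coefficient has a constant term, so each is divisible by t and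
      \<open>d\<close> picks a quotient. Its degree bound is smaller by one, which is what the
      induction consumes.\<close>
    define d where "d x = (SOME p. p \<in> P n \<and> x = p \<otimes> t)" for x
    have d: "d x \<in> P n \<and> x = d x \<otimes> t" if x: "x \<in> set qs" for x
    proof -
      obtain p k where pk: "p \<in> P n" "k \<in> K" "x = p \<otimes> t \<oplus> k"
        using subsetD[OF Suc.prems(2) x] unfolding P_Suc_iff by blast
      then have "k = \<zero>" using False x subsetD[OF P_T pk(1)] by blast
      then have "x = p \<otimes> t" using pk subsetD[OF P_carrier pk(1)] by simp
      then show ?thesis unfolding d_def using someI[of "\<lambda>p. p \<in> P n \<and> x = p \<otimes> t" p] pk(1) by blast
    qed
    have dc: "set (map d qs) \<subseteq> carrier R" using d P_carrier by fastforce
    have "combine (map d qs) ws \<in> carrier R" using dc assms by (intro combine_in_carrier)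
    moreover have "combine (map d qs) ws \<otimes> t = combine qs ws"
    proof -
      have "combine (map d qs) ws \<otimes> t = t \<otimes> combine (map d qs) ws"
        using m_comm \<open>combine (map d qs) ws \<in> carrier R\<close> by auto
      also have "\<dots> = combine (map ((\<otimes>) t) (map d qs)) ws"
        using dc assms by (intro combine_r_distr) auto
      also have "map ((\<otimes>) t) (map d qs) = qs"
      proof -
        have "t \<otimes> d x = x" if "x \<in> set qs" for x
          using d[OF that] dc that m_comm[of t "d x"] by auto
        then show ?thesis by (simp add: map_idI)
      qed
      finally show ?thesis .
    qed
    ultimately have "combine (map d qs) ws = \<zero>"
      using Suc.prems(3) integral t_nonzero t_closed by metis
    moreover have "\<exists>q \<in> set (map d qs). q \<noteq> \<zero>"
    proof -
      obtain x where x: "x \<in> set qs" "x \<noteq> \<zero>" using Suc.prems(4) by blast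
      then have "d x \<noteq> \<zero>" using d[OF x(1)] by (metis l_null t_closed)
      then show ?thesis using x by auto
    qed
    moreover have "set (map d qs) \<subseteq> P n" using d by auto
    ultimately show ?thesis using Suc.IH[of "map d qs"] Suc.prems(1) by simp
  qed
qed

text \<open>The relation says that w is redundant modulo t.\<close>

lemma residue_step:
  assumes ws: "set ws \<subseteq> carrier R" "set vs \<subseteq> set ws" "set ws \<subseteq> insert w (set vs)" "w \<in> set ws"
    and k: "k \<in> K" "k \<noteq> \<zero>" "q \<in> T" "(q \<otimes> t \<oplus> k) \<otimes> w \<in> Span T vs"
    and v: "v \<in> Span T ws"
  shows "\<exists>s \<in> Span T vs. \<exists>v' \<in> Span T ws. v = s \<oplus> t \<otimes> v'"
proof -
  \<comment> \<open>This set is a group, and T-multiples of sums s + t v of this shape stay in it;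
    so it suffices to write each entry of \<open>ws\<close> in this shape.\<close>
  define Z where "Z = {s \<oplus> t \<otimes> v' | s v'. s \<in> Span T vs \<and> v' \<in> Span T ws}"
  have vs: "set vs \<subseteq> carrier R" using ws by blast
  have w: "w \<in> carrier R" using ws by blast
  note S1 = add.subgroupE[OF Span_is_subgroup[OF subgroup_T ws(1)]]
  note S2 = add.subgroupE[OF Span_is_subgroup[OF subgroup_T vs]]
  have Zin: "s \<oplus> t \<otimes> v' \<in> Z" if "s \<in> Span T vs" "v' \<in> Span T ws" for s v'
    using that unfolding Z_def by blast
  have z0: "\<zero> \<in> Span T vs" "\<zero> \<in> Span T ws" using Span_zero T_ring(2) vs ws by auto
  have Z: "subgroup Z (add_monoid R)"
  proof (rule add.subgroupI)
    show "Z \<subseteq> carrier R" unfolding Z_def using S1(1) S2(1) by auto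
    show "Z \<noteq> {}" using Zin z0 by blast
  next
    fix x assume "x \<in> Z"
    then obtain s v where sv: "s \<in> Span T vs" "v \<in> Span T ws" "x = s \<oplus> t \<otimes> v" unfolding Z_def by blast
    then have "s \<in> carrier R" "v \<in> carrier R" using S1 S2 by auto
    then have "\<ominus> x = (\<ominus> s) \<oplus> t \<otimes> (\<ominus> v)" using sv(3) t_closed by algebra
    then show "\<ominus> x \<in> Z" using Zin[of "\<ominus> s" "\<ominus> v"] sv S1 S2 by simp
  next
    fix x y assume "x \<in> Z" "y \<in> Z"
    then obtain s v s' v' where sv: "s \<in> Span T vs" "v \<in> Span T ws" "x = s \<oplus> t \<otimes> v"
      "s' \<in> Span T vs" "v' \<in> Span T ws" "y = s' \<oplus> t \<otimes> v'" unfolding Z_def by blast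
    then have "s \<in> carrier R" "v \<in> carrier R" "s' \<in> carrier R" "v' \<in> carrier R" using S1 S2 by auto
    then have "x \<oplus> y = (s \<oplus> s') \<oplus> t \<otimes> (v \<oplus> v')" using sv(3,6) t_closed by algebra
    then show "x \<oplus> y \<in> Z" using Zin[of "s \<oplus> s'" "v \<oplus> v'"] sv S1 S2 by simp
  qed
  have wZ: "\<exists>s \<in> Span T vs. \<exists>v \<in> Span T ws. u = s \<oplus> t \<otimes> v" if "u \<in> set ws" for u
  proof (cases "u \<in> set vs")
    case True
    then have "\<one> \<otimes> u \<in> Span T vs" using Span_mem[of T vs u \<one>] T_ring(2,3) T_carrier vs by blast
    moreover have "\<one> \<otimes> u = \<one> \<otimes> u \<oplus> t \<otimes> \<zero>" "u = \<one> \<otimes> u" using that ws by auto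
    ultimately show ?thesis using z0 by metis
  next
    case False
    then have u: "u = w" using that ws by blast
    define i where "i = inv k"
    have i: "i \<in> K" "i \<otimes> k = \<one>" using subfield_m_inv[OF K_subfield, of k] k unfolding i_def by auto
    define s where "s = (q \<otimes> t \<oplus> k) \<otimes> w"
    have c: "i \<in> carrier R" "k \<in> carrier R" "q \<in> carrier R" using i k K_carrier T_carrier by auto
    \<comment> \<open>Modulo t the factor q t + k is the unit k. Thus w = k^-1 (q t + k) w - t (k^-1
      q) w, where the first term lies in the span of \<open>vs\<close>.\<close>
    have "i \<otimes> s \<oplus> t \<otimes> ((\<ominus> (i \<otimes> q)) \<otimes> w) = (i \<otimes> k) \<otimes> w"
      unfolding s_def using c w t_closed by algebra
    then have "w = i \<otimes> s \<oplus> t \<otimes> ((\<ominus> (i \<otimes> q)) \<otimes> w)" using i w by simp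
    moreover have "i \<otimes> s \<in> Span T vs" using Span_T_smult[of i s vs] i K_in_T k(4) vs unfolding s_def by blast
    moreover have "(\<ominus> (i \<otimes> q)) \<otimes> w \<in> Span T ws"
    proof (rule Span_mem)
      show "\<ominus> (i \<otimes> q) \<in> T" using i k K_in_T T_ring(5,6) by blast
    qed (use ws T_ring(2) T_carrier in auto)
    ultimately show ?thesis using u by blast
  qed
  have "Span T ws \<subseteq> Z"
  proof (rule Span_least[OF Z])
    fix a u assume a: "a \<in> T" and "u \<in> set ws"
    then obtain s v where sv: "s \<in> Span T vs" "v \<in> Span T ws" "u = s \<oplus> t \<otimes> v" using wZ by blast
    then have "s \<in> carrier R" "v \<in> carrier R" "a \<in> carrier R" using S1 S2 a T_carrier by auto
    then have "a \<otimes> u = a \<otimes> s \<oplus> t \<otimes> (a \<otimes> v)" using sv(3) t_closed by algebra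
    then show "a \<otimes> u \<in> Z" using Zin[of "a \<otimes> s" "a \<otimes> v"] Span_T_smult a sv vs ws by simp
  qed
  then show ?thesis using v unfolding Z_def by blast
qed

lemma residue_pow:
  assumes ws: "set ws \<subseteq> carrier R" "set vs \<subseteq> set ws" "set ws \<subseteq> insert w (set vs)" "w \<in> set ws"
    and k: "k \<in> K" "k \<noteq> \<zero>" "q \<in> T" "(q \<otimes> t \<oplus> k) \<otimes> w \<in> Span T vs"
    and v: "v \<in> Span T ws"
  shows "\<exists>s \<in> Span T vs. \<exists>v' \<in> Span T ws. v = s \<oplus> t [^] (r::nat) \<otimes> v'"
proof (induction r)
  case 0
  have vs: "set vs \<subseteq> carrier R" using ws by blast
  have "v \<in> carrier R" using v Span_in_carrier[OF T_carrier ws(1)] by blast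
  then have "v = \<zero> \<oplus> t [^] (0::nat) \<otimes> v" by simp
  then show ?case using v Span_zero[OF T_ring(2) vs] by blast
next
  case (Suc r)
  then obtain s v' where sv: "s \<in> Span T vs" "v' \<in> Span T ws" "v = s \<oplus> t [^] r \<otimes> v'" by blast
  obtain s' v'' where sv': "s' \<in> Span T vs" "v'' \<in> Span T ws" "v' = s' \<oplus> t \<otimes> v''"
    using residue_step[OF ws k sv(2)] by blast
  have vs: "set vs \<subseteq> carrier R" using ws by blast
  note S1 = add.subgroupE[OF Span_is_subgroup[OF subgroup_T ws(1)]]
  note S2 = add.subgroupE[OF Span_is_subgroup[OF subgroup_T vs]]
  have c: "s \<in> carrier R" "s' \<in> carrier R" "v'' \<in> carrier R" "t [^] r \<in> carrier R"
    using sv sv' S1(1) S2(1) by auto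
  have "v = (s \<oplus> t [^] r \<otimes> s') \<oplus> (t [^] r \<otimes> t) \<otimes> v''" using sv(3) sv'(3) c t_closed by algebra
  moreover have "s \<oplus> t [^] r \<otimes> s' \<in> Span T vs" using S2(4) sv(1) Span_T_smult[OF T_pow sv'(1) vs] by blast
  ultimately show ?case using sv'(2) by auto
qed

text \<open>A remainder modulo t^(r+1) has degree at most r, hence r + 1 coefficients; the dimension
  bound rests on this count.\<close>

lemma T_truncate:
  "q \<in> T \<Longrightarrow> \<exists>p \<in> P r. \<exists>q' \<in> T. q = p \<oplus> t [^] (Suc r) \<otimes> q'"
proof (induction r arbitrary: q)
  case 0
  then obtain q' k where *: "q' \<in> T" "k \<in> K" "q = q' \<otimes> t \<oplus> k" using T_Suc by blast
  then have "q' \<in> carrier R" "k \<in> carrier R" using T_carrier K_carrier by auto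
  then have "q = k \<oplus> t [^] Suc 0 \<otimes> q'" using *(3) t_closed by (simp add: m_comm a_comm)
  then show ?case using * by auto
next
  case (Suc r)
  then obtain q' k where *: "q' \<in> T" "k \<in> K" "q = q' \<otimes> t \<oplus> k" using T_Suc by blast
  obtain p q'' where **: "p \<in> P r" "q'' \<in> T" "q' = p \<oplus> t [^] Suc r \<otimes> q''" using Suc.IH[OF *(1)] by blast
  define x where "x = t [^] Suc r"
  have c: "k \<in> carrier R" "p \<in> carrier R" "q'' \<in> carrier R" "x \<in> carrier R"
    using * ** T_carrier K_carrier P_carrier x_def by auto
  have "q = (p \<otimes> t \<oplus> k) \<oplus> (x \<otimes> t) \<otimes> q''" using *(3) **(3) c t_closed unfolding x_def[symmetric] by algebra
  moreover have "p \<otimes> t \<oplus> k \<in> P (Suc r)" using P_Suc_iff * ** by blast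
  ultimately show ?case using ** x_def nat_pow_Suc by metis
qed

lemma Span_truncate:
  assumes "set vs \<subseteq> carrier R" "s \<in> Span T vs"
  shows "\<exists>s' \<in> Span (P r) vs. \<exists>v \<in> Span T vs. s = s' \<oplus> t [^] (Suc r) \<otimes> v"
  using assms
proof (induction vs arbitrary: s)
  case Nil
  then show ?case by simp
next
  case (Cons w vs)
  define x where "x = t [^] Suc r"
  obtain a u where au: "a \<in> T" "u \<in> Span T vs" "s = a \<otimes> w \<oplus> u" using Cons.prems(2) unfolding Span_Cons_iff by blast
  obtain p q where pq: "p \<in> P r" "q \<in> T" "a = p \<oplus> x \<otimes> q" using T_truncate[OF au(1)] unfolding x_def by blast
  obtain s' v where sv: "s' \<in> Span (P r) vs" "v \<in> Span T vs" "u = s' \<oplus> x \<otimes> v" using Cons.IH[OF _ au(2)] Cons.prems(1) unfolding x_def by auto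
  have vs: "set vs \<subseteq> carrier R" using Cons.prems by simp
  have c: "w \<in> carrier R" "p \<in> carrier R" "q \<in> carrier R" "s' \<in> carrier R" "v \<in> carrier R" "x \<in> carrier R"
    using Cons.prems pq sv T_carrier P_carrier[of r] Span_in_carrier[OF T_carrier vs]
      Span_in_carrier[OF P_carrier vs, of r] x_def by auto
  have "s = (p \<otimes> w \<oplus> s') \<oplus> x \<otimes> (q \<otimes> w \<oplus> v)" using au(3) pq(3) sv(3) c by algebra
  moreover have "p \<otimes> w \<oplus> s' \<in> Span (P r) (w # vs)" "q \<otimes> w \<oplus> v \<in> Span T (w # vs)"
    unfolding Span_Cons_iff using pq(1,2) sv(1,2) by blast+
  ultimately show ?case unfolding x_def by blast
qed

section \<open>K-bases for spans with coefficients of bounded degree\<close>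

primrec exps :: "nat \<Rightarrow> 'a list" where
  "exps 0 = [\<one>]"
| "exps (Suc n) = \<one> # map (\<lambda>x. x \<otimes> t) (exps n)"

lemma exps_carrier: "set (exps n) \<subseteq> carrier R"
  by (induction n) auto

lemma length_exps [simp]: "length (exps n) = Suc n"
  by (induction n) auto

lemma Span_exps: "Span K (exps n) = P n"
proof (induction n)
  case 0
  have "k \<otimes> \<one> \<oplus> \<zero> = k" if "k \<in> K" for k using subsetD[OF K_carrier that] by simp
  then show ?case unfolding set_eq_iff exps.simps Span_Cons_iff Span_Nil poly_vals.simps(1) bex_simps
    by (metis singleton_iff)
next
  case (Suc n)
  have "x \<in> Span K (exps (Suc n)) \<longleftrightarrow> (\<exists>k \<in> K. \<exists>p \<in> P n. x = k \<otimes> \<one> \<oplus> p \<otimes> t)" for x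
    using Span_map_mult[OF K_carrier exps_carrier t_closed, of n] Suc by (auto simp: Span_Cons_iff)
  moreover have "k \<otimes> \<one> \<oplus> p \<otimes> t = p \<otimes> t \<oplus> k" if "k \<in> K" "p \<in> P n" for k p
    using that K_carrier P_carrier[of n] by (simp add: a_comm subset_iff)
  ultimately show ?case unfolding set_eq_iff P_Suc_iff by metis
qed

lemma independent_exps: "independent K (exps n)"
proof (induction n)
  case 0
  show ?case by (auto intro!: li_Cons)
next
  case (Suc n)
  have "\<one> \<notin> Span K (map (\<lambda>x. x \<otimes> t) (exps n))"
  proof
    assume "\<one> \<in> Span K (map (\<lambda>x. x \<otimes> t) (exps n))"
    then obtain p where p: "p \<in> P n" "\<one> = p \<otimes> t"
      using Span_map_mult[OF K_carrier exps_carrier t_closed, of n] Span_exps by auto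
    then have "p \<otimes> t \<oplus> (\<ominus> \<one>) = \<zero>" using r_neg[OF one_closed] by simp
    then have "\<ominus> \<one> = \<zero>" using horner_zero(2)[of p "\<ominus> \<one>"] p P_T K_ring(3,5) by blast
    then show False using one_not_zero by (metis minus_minus minus_zero one_closed)
  qed
  then show ?case using independent_map_mult[OF K_subfield t_closed t_nonzero Suc] by (auto intro: li_Cons)
qed

text \<open>The products t^a w with a at most n. They replace a span over \<open>P n\<close>, which
  is no field, by a span over K, where dimensions can be counted.\<close>

primrec exps_basis :: "nat \<Rightarrow> 'a list \<Rightarrow> 'a list" where
  "exps_basis n [] = []"
| "exps_basis n (w # ws) = map (\<lambda>x. x \<otimes> w) (exps n) @ exps_basis n ws"

lemma exps_basis_carrier: "set ws \<subseteq> carrier R \<Longrightarrow> set (exps_basis n ws) \<subseteq> carrier R"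
  by (induction ws) (use exps_carrier in auto)

lemma length_exps_basis: "length (exps_basis n ws) = Suc n * length ws"
  by (induction ws) auto

lemma Span_exps_basis: "set ws \<subseteq> carrier R \<Longrightarrow> Span K (exps_basis n ws) = Span (P n) ws"
proof (induction ws)
  case (Cons w ws)
  then have w: "w \<in> carrier R" "set ws \<subseteq> carrier R" by auto
  have m: "set (map (\<lambda>x. x \<otimes> w) (exps n)) \<subseteq> carrier R" using exps_carrier w by auto
  have "Span K (exps_basis n (w # ws)) = (\<lambda>x. x \<otimes> w) ` P n <+> Span (P n) ws"
    using Span_append_eq_set_add[OF K_subfield m exps_basis_carrier[OF w(2)]] Cons.IH[OF w(2)]
      Span_map_mult[OF K_carrier exps_carrier w(1), of n] Span_exps by simp
  also have "(\<lambda>x. x \<otimes> w) ` P n = P n #> w" by (auto simp: r_coset_def)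
  finally show ?case by (simp add: Span_Cons line_extension_def)
qed simp

lemma independent_exps_basis:
  "set ws \<subseteq> carrier R \<Longrightarrow> free_over (P n) ws \<Longrightarrow> independent K (exps_basis n ws)"
proof (induction ws)
  case (Cons w ws)
  then have w: "w \<in> carrier R" "set ws \<subseteq> carrier R" by auto
  have z: "\<zero> \<in> Span (P n) ws" using Span_zero[OF P_zero w(2)] .
  have "\<one> \<in> P n" using subsetD[OF K_in_P K_ring(3)] .
  then have "\<one> \<otimes> w \<notin> Span (P n) ws" using Cons.prems(2) one_not_zero unfolding free_over.simps by blast
  then have "w \<noteq> \<zero>" using z by auto
  have m: "set (map (\<lambda>x. x \<otimes> w) (exps n)) \<subseteq> carrier R" using exps_carrier w by auto
  have "Span K (map (\<lambda>x. x \<otimes> w) (exps n)) \<inter> Span K (exps_basis n ws) = {\<zero>}"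
  proof -
    have eq: "Span K (map (\<lambda>x. x \<otimes> w) (exps n)) = (\<lambda>x. x \<otimes> w) ` P n"
      using Span_map_mult[OF K_carrier exps_carrier w(1), of n] Span_exps by simp
    have "p \<otimes> w = \<zero>" if "p \<in> P n" "p \<otimes> w \<in> Span (P n) ws" for p
    proof -
      have "p = \<zero>" using Cons.prems(2) that unfolding free_over.simps by blast
      then show ?thesis using w by simp
    qed
    moreover have "\<zero> \<in> (\<lambda>x. x \<otimes> w) ` P n" using imageI[OF P_zero[of n], of "\<lambda>x. x \<otimes> w"] w by simp
    ultimately show ?thesis unfolding Span_exps_basis[OF w(2), of n] eq using z by blast
  qed
  then show ?case
    using independent_append[OF K_subfield independent_map_mult[OF K_subfield w(1) \<open>w \<noteq> \<zero>\<close> independent_exps]]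
      Cons by simp
qed simp

lemma free_over_trivial_combine:
  assumes "set ws \<subseteq> carrier R" "\<not> free_over T ws"
  shows "\<exists>qs. length qs = length ws \<and> set qs \<subseteq> T \<and> combine qs ws = \<zero> \<and> (\<exists>q \<in> set qs. q \<noteq> \<zero>)"
  using assms
proof (induction ws)
  case (Cons w ws)
  have w: "w \<in> carrier R" "set ws \<subseteq> carrier R" using Cons.prems by auto
  show ?case
  proof (cases "free_over T ws")
    case True
    then obtain a where a: "a \<in> T" "a \<otimes> w \<in> Span T ws" "a \<noteq> \<zero>" using Cons.prems(2) by auto
    then have "\<ominus> (a \<otimes> w) \<in> Span T ws"
      using add.subgroupE(3)[OF Span_is_subgroup[OF subgroup_T w(2)]] by blast
    then obtain qs where qs: "length qs = length ws" "set qs \<subseteq> T" "\<ominus> (a \<otimes> w) = combine qs ws"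
      using Span_imp_combine by blast
    then have "combine (a # qs) (w # ws) = \<zero>" using r_neg[of "a \<otimes> w"] a(1) T_carrier w by auto
    with qs a show ?thesis by (intro exI[of _ "a # qs"]) auto
  next
    case False
    then obtain qs where qs: "length qs = length ws" "set qs \<subseteq> T" "combine qs ws = \<zero>" "\<exists>q \<in> set qs. q \<noteq> \<zero>"
      using Cons by auto
    then show ?thesis using w T_ring(2) by (intro exI[of _ "\<zero> # qs"]) auto
  qed
qed simp

lemma list_in_P:
  "set qs \<subseteq> T \<Longrightarrow> \<exists>n. set qs \<subseteq> P n"
proof (induction qs)
  case (Cons q qs)
  then obtain n where n: "set qs \<subseteq> P n" by auto
  obtain m where m: "q \<in> P m" using T_in_P Cons.prems by auto
  have "set (q # qs) \<subseteq> P (max m n)"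
    using subset_trans[OF n P_mono[of n "max m n"]] subsetD[OF P_mono[of m "max m n"] m] by simp
  then show ?case by blast
qed simp

text \<open>\<open>B\<close> is the degree up to which relations are excluded, and \<open>c\<close>
  bounds the degrees in the multiplication table of the list. The inequality \<open>big\<close> says
  that the products t^a w with a at most B are too many to stay independent modulo t^(B+c+1) once
  one entry is redundant there.\<close>

lemma free_over_T:
  assumes ws: "set ws \<subseteq> carrier R"
    and closed: "\<And>u v. u \<in> set ws \<Longrightarrow> v \<in> set ws \<Longrightarrow> u \<otimes> v \<in> Span (P c) ws"
    and free: "free_over (P B) ws"
    and big: "(length ws - 1) * (B + c + 1) < length ws * (B + 1)"
  shows "free_over T ws"
proof (rule ccontr)
  assume "\<not> free_over T ws"
  then obtain qs where qs: "length qs = length ws" "set qs \<subseteq> T" "combine qs ws = \<zero>" "\<exists>q \<in> set qs. q \<noteq> \<zero>"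
    using free_over_trivial_combine[OF ws] by blast
  obtain n where "set qs \<subseteq> P n" using list_in_P[OF qs(2)] by blast
  then obtain us w vs k q where rel: "ws = us @ w # vs" "k \<in> K" "k \<noteq> \<zero>" "q \<in> T"
    "(q \<otimes> t \<oplus> k) \<otimes> w \<in> Span T (us @ vs)"
    using primitive_relation[OF ws qs(1) _ qs(3,4)] by blast
  define zs where "zs = us @ vs"
  have zs: "set zs \<subseteq> set ws" "set ws \<subseteq> insert w (set zs)" "w \<in> set ws" "length ws = Suc (length zs)"
    unfolding zs_def rel(1) by auto
  have zc: "set zs \<subseteq> carrier R" using zs(1) ws by blast
  \<comment> \<open>Multiplying by an element whose coefficients have degree at most B raises
    degrees by at most B + c, the c coming from products of entries. With r one larger, t^r gains on
    this bound with every further factor.\<close>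
  define e where "e = B + c"
  define r where "r = Suc e"
  define S where "S = Span T ws"
  note S1 = add.subgroupE[OF Span_is_subgroup[OF subgroup_T ws]]
  note S2 = add.subgroupE[OF Span_is_subgroup[OF subgroup_T zc]]
  note S3 = add.subgroupE[OF Span_is_subgroup[OF subgroup_P zc, of e]]
  have zsT: "Span T zs \<subseteq> Span T ws"
    using Span_least[OF Span_is_subgroup[OF subgroup_T ws]] Span_mem[OF T_ring(2) T_carrier ws] zs(1) by blast
  have reduce: "\<exists>s \<in> Span (P e) zs. \<exists>v' \<in> S. v = s \<oplus> t [^] r \<otimes> v'" if v: "v \<in> S" for v
  proof -
    obtain s v' where sv: "s \<in> Span T zs" "v' \<in> Span T ws" "v = s \<oplus> t [^] r \<otimes> v'"
      using residue_pow[OF ws zs(1-3) rel(2-4) rel(5)[folded zs_def] v[unfolded S_def]] by blast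
    obtain s' v'' where sv': "s' \<in> Span (P e) zs" "v'' \<in> Span T zs" "s = s' \<oplus> t [^] r \<otimes> v''"
      using Span_truncate[OF zc sv(1)] unfolding r_def by blast
    have c: "s' \<in> carrier R" "v'' \<in> carrier R" "v' \<in> carrier R" "t [^] r \<in> carrier R"
      using subsetD[OF S3(1) sv'(1)] subsetD[OF S2(1) sv'(2)] subsetD[OF S1(1) sv(2)] by auto
    have "v = s' \<oplus> t [^] r \<otimes> (v'' \<oplus> v')" using sv(3) sv'(3) c by algebra
    moreover have "v'' \<oplus> v' \<in> S" unfolding S_def using S1(4) sv(2) subsetD[OF zsT sv'(2)] by blast
    ultimately show ?thesis using sv'(1) by blast
  qed
  define ys where "ys = exps_basis B ws"
  have ysc: "set ys \<subseteq> carrier R" unfolding ys_def by (rule exps_basis_carrier[OF ws])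
  have ysi: "independent K ys" unfolding ys_def by (rule independent_exps_basis[OF ws free])
  have ysS: "Span K ys = Span (P B) ws" unfolding ys_def by (rule Span_exps_basis[OF ws])
  have PS: "Span (P m) ws \<subseteq> S" for m unfolding S_def by (rule Span_mono[OF P_T])
  have ysS': "set ys \<subseteq> S" using Span_base_incl[OF K_subfield ysc] ysS PS[of B] by simp
  \<comment> \<open>Remainder and quotient modulo t^r, chosen separately for each v. They need not
    be linear, since only their values on the finitely many \<open>ys\<close> enter.\<close>
  obtain \<sigma> \<tau> where st: "\<And>v. v \<in> S \<Longrightarrow> \<sigma> v \<in> Span (P e) zs \<and> \<tau> v \<in> S \<and> v = \<sigma> v \<oplus> t [^] r \<otimes> \<tau> v"
    using reduce by metis
  have Sc: "S \<subseteq> carrier R" unfolding S_def by (rule S1(1))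
  have \<sigma>c: "\<sigma> v \<in> carrier R" if "v \<in> S" for v using st[OF that] S3(1) by blast
  have \<tau>c: "\<tau> v \<in> carrier R" if "v \<in> S" for v using st[OF that] Sc by blast
  \<comment> \<open>The count, with M the length of \<open>ws\<close>: \<open>ys\<close> has M (B +
    1) entries, while the remainders lie in a space spanned by (M - 1)(e + 1) elements.\<close>
  have "dependent K (map \<sigma> ys)"
  proof
    assume ind: "independent K (map \<sigma> ys)"
    obtain m where m: "m \<le> length (exps_basis e zs)" "dimension m K (Span K (exps_basis e zs))"
      using Span_dimension_le[OF K_subfield exps_basis_carrier[OF zc]] by blast
    have "set (map \<sigma> ys) \<subseteq> Span K (exps_basis e zs)"
      unfolding Span_exps_basis[OF zc] using st ysS' by auto
    then have "length (map \<sigma> ys) \<le> m"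
      using independent_length_le_dimension[OF K_subfield m(2) ind] by blast
    then have "length ys \<le> Suc e * length zs" using m(1) length_exps_basis by simp
    moreover have "length ys = Suc B * length ws" unfolding ys_def by (rule length_exps_basis)
    ultimately show False using big zs(4) unfolding e_def by (simp add: algebra_simps)
  qed
  moreover have "set (map \<sigma> ys) \<subseteq> carrier R" using \<sigma>c ysS' by auto
  ultimately obtain ks where ks: "length ks = length (map \<sigma> ys)" "combine ks (map \<sigma> ys) = \<zero>" "set ks \<subseteq> K" "set ks \<noteq> {\<zero>}"
    using dependent_imp_non_trivial_combine[OF K_subfield] by metis
  have ys_ne: "ys \<noteq> []" using length_exps_basis[of B ws] zs(4) ys_def by force
  have ksc: "set ks \<subseteq> carrier R" using ks(3) K_carrier by blast
  define f where "f = combine ks ys"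
  define g where "g = combine ks (map \<tau> ys)"
  have f0: "f \<noteq> \<zero>"
  proof
    assume "f = \<zero>"
    then have "set (take (length ys) ks) \<subseteq> {\<zero>}"
      using independent_imp_trivial_combine[OF K_subfield ysi ks(3)] f_def by simp
    moreover have "take (length ys) ks = ks" using ks(1) by simp
    moreover have "set ks \<noteq> {}" using ks(1) ys_ne by auto
    ultimately show False using ks(4) subset_singletonD[of "set ks" \<zero>] by simp
  qed
  have fB: "f \<in> Span (P B) ws"
    unfolding f_def ysS[symmetric] using combine_in_Span[of ks ys K] ks by simp
  have gS: "g \<in> S"
  proof -
    have "g \<in> Span K (map \<tau> ys)" unfolding g_def using combine_in_Span[of ks "map \<tau> ys" K] ks by simp
    moreover have "Span K (map \<tau> ys) \<subseteq> S"
    proof (rule Span_least)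
      show "subgroup S (add_monoid R)" unfolding S_def by (rule Span_is_subgroup[OF subgroup_T ws])
      fix a w assume "a \<in> K" "w \<in> set (map \<tau> ys)"
      then have "a \<in> T" "w \<in> S" using K_in_T st ysS' by auto
      then show "a \<otimes> w \<in> S" unfolding S_def using Span_T_smult ws by blast
    qed
    ultimately show ?thesis by blast
  qed
  have gc: "g \<in> carrier R" using gS Sc by blast
  have fg: "f = t [^] r \<otimes> g"
  proof -
    have "f = combine ks (map \<sigma> ys) \<oplus> t [^] r \<otimes> g"
      unfolding f_def g_def
      by (rule combine_map_add_smult[OF ksc ysS' _ \<sigma>c \<tau>c]) (use st ks(1) in auto)
    then show ?thesis using ks(2) gc by simp
  qed
  have fc: "f \<in> carrier R" using fg gc by simp
  have mult_f: "v \<otimes> f \<in> Span (P (n + e)) ws" if v: "v \<in> Span (P n) ws" for n v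
  proof (rule Span_mult[OF P_carrier P_carrier subgroup_P _ ws ws fc _ v])
    show "a \<otimes> b \<in> P (n + e)" if "a \<in> P n" "b \<in> P e" for a b using P_mult[OF that] .
    fix w assume w: "w \<in> set ws"
    have "f \<otimes> w \<in> Span (P (B + c)) ws"
    proof (rule Span_mult[OF P_carrier P_carrier subgroup_P _ ws ws _ _ fB])
      show "a \<otimes> b \<in> P (B + c)" if "a \<in> P B" "b \<in> P c" for a b using P_mult[OF that] .
      show "u \<otimes> w \<in> Span (P c) ws" if "u \<in> set ws" for u using closed that w by blast
    qed (use w ws in auto)
    then show "w \<otimes> f \<in> Span (P e) ws" using m_comm[of w f] fc w ws unfolding e_def by auto
  qed
  \<comment> \<open>Exponents start at 1, here and for g, because S is not assumed to contain the
    unit element.\<close>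
  have f_pow: "f [^] Suc j \<in> Span (P (B + j * e)) ws" for j
  proof (induction j)
    case 0
    then show ?case using fB fc by simp
  next
    case (Suc j)
    have "f [^] Suc j \<otimes> f \<in> Span (P (B + j * e + e)) ws" by (rule mult_f[OF Suc])
    then show ?case by (simp add: algebra_simps)
  qed
  have mult_S: "x \<otimes> y \<in> S" if "x \<in> S" "y \<in> S" for x y
  proof -
    have "y \<otimes> w \<in> Span T ws" if w: "w \<in> set ws" for w
    proof (rule Span_mult[OF T_carrier T_carrier subgroup_T _ ws ws _ _ \<open>y \<in> S\<close>[unfolded S_def]])
      show "u \<otimes> w \<in> Span T ws" if "u \<in> set ws" for u
        using subsetD[OF Span_mono[OF P_T] closed[OF that w]] .
    qed (use w ws T_ring(6) in auto)
    moreover have "w \<otimes> y = y \<otimes> w" if "w \<in> set ws" for w using m_comm[of w y] that \<open>y \<in> S\<close> Sc ws by auto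
    ultimately have "w \<otimes> y \<in> Span T ws" if w: "w \<in> set ws" for w using w by simp
    then show ?thesis unfolding S_def
      by (intro Span_mult[OF T_carrier T_carrier subgroup_T _ ws ws _ _ \<open>x \<in> S\<close>[unfolded S_def]])
        (use T_ring(6) \<open>y \<in> S\<close> Sc in auto)
  qed
  have g_pow: "g [^] Suc j \<in> S" for j
    by (induction j) (use gS gc mult_S in auto)
  obtain C where C: "\<And>n m y. \<lbrakk>y \<in> Span T ws; t [^] m \<otimes> y \<in> Span (P n) ws; n + C < m\<rbrakk> \<Longrightarrow> y = \<zero>"
    using Span_pow_gap[OF ws] by metis
  \<comment> \<open>The exponent of t in f^(j+1) exceeds the degree bound by r (j + 1) - (B + j e) =
    j + c + 1, which is larger than C for this j.\<close>
  define j where "j = B + C"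
  have "f [^] Suc j = t [^] (r * Suc j) \<otimes> g [^] Suc j"
    unfolding fg using gc nat_pow_distrib[of "t [^] r" g "Suc j"] nat_pow_pow[of t r "Suc j"] by simp
  moreover have "B + j * e + C < r * Suc j" unfolding j_def r_def by (simp add: algebra_simps)
  ultimately have "g [^] Suc j = \<zero>"
    using C[of "g [^] Suc j" "r * Suc j" "B + j * e"] g_pow[of j] f_pow[of j] unfolding S_def by simp
  moreover have "x [^] (n::nat) \<noteq> \<zero>" if "x \<in> carrier R" "x \<noteq> \<zero>" for x n
    by (induction n) (use that integral_iff in auto)
  ultimately have "g = \<zero>" using gc by metis
  then show False using f0 fg by simp
qed

section \<open>The fraction field of K[t] and the clearing of denominators\<close>

definition Fr :: "'a set" where
  "Fr = {a \<otimes> inv b | a b. a \<in> T \<and> b \<in> T \<and> b \<noteq> \<zero>}"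

lemma FrI: "a \<in> T \<Longrightarrow> b \<in> T \<Longrightarrow> b \<noteq> \<zero> \<Longrightarrow> a \<otimes> inv b \<in> Fr"
  unfolding Fr_def by blast

lemma T_nonzero_inv:
  assumes "b \<in> T" "b \<noteq> \<zero>"
  shows "b \<in> carrier R" "inv b \<in> carrier R" "b \<otimes> inv b = \<one>" "inv b \<noteq> \<zero>"
proof -
  show b: "b \<in> carrier R" using assms T_carrier by blast
  then have "b \<in> Units R" using assms field_Units by blast
  then show "inv b \<in> carrier R" "b \<otimes> inv b = \<one>" by auto
  then show "inv b \<noteq> \<zero>" using b one_not_zero by auto
qed

text \<open>With a denominator b as witness, closure under the field operations is checked by
  multiplying denominators, and membership transfers to components without mention of
  inverses.\<close>

lemma Fr_scale: "x \<in> Fr \<longleftrightarrow> x \<in> carrier R \<and> (\<exists>b \<in> T. b \<noteq> \<zero> \<and> b \<otimes> x \<in> T)"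
proof
  assume "x \<in> Fr"
  then obtain a b where ab: "a \<in> T" "b \<in> T" "b \<noteq> \<zero>" "x = a \<otimes> inv b" unfolding Fr_def by blast
  note b = T_nonzero_inv[OF ab(2,3)]
  have a: "a \<in> carrier R" using ab T_carrier by blast
  have "b \<otimes> x = a \<otimes> (b \<otimes> inv b)" unfolding ab(4) using a b(1,2) by algebra
  then show "x \<in> carrier R \<and> (\<exists>b \<in> T. b \<noteq> \<zero> \<and> b \<otimes> x \<in> T)" using a b ab by auto
next
  assume "x \<in> carrier R \<and> (\<exists>b \<in> T. b \<noteq> \<zero> \<and> b \<otimes> x \<in> T)"
  then obtain b where x: "x \<in> carrier R" "b \<in> T" "b \<noteq> \<zero>" "b \<otimes> x \<in> T" by blast
  note b = T_nonzero_inv[OF x(2,3)]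
  have "(b \<otimes> x) \<otimes> inv b = (b \<otimes> inv b) \<otimes> x" using x(1) b(1,2) by algebra
  then have "x = (b \<otimes> x) \<otimes> inv b" using x(1) unfolding b(3) by (metis l_one)
  then show "x \<in> Fr" using FrI x by metis
qed

lemma T_integral: "a \<in> T \<Longrightarrow> b \<in> T \<Longrightarrow> a \<noteq> \<zero> \<Longrightarrow> b \<noteq> \<zero> \<Longrightarrow> a \<otimes> b \<noteq> \<zero>"
  using integral_iff subsetD[OF T_carrier] by blast

lemma T_in_Fr: "T \<subseteq> Fr"
proof
  fix x assume "x \<in> T"
  then have "x \<in> carrier R" "\<one> \<otimes> x \<in> T" using T_carrier by auto
  then show "x \<in> Fr" unfolding Fr_scale using T_ring(3) one_not_zero by blast
qed

lemma Fr_subfield: "subfield Fr R"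
proof (rule subfieldI')
  show "subring Fr R"
  proof (rule subringI)
    show "Fr \<subseteq> carrier R" using Fr_scale by blast
    show "\<one> \<in> Fr" using T_in_Fr T_ring(3) by blast
  next
    fix x assume "x \<in> Fr"
    then obtain b where b: "x \<in> carrier R" "b \<in> T" "b \<noteq> \<zero>" "b \<otimes> x \<in> T" unfolding Fr_scale by blast
    then have "b \<otimes> (\<ominus> x) = \<ominus> (b \<otimes> x)" using T_carrier r_minus by blast
    then show "\<ominus> x \<in> Fr" unfolding Fr_scale using b T_ring(5)[OF b(4)] by auto
  next
    fix x y assume "x \<in> Fr" "y \<in> Fr"
    then obtain b c where b: "x \<in> carrier R" "b \<in> T" "b \<noteq> \<zero>" "b \<otimes> x \<in> T"
      and c: "y \<in> carrier R" "c \<in> T" "c \<noteq> \<zero>" "c \<otimes> y \<in> T" unfolding Fr_scale by blast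
    have bc: "b \<in> carrier R" "c \<in> carrier R" "b \<otimes> c \<in> T" "b \<otimes> c \<noteq> \<zero>"
      using b c T_carrier T_ring(6) T_integral by auto
    have "(b \<otimes> c) \<otimes> (x \<otimes> y) = (b \<otimes> x) \<otimes> (c \<otimes> y)"
      "(b \<otimes> c) \<otimes> (x \<oplus> y) = c \<otimes> (b \<otimes> x) \<oplus> b \<otimes> (c \<otimes> y)"
      using b(1) c(1) bc by algebra+
    then have "(b \<otimes> c) \<otimes> (x \<otimes> y) \<in> T" "(b \<otimes> c) \<otimes> (x \<oplus> y) \<in> T"
      using T_ring(6,7) b c by auto
    then show "x \<otimes> y \<in> Fr" "x \<oplus> y \<in> Fr" unfolding Fr_scale using bc b(1) c(1) by blast+
  qed
next
  fix k assume k: "k \<in> Fr - {\<zero>}"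
  then obtain b where b: "k \<in> carrier R" "b \<in> T" "b \<noteq> \<zero>" "b \<otimes> k \<in> T" "k \<noteq> \<zero>"
    using Fr_scale[of k] by blast
  then have bc: "b \<in> carrier R" using T_carrier by blast
  have k: "inv k \<in> carrier R" "k \<otimes> inv k = \<one>" using b(1,5) field_Units by auto
  have "(b \<otimes> k) \<otimes> inv k = b \<otimes> (k \<otimes> inv k)" using b bc k by algebra
  then have "(b \<otimes> k) \<otimes> inv k \<in> T" using b k bc by simp
  moreover have "b \<otimes> k \<noteq> \<zero>" using b bc integral_iff by blast
  ultimately show "inv k \<in> Fr" unfolding Fr_scale using b k by blast
qed

lemma generate_field_eq_Fr: "generate_field R (K \<union> {t}) = Fr"
proof
  show "generate_field R (K \<union> {t}) \<subseteq> Fr"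
    by (rule generate_field_min_subfield1[OF _ Fr_subfield]) (use K_carrier K_in_T t_in_T T_in_Fr in auto)
  have Kt: "K \<union> {t} \<subseteq> carrier R" using K_carrier by auto
  have sf: "subfield (generate_field R (K \<union> {t})) R"
    by (rule generate_field_is_subfield[OF Kt])
  note sr = subringE[OF subfieldE(1)[OF sf]]
  have "K \<union> {t} \<subseteq> generate_field R (K \<union> {t})" by (auto intro: generate_field.incl)
  then have "T \<subseteq> generate_field R (K \<union> {t})" unfolding T_def
    by (intro simple_extension_subring_incl[OF subfieldE(1)[OF sf]]) auto
  then show "Fr \<subseteq> generate_field R (K \<union> {t})"
    unfolding Fr_def using sr(6) subfield_m_inv(1)[OF sf] by blast
qed

lemma Span_Fr_scale:
  "set ws \<subseteq> carrier R \<Longrightarrow> v \<in> Span Fr ws \<Longrightarrow> \<exists>b \<in> T. b \<noteq> \<zero> \<and> b \<otimes> v \<in> Span T ws"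
proof (induction ws arbitrary: v)
  case Nil
  then have "\<one> \<otimes> v \<in> Span T []" by simp
  then show ?case using T_ring(3) one_not_zero by blast
next
  case (Cons w ws)
  then have w: "w \<in> carrier R" "set ws \<subseteq> carrier R" by auto
  obtain a u where au: "a \<in> Fr" "u \<in> Span Fr ws" "v = a \<otimes> w \<oplus> u" using Cons.prems unfolding Span_Cons_iff by blast
  obtain b where b: "b \<in> T" "b \<noteq> \<zero>" "b \<otimes> u \<in> Span T ws" using Cons.IH[OF w(2) au(2)] by blast
  obtain c where c: "a \<in> carrier R" "c \<in> T" "c \<noteq> \<zero>" "c \<otimes> a \<in> T" using au(1) unfolding Fr_scale by blast
  have cs: "b \<in> carrier R" "c \<in> carrier R" "u \<in> carrier R"
    using b c T_carrier Span_in_carrier[OF subfieldE(3)[OF Fr_subfield] w(2)] au by auto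
  have "(b \<otimes> c) \<otimes> v = (b \<otimes> (c \<otimes> a)) \<otimes> w \<oplus> c \<otimes> (b \<otimes> u)"
    unfolding au(3) using cs c(1) w(1) by algebra
  moreover have "b \<otimes> (c \<otimes> a) \<in> T" using T_ring(6) b c by blast
  moreover have "c \<otimes> (b \<otimes> u) \<in> Span T ws" using Span_T_smult c b w by blast
  ultimately have "(b \<otimes> c) \<otimes> v \<in> Span T (w # ws)" unfolding Span_Cons_iff by blast
  then show ?case using T_integral b c T_ring(6) by blast
qed

text \<open>A common denominator. It will be applied to all products of two elements of a
  basis.\<close>

lemma finite_Span_Fr_scale:
  assumes "finite W" "set ws \<subseteq> carrier R"
  shows "W \<subseteq> Span Fr ws \<Longrightarrow> \<exists>b \<in> T. b \<noteq> \<zero> \<and> (\<forall>x \<in> W. b \<otimes> x \<in> Span T ws)"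
  using assms(1)
proof induction
  case empty
  then show ?case using T_ring(3) one_not_zero by blast
next
  case (insert x W)
  then obtain b where b: "b \<in> T" "b \<noteq> \<zero>" "\<forall>x \<in> W. b \<otimes> x \<in> Span T ws" by blast
  obtain c where c: "c \<in> T" "c \<noteq> \<zero>" "c \<otimes> x \<in> Span T ws" using Span_Fr_scale[OF assms(2)] insert.prems by blast
  have cc: "b \<in> carrier R" "c \<in> carrier R" using b c T_carrier by auto
  have Wc: "y \<in> carrier R" if "y \<in> insert x W" for y
    using that insert.prems Span_in_carrier[OF subfieldE(3)[OF Fr_subfield] assms(2)] by blast
  have "(b \<otimes> c) \<otimes> y \<in> Span T ws" if y: "y \<in> insert x W" for y
  proof (cases "y = x")
    case True
    have "b \<otimes> (c \<otimes> x) \<in> Span T ws" using Span_T_smult[OF b(1) c(3) assms(2)] .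
    then show ?thesis using True cc Wc[OF y] by (simp add: m_assoc)
  next
    case False
    then have "c \<otimes> (b \<otimes> y) \<in> Span T ws" using Span_T_smult[OF c(1) _ assms(2)] b(3) y by blast
    then show ?thesis using cc Wc[OF y] by (simp add: m_ac)
  qed
  then show ?case using T_integral b c T_ring(6) by blast
qed

lemma free_over_T_imp_independent:
  "set ws \<subseteq> carrier R \<Longrightarrow> free_over T ws \<Longrightarrow> independent Fr ws"
proof (induction ws)
  case (Cons w ws)
  then have w: "w \<in> carrier R" "set ws \<subseteq> carrier R" "free_over T ws" by auto
  have "w \<notin> Span Fr ws"
  proof
    assume "w \<in> Span Fr ws"
    then obtain b where "b \<in> T" "b \<noteq> \<zero>" "b \<otimes> w \<in> Span T ws" using Span_Fr_scale w by blast
    then show False using Cons.prems(2) unfolding free_over.simps by blast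
  qed
  then show ?case using Cons.IH w by (auto intro: li_Cons)
qed simp

lemma independent_imp_free_over:
  assumes "A \<subseteq> Fr"
  shows "independent Fr ws \<Longrightarrow> free_over A ws"
proof (induction ws)
  case (Cons w ws)
  note i = independent_backwards[OF Cons.prems]
  have "a = \<zero>" if "a \<in> A" "a \<otimes> w \<in> Span A ws" for a
  proof (rule ccontr)
    assume "a \<noteq> \<zero>"
    then have "a \<in> Fr - {\<zero>}" "a \<otimes> w \<in> Span Fr ws" using that assms subsetD[OF Span_mono[OF assms]] by auto
    then have "w \<in> Span Fr ws"
      using Span_m_inv_simprule[OF Fr_subfield independent_in_carrier[OF i(2)] _ i(3)] by blast
    then show False using i(1) by simp
  qed
  then show ?case using Cons.IH[OF i(2)] by simp
qed simp

text \<open>Links the Horner form to the explicit sums by which \<open>ratfun_embed\<close> is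
  defined.\<close>

lemma P_eq_finsum:
  "P n = {\<Oplus>i\<in>{..n}. a i \<otimes> t [^] i | a. \<forall>i. a i \<in> K}"
proof (induction n)
  case 0
  have *: "(\<Oplus>i\<in>{..0::nat}. a i \<otimes> t [^] i) = a 0" if "\<forall>i. a i \<in> K" for a
  proof -
    have "a 0 \<in> carrier R" using that K_carrier by blast
    then show ?thesis by (subst finsum_0) auto
  qed
  show ?case
  proof (intro equalityI subsetI)
    fix x assume "x \<in> P 0"
    then have "\<forall>i::nat. (\<lambda>_. x) i \<in> K" by simp
    from this *[OF this] show "x \<in> {\<Oplus>i\<in>{..0::nat}. a i \<otimes> t [^] i | a. \<forall>i. a i \<in> K}"
      by (intro CollectI exI[of _ "\<lambda>_. x"]) simp
  qed (auto simp del: atMost_0 simp: *)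
next
  case (Suc n)
  have *: "(\<Oplus>i\<in>{..Suc n}. a i \<otimes> t [^] i) = (\<Oplus>i\<in>{..n}. a (Suc i) \<otimes> t [^] i) \<otimes> t \<oplus> a 0"
    if a: "\<forall>i. a i \<in> K" for a
  proof -
    have ac: "a i \<in> carrier R" for i using a K_carrier by blast
    have "(\<Oplus>i\<in>{..Suc n}. a i \<otimes> t [^] i) = (\<Oplus>i\<in>{..n}. a (Suc i) \<otimes> t [^] (Suc i)) \<oplus> a 0 \<otimes> t [^] (0::nat)"
      using ac by (intro finsum_Suc2) auto
    also have "(\<Oplus>i\<in>{..n}. a (Suc i) \<otimes> t [^] (Suc i)) = (\<Oplus>i\<in>{..n}. a (Suc i) \<otimes> t [^] i \<otimes> t)"
      using ac by (intro finsum_cong') (auto simp: m_assoc)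
    also have "\<dots> = (\<Oplus>i\<in>{..n}. a (Suc i) \<otimes> t [^] i) \<otimes> t"
      using ac by (intro finsum_ldistr[symmetric]) auto
    finally show ?thesis using ac by simp
  qed
  show ?case
  proof (intro equalityI subsetI)
    fix x assume "x \<in> P (Suc n)"
    then obtain p k where pk: "p \<in> P n" "k \<in> K" "x = p \<otimes> t \<oplus> k" unfolding P_Suc_iff by blast
    then obtain a where a: "\<forall>i. a i \<in> K" "p = (\<Oplus>i\<in>{..n}. a i \<otimes> t [^] i)" using Suc by blast
    define b where "b i = (case i of 0 \<Rightarrow> k | Suc j \<Rightarrow> a j)" for i
    have "\<forall>i. b i \<in> K" using a pk unfolding b_def by (auto split: nat.split)
    moreover from *[OF this] have "x = (\<Oplus>i\<in>{..Suc n}. b i \<otimes> t [^] i)" using pk a unfolding b_def by simp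
    ultimately show "x \<in> {\<Oplus>i\<in>{..Suc n}. a i \<otimes> t [^] i | a. \<forall>i. a i \<in> K}" by blast
  next
    fix x assume "x \<in> {\<Oplus>i\<in>{..Suc n}. a i \<otimes> t [^] i | a. \<forall>i. a i \<in> K}"
    then obtain a where a: "\<forall>i. a i \<in> K" "x = (\<Oplus>i\<in>{..Suc n}. a i \<otimes> t [^] i)" by blast
    moreover have "(\<Oplus>i\<in>{..n}. a (Suc i) \<otimes> t [^] i) \<in> P n"
      unfolding Suc using a(1) by (intro CollectI exI[of _ "\<lambda>i. a (Suc i)"]) auto
    ultimately show "x \<in> P (Suc n)" unfolding P_Suc_iff using *[OF a(1)] by blast
  qed
qed

lemma finsum_eq_zero_imp:
  fixes n :: nat
  shows "\<forall>i. a i \<in> K \<Longrightarrow> (\<Oplus>i\<in>{..n}. a i \<otimes> t [^] i) = \<zero> \<Longrightarrow> i \<le> n \<Longrightarrow> a i = \<zero>"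
proof (induction n arbitrary: a i)
  case 0
  then have "a 0 \<in> carrier R" using K_carrier by blast
  moreover from this have "(\<Oplus>i\<in>{..0::nat}. a i \<otimes> t [^] i) = a 0" by (subst finsum_0) auto
  ultimately show ?case using 0 by simp
next
  case (Suc n)
  have ac: "a i \<in> carrier R" for i using Suc.prems K_carrier by blast
  have "(\<Oplus>i\<in>{..Suc n}. a i \<otimes> t [^] i) = (\<Oplus>i\<in>{..n}. a (Suc i) \<otimes> t [^] (Suc i)) \<oplus> a 0 \<otimes> t [^] (0::nat)"
    using ac by (intro finsum_Suc2) auto
  also have "(\<Oplus>i\<in>{..n}. a (Suc i) \<otimes> t [^] (Suc i)) = (\<Oplus>i\<in>{..n}. a (Suc i) \<otimes> t [^] i \<otimes> t)"
    using ac by (intro finsum_cong') (auto simp: m_assoc)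
  also have "\<dots> = (\<Oplus>i\<in>{..n}. a (Suc i) \<otimes> t [^] i) \<otimes> t"
    using ac by (intro finsum_ldistr[symmetric]) auto
  finally have e: "(\<Oplus>i\<in>{..n}. a (Suc i) \<otimes> t [^] i) \<otimes> t \<oplus> a 0 = \<zero>" using ac Suc.prems(2) by simp
  have "(\<Oplus>i\<in>{..n}. a (Suc i) \<otimes> t [^] i) \<in> P n"
    unfolding P_eq_finsum using Suc.prems(1) by (intro CollectI exI[of _ "\<lambda>i. a (Suc i)"]) auto
  from horner_zero[OF subsetD[OF P_T this] _ e]
  have z: "(\<Oplus>i\<in>{..n}. a (Suc i) \<otimes> t [^] i) = \<zero>" "a 0 = \<zero>" using Suc.prems(1) by auto
  show ?case
  proof (cases i)
    case (Suc j)
    then show ?thesis using Suc.IH[of "\<lambda>i. a (Suc i)" j] z Suc.prems by simp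
  qed (use z in simp)
qed

end

text \<open>A converse of \<open>horner_zero\<close>. Its hypothesis concerns one degree bound n at
  a time and can therefore be checked in an ultraproduct.\<close>

lemma (in field) transcendental_elemI:
  assumes K: "subfield K R" and t: "t \<in> carrier R"
    and horner: "\<And>n p k. p \<in> poly_vals K t n \<Longrightarrow> k \<in> K \<Longrightarrow> p \<otimes> t \<oplus> k = \<zero> \<Longrightarrow> p = \<zero> \<and> k = \<zero>"
  shows "transcendental_elem R K t"
proof -
  note Kc = subfieldE(3)[OF K]
  have eval_poly_vals: "set q \<subseteq> K \<Longrightarrow> eval q t \<in> poly_vals K t (length q)" for q
  proof (induction q rule: rev_induct)
    case Nil
    then show ?case using subringE(2)[OF subfieldE(1)[OF K]] by simp
  next
    case (snoc k q)
    then have "eval (q @ [k]) t = eval q t \<otimes> t \<oplus> k" using eval_append_aux[of q k t] t Kc by auto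
    then show ?case using snoc by auto
  qed
  have zeros: "set q \<subseteq> K \<Longrightarrow> eval q t = \<zero> \<Longrightarrow> set q \<subseteq> {\<zero>}" for q
  proof (induction q rule: rev_induct)
    case (snoc k q)
    then have "eval (q @ [k]) t = eval q t \<otimes> t \<oplus> k" using eval_append_aux[of q k t] t Kc by auto
    then have "eval q t = \<zero> \<and> k = \<zero>" using horner[OF eval_poly_vals, of q k] snoc by auto
    then show ?case using snoc by auto
  qed simp
  have "q = []" if "q \<in> carrier (K[X])" "eval q t = \<zero>" for q
  proof (rule ccontr)
    assume "q \<noteq> []"
    moreover have "polynomial K q" using that univ_poly_carrier by blast
    ultimately have "hd q \<noteq> \<zero>" "set q \<subseteq> K" unfolding polynomial_def by auto
    then show False using zeros[of q] that \<open>q \<noteq> []\<close> hd_in_set[of q] by blast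
  qed
  moreover have "[] \<in> carrier (K[X])" "eval [] t = \<zero>" by auto
  ultimately have "a_kernel (K[X]) R (\<lambda>p. eval p t) = {[]}" unfolding a_kernel_def' by auto
  then have "transcendental K t"
    using trivial_ker_imp_transcendental[OF subfieldE(1)[OF K] t] by (simp add: over_def)
  with K t show ?thesis
    by (intro transcendental_elem.intro field_axioms transcendental_elem_axioms.intro)
qed

section \<open>Ultraproducts of fields\<close>

locale ultraproduct =
  fixes D :: "'s filter" and \<Omega> :: "'s \<Rightarrow> 'b ring"
  assumes ultra: "is_ultrafilter D" and fields: "\<And>s. field (\<Omega> s)"
begin

abbreviation U where "U \<equiv> ultraprod D \<Omega>"

text \<open>Representatives lie in the carrier at every index, as in \<open>ultraprod\<close>,
  whereas membership in smaller sets is asked for almost everywhere only.\<close>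

definition el :: "('s \<Rightarrow> 'b) \<Rightarrow> bool" where "el f \<longleftrightarrow> (\<forall>s. f s \<in> carrier (\<Omega> s))"

lemma ev_not: "\<not> eventually P D \<longleftrightarrow> eventually (\<lambda>s. \<not> P s) D"
proof
  assume "eventually (\<lambda>s. \<not> P s) D"
  then show "\<not> eventually P D"
    using ultra eventually_elim2[of P D "\<lambda>s. \<not> P s" "\<lambda>_. False"] unfolding is_ultrafilter_def by auto
qed (use ultra in \<open>auto simp: is_ultrafilter_def\<close>)

text \<open>A finite union belongs to an ultrafilter only if one of its members does. This later
  fixes one coefficient of a denominator that is nonzero for almost all s.\<close>

lemma ev_bex_finite:
  "finite I \<Longrightarrow> eventually (\<lambda>s. \<exists>i \<in> I. P i s) D \<longleftrightarrow> (\<exists>i \<in> I. eventually (P i) D)"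
proof -
  assume I: "finite I"
  have "\<not> eventually (\<lambda>s. \<exists>i \<in> I. P i s) D \<longleftrightarrow> \<not> (\<exists>i \<in> I. eventually (P i) D)"
    using I by (simp add: ev_not eventually_ball_finite_distrib)
  then show ?thesis by blast
qed

lemma ucls_eq_iff: "ucls D f = ucls D g \<longleftrightarrow> eventually (\<lambda>s. f s = g s) D"
proof
  assume "ucls D f = ucls D g"
  moreover have "f \<in> ucls D f" unfolding ucls_def by simp
  ultimately show "eventually (\<lambda>s. f s = g s) D" unfolding ucls_def by blast
next
  assume "eventually (\<lambda>s. f s = g s) D"
  then show "ucls D f = ucls D g" unfolding ucls_def by (auto elim: eventually_elim2)
qed

lemma carrier_U: "carrier U = {ucls D f | f. el f}"
  unfolding ultraprod_def el_def by simp

lemma in_carrier_U [simp, intro]: "el f \<Longrightarrow> ucls D f \<in> carrier U"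
  unfolding carrier_U by blast

lemma carrier_U_cases:
  assumes "x \<in> carrier U" obtains f where "el f" "x = ucls D f"
  using assms unfolding carrier_U by blast

lemma mult_U: "ucls D f \<otimes>\<^bsub>U\<^esub> ucls D g = ucls D (\<lambda>s. f s \<otimes>\<^bsub>\<Omega> s\<^esub> g s)"
proof (intro equalityI subsetI)
  fix h assume "h \<in> ucls D f \<otimes>\<^bsub>U\<^esub> ucls D g"
  then obtain f' g' where "eventually (\<lambda>s. f' s = f s) D" "eventually (\<lambda>s. g' s = g s) D"
    "eventually (\<lambda>s. h s = f' s \<otimes>\<^bsub>\<Omega> s\<^esub> g' s) D"
    unfolding ultraprod_def ucls_def by auto
  then have "eventually (\<lambda>s. h s = f s \<otimes>\<^bsub>\<Omega> s\<^esub> g s) D" by eventually_elim simp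
  then show "h \<in> ucls D (\<lambda>s. f s \<otimes>\<^bsub>\<Omega> s\<^esub> g s)" unfolding ucls_def by simp
next
  fix h assume "h \<in> ucls D (\<lambda>s. f s \<otimes>\<^bsub>\<Omega> s\<^esub> g s)"
  moreover have "f \<in> ucls D f" "g \<in> ucls D g" unfolding ucls_def by simp_all
  ultimately show "h \<in> ucls D f \<otimes>\<^bsub>U\<^esub> ucls D g"
    unfolding ultraprod_def ucls_def[of D "\<lambda>s. f s \<otimes>\<^bsub>\<Omega> s\<^esub> g s"] by auto
qed

lemma add_U: "ucls D f \<oplus>\<^bsub>U\<^esub> ucls D g = ucls D (\<lambda>s. f s \<oplus>\<^bsub>\<Omega> s\<^esub> g s)"
proof (intro equalityI subsetI)
  fix h assume "h \<in> ucls D f \<oplus>\<^bsub>U\<^esub> ucls D g"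
  then obtain f' g' where "eventually (\<lambda>s. f' s = f s) D" "eventually (\<lambda>s. g' s = g s) D"
    "eventually (\<lambda>s. h s = f' s \<oplus>\<^bsub>\<Omega> s\<^esub> g' s) D"
    unfolding ultraprod_def ucls_def by auto
  then have "eventually (\<lambda>s. h s = f s \<oplus>\<^bsub>\<Omega> s\<^esub> g s) D" by eventually_elim simp
  then show "h \<in> ucls D (\<lambda>s. f s \<oplus>\<^bsub>\<Omega> s\<^esub> g s)" unfolding ucls_def by simp
next
  fix h assume "h \<in> ucls D (\<lambda>s. f s \<oplus>\<^bsub>\<Omega> s\<^esub> g s)"
  moreover have "f \<in> ucls D f" "g \<in> ucls D g" unfolding ucls_def by simp_all
  ultimately show "h \<in> ucls D f \<oplus>\<^bsub>U\<^esub> ucls D g"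
    unfolding ultraprod_def ucls_def[of D "\<lambda>s. f s \<oplus>\<^bsub>\<Omega> s\<^esub> g s"] by auto
qed

lemma one_U: "\<one>\<^bsub>U\<^esub> = ucls D (\<lambda>s. \<one>\<^bsub>\<Omega> s\<^esub>)" and zero_U: "\<zero>\<^bsub>U\<^esub> = ucls D (\<lambda>s. \<zero>\<^bsub>\<Omega> s\<^esub>)"
  unfolding ultraprod_def by simp_all

sublocale F: field "\<Omega> s" for s by (rule fields)

lemma el_ops [simp, intro]:
  "el (\<lambda>s. \<one>\<^bsub>\<Omega> s\<^esub>)" "el (\<lambda>s. \<zero>\<^bsub>\<Omega> s\<^esub>)"
  "el f \<Longrightarrow> el g \<Longrightarrow> el (\<lambda>s. f s \<otimes>\<^bsub>\<Omega> s\<^esub> g s)"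
  "el f \<Longrightarrow> el g \<Longrightarrow> el (\<lambda>s. f s \<oplus>\<^bsub>\<Omega> s\<^esub> g s)"
  "el f \<Longrightarrow> el (\<lambda>s. \<ominus>\<^bsub>\<Omega> s\<^esub> f s)"
  "el f \<Longrightarrow> el (\<lambda>s. f s [^]\<^bsub>\<Omega> s\<^esub> (n::nat))"
  unfolding el_def
  by auto

lemma elD: "el f \<Longrightarrow> f s \<in> carrier (\<Omega> s)" unfolding el_def by blast

lemma field_U: "field U"
proof -
  have cr: "cring U"
  proof (rule cringI)
    show "abelian_group U"
    proof (rule abelian_groupI)
      fix x y z assume "x \<in> carrier U" "y \<in> carrier U" "z \<in> carrier U"
      then obtain f g h where *: "el f" "x = ucls D f" "el g" "y = ucls D g" "el h" "z = ucls D h"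
        by (auto elim!: carrier_U_cases)
      note E = *(1,3,5)[THEN elD]
      show "x \<oplus>\<^bsub>U\<^esub> y \<oplus>\<^bsub>U\<^esub> z = x \<oplus>\<^bsub>U\<^esub> (y \<oplus>\<^bsub>U\<^esub> z)"
        unfolding * add_U by (simp add: F.a_assoc E)
      show "x \<oplus>\<^bsub>U\<^esub> y = y \<oplus>\<^bsub>U\<^esub> x" unfolding * add_U by (simp add: F.a_comm E)
    next
      fix x assume "x \<in> carrier U"
      then obtain f where *: "el f" "x = ucls D f" by (rule carrier_U_cases)
      show "\<zero>\<^bsub>U\<^esub> \<oplus>\<^bsub>U\<^esub> x = x" unfolding * add_U zero_U by (simp add: elD[OF *(1)])
      show "\<exists>y\<in>carrier U. y \<oplus>\<^bsub>U\<^esub> x = \<zero>\<^bsub>U\<^esub>"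
        by (rule bexI[of _ "ucls D (\<lambda>s. \<ominus>\<^bsub>\<Omega> s\<^esub> f s)"])
          (use *(1) in \<open>auto simp: *(2) add_U zero_U elD F.l_neg\<close>)
    qed (auto simp: zero_U add_U elim!: carrier_U_cases)
    show "comm_monoid U"
    proof (rule comm_monoidI)
      fix x y z assume "x \<in> carrier U" "y \<in> carrier U" "z \<in> carrier U"
      then obtain f g h where *: "el f" "x = ucls D f" "el g" "y = ucls D g" "el h" "z = ucls D h"
        by (auto elim!: carrier_U_cases)
      note E = *(1,3,5)[THEN elD]
      show "x \<otimes>\<^bsub>U\<^esub> y \<otimes>\<^bsub>U\<^esub> z = x \<otimes>\<^bsub>U\<^esub> (y \<otimes>\<^bsub>U\<^esub> z)"
        unfolding * mult_U by (simp add: F.m_assoc E)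
      show "x \<otimes>\<^bsub>U\<^esub> y = y \<otimes>\<^bsub>U\<^esub> x" unfolding * mult_U by (simp add: F.m_comm E)
    next
      fix x assume "x \<in> carrier U"
      then obtain f where *: "el f" "x = ucls D f" by (rule carrier_U_cases)
      show "\<one>\<^bsub>U\<^esub> \<otimes>\<^bsub>U\<^esub> x = x" unfolding * mult_U one_U by (simp add: elD[OF *(1)])
    qed (auto simp: one_U mult_U elim!: carrier_U_cases)
    fix x y z assume "x \<in> carrier U" "y \<in> carrier U" "z \<in> carrier U"
    then obtain f g h where *: "el f" "x = ucls D f" "el g" "y = ucls D g" "el h" "z = ucls D h"
      by (auto elim!: carrier_U_cases)
    note E = *(1,3,5)[THEN elD]
    show "(x \<oplus>\<^bsub>U\<^esub> y) \<otimes>\<^bsub>U\<^esub> z = x \<otimes>\<^bsub>U\<^esub> z \<oplus>\<^bsub>U\<^esub> y \<otimes>\<^bsub>U\<^esub> z"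
      unfolding * mult_U add_U by (simp add: F.l_distr E)
  qed
  show ?thesis
  proof (rule cring.cring_fieldI2[OF cr])
    show "\<zero>\<^bsub>U\<^esub> \<noteq> \<one>\<^bsub>U\<^esub>"
      unfolding zero_U one_U ucls_eq_iff ev_not by (simp add: F.one_not_zero[symmetric])
    fix x assume x: "x \<in> carrier U" "x \<noteq> \<zero>\<^bsub>U\<^esub>"
    then obtain f where *: "el f" "x = ucls D f" by (auto elim!: carrier_U_cases)
    \<comment> \<open>The value zero keeps g inside the carriers where f vanishes, and these indices
      are negligible.\<close>
    define g where "g s = (if f s = \<zero>\<^bsub>\<Omega> s\<^esub> then \<zero>\<^bsub>\<Omega> s\<^esub> else inv\<^bsub>\<Omega> s\<^esub> f s)" for s
    have unit: "f s \<in> Units (\<Omega> s)" if "f s \<noteq> \<zero>\<^bsub>\<Omega> s\<^esub>" for s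
      using F.field_Units that elD[OF *(1)] by blast
    have g: "el g" unfolding el_def g_def
      using F.Units_inv_closed[OF unit] by auto
    have "eventually (\<lambda>s. f s \<noteq> \<zero>\<^bsub>\<Omega> s\<^esub>) D" using x(2) unfolding * zero_U ucls_eq_iff ev_not .
    then have "eventually (\<lambda>s. f s \<otimes>\<^bsub>\<Omega> s\<^esub> g s = \<one>\<^bsub>\<Omega> s\<^esub>) D"
      by eventually_elim (simp add: g_def F.Units_r_inv[OF unit])
    then have "x \<otimes>\<^bsub>U\<^esub> ucls D g = \<one>\<^bsub>U\<^esub>" unfolding * mult_U one_U ucls_eq_iff .
    then show "\<exists>y\<in>carrier U. x \<otimes>\<^bsub>U\<^esub> y = \<one>\<^bsub>U\<^esub>" using g by blast
  qed
qed

sublocale U: field U by (rule field_U)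

abbreviation "us \<equiv> ultraset D \<Omega>"

lemma us_iff: "el f \<Longrightarrow> ucls D f \<in> us A \<longleftrightarrow> eventually (\<lambda>s. f s \<in> A s) D"
proof
  assume "ucls D f \<in> us A"
  then obtain g where "ucls D f = ucls D g" "eventually (\<lambda>s. g s \<in> A s) D"
    unfolding ultraset_def by blast
  then have "eventually (\<lambda>s. f s = g s) D" "eventually (\<lambda>s. g s \<in> A s) D" using ucls_eq_iff by auto
  then show "eventually (\<lambda>s. f s \<in> A s) D" by eventually_elim simp
qed (auto simp: ultraset_def el_def)

lemma us_carrier: "us A \<subseteq> carrier U"
  unfolding ultraset_def carrier_U el_def by blast

lemma set_eqI_el:
  assumes "A \<subseteq> carrier U" "B \<subseteq> carrier U" "\<And>f. el f \<Longrightarrow> ucls D f \<in> A \<longleftrightarrow> ucls D f \<in> B"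
  shows "A = B"
  using assms carrier_U_cases by (metis subset_antisym subsetI subsetD)

text \<open>The existential step of Los's theorem. Where no witness exists, some element of the
  carrier is taken, so that the choice is a representative at every index.\<close>

lemma ev_choice:
  assumes "eventually (\<lambda>s. \<exists>x \<in> carrier (\<Omega> s). Q s x) D"
  shows "\<exists>g. el g \<and> eventually (\<lambda>s. Q s (g s)) D"
proof -
  have "\<exists>x \<in> carrier (\<Omega> s). (\<exists>x \<in> carrier (\<Omega> s). Q s x) \<longrightarrow> Q s x" for s
    using F.zero_closed by blast
  then obtain g where g: "\<And>s. g s \<in> carrier (\<Omega> s)" "\<And>s. (\<exists>x \<in> carrier (\<Omega> s). Q s x) \<Longrightarrow> Q s (g s)"
    by metis
  from assms have "eventually (\<lambda>s. Q s (g s)) D" by eventually_elim (rule g(2))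
  with g(1) show ?thesis unfolding el_def by blast
qed

text \<open>A Horner step and the addition of a generator to a span both have the form a w + b. With
  this one formula transferred, \<open>poly_vals\<close> and \<open>Span\<close> commute with
  ultraproducts by induction.\<close>

lemma us_linear:
  assumes A: "\<And>s. A s \<subseteq> carrier (\<Omega> s)" and B: "\<And>s. B s \<subseteq> carrier (\<Omega> s)" and f: "el f" and w: "el w"
  shows "(\<exists>a \<in> us A. \<exists>b \<in> us B. ucls D f = a \<otimes>\<^bsub>U\<^esub> ucls D w \<oplus>\<^bsub>U\<^esub> b) \<longleftrightarrow>
    eventually (\<lambda>s. \<exists>a \<in> A s. \<exists>b \<in> B s. f s = a \<otimes>\<^bsub>\<Omega> s\<^esub> w s \<oplus>\<^bsub>\<Omega> s\<^esub> b) D" (is "?l = ?r")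
proof
  assume ?l
  then obtain a b where ab: "a \<in> us A" "b \<in> us B" "ucls D f = a \<otimes>\<^bsub>U\<^esub> ucls D w \<oplus>\<^bsub>U\<^esub> b" by blast
  obtain g where g: "el g" "a = ucls D g" using carrier_U_cases[OF subsetD[OF us_carrier ab(1)]] .
  obtain h where h: "el h" "b = ucls D h" using carrier_U_cases[OF subsetD[OF us_carrier ab(2)]] .
  have "eventually (\<lambda>s. g s \<in> A s) D" "eventually (\<lambda>s. h s \<in> B s) D"
    using ab(1,2) unfolding g(2) h(2) us_iff[OF g(1)] us_iff[OF h(1)] .
  moreover have "eventually (\<lambda>s. f s = g s \<otimes>\<^bsub>\<Omega> s\<^esub> w s \<oplus>\<^bsub>\<Omega> s\<^esub> h s) D"
    using ab(3) unfolding g h mult_U add_U ucls_eq_iff .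
  ultimately show ?r by eventually_elim blast
next
  assume ?r
  then have "eventually (\<lambda>s. \<exists>a \<in> carrier (\<Omega> s). a \<in> A s \<and>
      (\<exists>b \<in> carrier (\<Omega> s). b \<in> B s \<and> f s = a \<otimes>\<^bsub>\<Omega> s\<^esub> w s \<oplus>\<^bsub>\<Omega> s\<^esub> b)) D"
    by eventually_elim (blast intro: A[THEN subsetD] B[THEN subsetD])
  from ev_choice[OF this] obtain g where g: "el g" "eventually (\<lambda>s. g s \<in> A s \<and>
      (\<exists>b \<in> carrier (\<Omega> s). b \<in> B s \<and> f s = g s \<otimes>\<^bsub>\<Omega> s\<^esub> w s \<oplus>\<^bsub>\<Omega> s\<^esub> b)) D"
    by blast
  then have "eventually (\<lambda>s. \<exists>b \<in> carrier (\<Omega> s). g s \<in> A s \<and> b \<in> B s \<and> f s = g s \<otimes>\<^bsub>\<Omega> s\<^esub> w s \<oplus>\<^bsub>\<Omega> s\<^esub> b) D"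
    by (elim eventually_mono) blast
  from ev_choice[OF this] obtain h where h: "el h"
    "eventually (\<lambda>s. g s \<in> A s \<and> h s \<in> B s \<and> f s = g s \<otimes>\<^bsub>\<Omega> s\<^esub> w s \<oplus>\<^bsub>\<Omega> s\<^esub> h s) D"
    by blast
  then have "eventually (\<lambda>s. g s \<in> A s) D" "eventually (\<lambda>s. h s \<in> B s) D"
    "eventually (\<lambda>s. f s = g s \<otimes>\<^bsub>\<Omega> s\<^esub> w s \<oplus>\<^bsub>\<Omega> s\<^esub> h s) D"
    by (auto elim: eventually_mono)
  then show ?l
    by (intro bexI[of _ "ucls D g"] bexI[of _ "ucls D h"]) (simp_all add: us_iff g(1) h(1) mult_U add_U ucls_eq_iff)
qed

lemma poly_vals_us:
  assumes A: "\<And>s. A s \<subseteq> carrier (\<Omega> s)" and \<tau>: "el \<tau>"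
  shows "U.poly_vals (us A) (ucls D \<tau>) n = us (\<lambda>s. cring.poly_vals (\<Omega> s) (A s) (\<tau> s) n)"
proof (induction n)
  case 0
  show ?case by simp
next
  case (Suc n)
  define P where "P s = cring.poly_vals (\<Omega> s) (A s) (\<tau> s) n" for s
  have Pc: "P s \<subseteq> carrier (\<Omega> s)" for s unfolding P_def using F.poly_vals_carrier[OF A elD[OF \<tau>]] .
  have Suc': "x \<in> cring.poly_vals (\<Omega> s) (A s) (\<tau> s) (Suc n) \<longleftrightarrow>
      (\<exists>p \<in> P s. \<exists>k \<in> A s. x = p \<otimes>\<^bsub>\<Omega> s\<^esub> \<tau> s \<oplus>\<^bsub>\<Omega> s\<^esub> k)" for x s
    unfolding F.poly_vals.simps P_def by blast
  show ?case
  proof (rule set_eqI_el)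
    show "U.poly_vals (us A) (ucls D \<tau>) (Suc n) \<subseteq> carrier U"
      using U.poly_vals_carrier[OF us_carrier in_carrier_U[OF \<tau>]] .
    fix f assume f: "el f"
    have "ucls D f \<in> U.poly_vals (us A) (ucls D \<tau>) (Suc n) \<longleftrightarrow>
      (\<exists>p \<in> us P. \<exists>k \<in> us A. ucls D f = p \<otimes>\<^bsub>U\<^esub> ucls D \<tau> \<oplus>\<^bsub>U\<^esub> k)"
      unfolding U.poly_vals.simps P_def Suc by blast
    also have "\<dots> \<longleftrightarrow> eventually (\<lambda>s. f s \<in> cring.poly_vals (\<Omega> s) (A s) (\<tau> s) (Suc n)) D"
      unfolding us_linear[of P, OF Pc A f \<tau>] Suc' ..
    finally show "ucls D f \<in> U.poly_vals (us A) (ucls D \<tau>) (Suc n) \<longleftrightarrow>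
       ucls D f \<in> us (\<lambda>s. cring.poly_vals (\<Omega> s) (A s) (\<tau> s) (Suc n))"
      using us_iff[OF f] by simp
  qed (rule us_carrier)
qed

abbreviation vals :: "('s \<Rightarrow> 'b) list \<Rightarrow> 's \<Rightarrow> 'b list" where "vals fs s \<equiv> map (\<lambda>f. f s) fs"

lemma vals_carrier: "\<forall>f \<in> set fs. el f \<Longrightarrow> set (vals fs s) \<subseteq> carrier (\<Omega> s)"
  using elD by auto

lemma map_ucls_carrier: "\<forall>f \<in> set fs. el f \<Longrightarrow> set (map (ucls D) fs) \<subseteq> carrier U"
  by auto

lemma Span_us:
  assumes A: "\<And>s. A s \<subseteq> carrier (\<Omega> s)"
  shows "\<forall>f \<in> set fs. el f \<Longrightarrow>
    U.Span (us A) (map (ucls D) fs) = us (\<lambda>s. ring.Span (\<Omega> s) (A s) (vals fs s))"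
proof (induction fs)
  case Nil
  show ?case
    by (rule set_eqI_el) (auto simp: us_iff us_carrier[THEN subsetD] zero_U ucls_eq_iff)
next
  case (Cons w fs)
  define P where "P s = ring.Span (\<Omega> s) (A s) (vals fs s)" for s
  have w: "el w" and fs: "\<forall>f \<in> set fs. el f" using Cons.prems by auto
  have Pc: "P s \<subseteq> carrier (\<Omega> s)" for s unfolding P_def using F.Span_in_carrier[OF A vals_carrier[OF fs]] .
  have IH: "U.Span (us A) (map (ucls D) fs) = us P" unfolding P_def using Cons.IH[OF fs] .
  have Cons': "x \<in> ring.Span (\<Omega> s) (A s) (vals (w # fs) s) \<longleftrightarrow>
      (\<exists>k \<in> A s. \<exists>p \<in> P s. x = k \<otimes>\<^bsub>\<Omega> s\<^esub> w s \<oplus>\<^bsub>\<Omega> s\<^esub> p)" for x s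
    unfolding list.map F.Span_Cons_iff P_def by blast
  show ?case
  proof (rule set_eqI_el)
    show "U.Span (us A) (map (ucls D) (w # fs)) \<subseteq> carrier U"
      using U.Span_in_carrier[OF us_carrier map_ucls_carrier[OF Cons.prems]] .
    fix f assume f: "el f"
    have "ucls D f \<in> U.Span (us A) (map (ucls D) (w # fs)) \<longleftrightarrow>
      (\<exists>k \<in> us A. \<exists>p \<in> us P. ucls D f = k \<otimes>\<^bsub>U\<^esub> ucls D w \<oplus>\<^bsub>U\<^esub> p)"
      unfolding list.map U.Span_Cons_iff IH by blast
    also have "\<dots> \<longleftrightarrow> eventually (\<lambda>s. f s \<in> ring.Span (\<Omega> s) (A s) (vals (w # fs) s)) D"
      unfolding us_linear[of A, OF A Pc f w] Cons' ..
    finally show "ucls D f \<in> U.Span (us A) (map (ucls D) (w # fs)) \<longleftrightarrow>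
       ucls D f \<in> us (\<lambda>s. ring.Span (\<Omega> s) (A s) (vals (w # fs) s))"
      using us_iff[OF f] by simp
  qed (rule us_carrier)
qed

text \<open>Freeness denies the existence of a nonzero coefficient, so its transfer uses that the
  ultrafilter decides every set. The coefficients on the left form the whole ultraproduct of the
  sets A s; applied to \<open>Ps s n\<close> with fixed n this is again a set of polynomials of
  degree at most n.\<close>

lemma free_over_us:
  assumes A: "\<And>s. A s \<subseteq> carrier (\<Omega> s)"
  shows "\<forall>f \<in> set fs. el f \<Longrightarrow>
    U.free_over (us A) (map (ucls D) fs) \<longleftrightarrow> eventually (\<lambda>s. cring.free_over (\<Omega> s) (A s) (vals fs s)) D"
proof (induction fs)
  case (Cons w fs)
  define P where "P s = ring.Span (\<Omega> s) (A s) (vals fs s)" for s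
  have w: "el w" and fs: "\<forall>f \<in> set fs. el f" using Cons.prems by auto
  have eq: "U.Span (us A) (map (ucls D) fs) = us P" unfolding P_def using Span_us[of A, OF A fs] .
  have "(\<exists>a \<in> us A. a \<otimes>\<^bsub>U\<^esub> ucls D w \<in> us P \<and> a \<noteq> \<zero>\<^bsub>U\<^esub>) \<longleftrightarrow>
    eventually (\<lambda>s. \<exists>a \<in> A s. a \<otimes>\<^bsub>\<Omega> s\<^esub> w s \<in> P s \<and> a \<noteq> \<zero>\<^bsub>\<Omega> s\<^esub>) D" (is "?l = ?r")
  proof
    assume ?l
    then obtain a where a: "a \<in> us A" "a \<otimes>\<^bsub>U\<^esub> ucls D w \<in> us P" "a \<noteq> \<zero>\<^bsub>U\<^esub>" by blast
    obtain g where g: "el g" "a = ucls D g" using a(1) us_carrier carrier_U_cases by blast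
    have "eventually (\<lambda>s. g s \<in> A s) D" using a(1) g us_iff by simp
    moreover have "eventually (\<lambda>s. g s \<otimes>\<^bsub>\<Omega> s\<^esub> w s \<in> P s) D"
      using a(2) unfolding g(2) mult_U us_iff[OF el_ops(3)[OF g(1) w]] .
    moreover have "eventually (\<lambda>s. g s \<noteq> \<zero>\<^bsub>\<Omega> s\<^esub>) D"
      using a(3) unfolding g(2) zero_U ucls_eq_iff ev_not .
    ultimately show ?r by eventually_elim blast
  next
    assume ?r
    then have "eventually (\<lambda>s. \<exists>a \<in> carrier (\<Omega> s). a \<in> A s \<and> a \<otimes>\<^bsub>\<Omega> s\<^esub> w s \<in> P s \<and> a \<noteq> \<zero>\<^bsub>\<Omega> s\<^esub>) D"
      by eventually_elim (blast intro: A[THEN subsetD])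
    from ev_choice[OF this] obtain g where g: "el g"
      "eventually (\<lambda>s. g s \<in> A s \<and> g s \<otimes>\<^bsub>\<Omega> s\<^esub> w s \<in> P s \<and> g s \<noteq> \<zero>\<^bsub>\<Omega> s\<^esub>) D"
      by blast
    then have "ucls D g \<in> us A" "ucls D g \<otimes>\<^bsub>U\<^esub> ucls D w \<in> us P" "ucls D g \<noteq> \<zero>\<^bsub>U\<^esub>"
      unfolding mult_U us_iff[OF g(1)] us_iff[OF el_ops(3)[OF g(1) w]] zero_U ucls_eq_iff ev_not
      by (auto elim: eventually_mono)
    then show ?l by blast
  qed
  then have "(\<forall>a \<in> us A. a \<otimes>\<^bsub>U\<^esub> ucls D w \<in> us P \<longrightarrow> a = \<zero>\<^bsub>U\<^esub>) \<longleftrightarrow>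
    eventually (\<lambda>s. \<forall>a \<in> A s. a \<otimes>\<^bsub>\<Omega> s\<^esub> w s \<in> P s \<longrightarrow> a = \<zero>\<^bsub>\<Omega> s\<^esub>) D"
    using ev_not[of "\<lambda>s. \<exists>a \<in> A s. a \<otimes>\<^bsub>\<Omega> s\<^esub> w s \<in> P s \<and> a \<noteq> \<zero>\<^bsub>\<Omega> s\<^esub>"]
    by (smt (verit, best) eventually_mono)
  then show ?case unfolding list.map U.free_over.simps F.free_over.simps eq P_def[symmetric] Cons.IH[OF fs]
    by (simp add: eventually_conj_iff)
qed simp

lemma subfield_us:
  assumes A: "eventually (\<lambda>s. subfield (A s) (\<Omega> s)) D"
  shows "subfield (us A) U"
proof (rule U.subfieldI')
  show "subring (us A) U"
  proof (rule U.subringI[OF us_carrier])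
    show "\<one>\<^bsub>U\<^esub> \<in> us A" unfolding one_U us_iff[OF el_ops(1)]
      using A by eventually_elim (rule subringE(3)[OF subfieldE(1)])
  next
    fix x assume x: "x \<in> us A"
    then obtain f where f: "el f" "x = ucls D f" using us_carrier carrier_U_cases by blast
    then have fA: "eventually (\<lambda>s. f s \<in> A s) D" using x us_iff by simp
    have "\<ominus>\<^bsub>U\<^esub> x = ucls D (\<lambda>s. \<ominus>\<^bsub>\<Omega> s\<^esub> f s)"
      by (rule U.minus_equality) (use f in \<open>auto simp: add_U zero_U elD F.l_neg\<close>)
    moreover have "eventually (\<lambda>s. \<ominus>\<^bsub>\<Omega> s\<^esub> f s \<in> A s) D"
      using A fA by eventually_elim (rule subringE(5)[OF subfieldE(1)])
    ultimately show "\<ominus>\<^bsub>U\<^esub> x \<in> us A" using us_iff[OF el_ops(5)[OF f(1)]] by simp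
  next
    fix x y assume xy: "x \<in> us A" "y \<in> us A"
    obtain f where f: "el f" "x = ucls D f" using xy us_carrier carrier_U_cases by blast
    obtain g where g: "el g" "y = ucls D g" using xy us_carrier carrier_U_cases by blast
    have fA: "eventually (\<lambda>s. f s \<in> A s) D" "eventually (\<lambda>s. g s \<in> A s) D" using xy us_iff f g by simp_all
    have "eventually (\<lambda>s. f s \<otimes>\<^bsub>\<Omega> s\<^esub> g s \<in> A s) D"
      using A fA by eventually_elim (rule subringE(6)[OF subfieldE(1)])
    then show "x \<otimes>\<^bsub>U\<^esub> y \<in> us A" unfolding f(2) g(2) mult_U us_iff[OF el_ops(3)[OF f(1) g(1)]] .
    have "eventually (\<lambda>s. f s \<oplus>\<^bsub>\<Omega> s\<^esub> g s \<in> A s) D"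
      using A fA by eventually_elim (rule subringE(7)[OF subfieldE(1)])
    then show "x \<oplus>\<^bsub>U\<^esub> y \<in> us A" unfolding f(2) g(2) add_U us_iff[OF el_ops(4)[OF f(1) g(1)]] .
  qed
next
  fix x assume x: "x \<in> us A - {\<zero>\<^bsub>U\<^esub>}"
  then have xc: "x \<in> carrier U" "x \<noteq> \<zero>\<^bsub>U\<^esub>" using subsetD[OF us_carrier] by auto
  obtain f where f: "el f" "x = ucls D f" using carrier_U_cases[OF xc(1)] .
  have "ucls D f \<in> us A" "ucls D f \<noteq> \<zero>\<^bsub>U\<^esub>" using x f by simp_all
  then have fA: "eventually (\<lambda>s. f s \<in> A s) D" "eventually (\<lambda>s. f s \<noteq> \<zero>\<^bsub>\<Omega> s\<^esub>) D"
    unfolding zero_U ucls_eq_iff ev_not us_iff[OF f(1)] .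
  have xu: "inv\<^bsub>U\<^esub> x \<in> carrier U" "x \<otimes>\<^bsub>U\<^esub> inv\<^bsub>U\<^esub> x = \<one>\<^bsub>U\<^esub>"
    using xc U.field_Units U.Units_inv_closed U.Units_r_inv by auto
  obtain g where g: "el g" "inv\<^bsub>U\<^esub> x = ucls D g" using xu(1) carrier_U_cases by blast
  have "eventually (\<lambda>s. f s \<otimes>\<^bsub>\<Omega> s\<^esub> g s = \<one>\<^bsub>\<Omega> s\<^esub>) D"
    using xu(2) unfolding g(2) unfolding f(2) mult_U one_U ucls_eq_iff .
  then have "eventually (\<lambda>s. g s \<in> A s) D"
    using A fA
  proof eventually_elim
    case (elim s)
    then show ?case
      using F.subfield_m_inv_simprule[OF elim(2), of "f s" "g s"] elD[OF g(1)]
        subringE(3)[OF subfieldE(1)[OF elim(2)]] by simp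
  qed
  then show "inv\<^bsub>U\<^esub> x \<in> us A" unfolding g(2) us_iff[OF g(1)] .
qed

end

section \<open>The field K(t) inside the ultraproduct\<close>

locale ultra_ratfun = ultraproduct D \<Omega> for D :: "'s filter" and \<Omega> :: "'s \<Rightarrow> 'b ring" +
  fixes K :: "'s \<Rightarrow> 'b set" and t :: "'s \<Rightarrow> 'b"
  assumes trans_s: "\<And>s. transcendental_elem (\<Omega> s) (K s) (t s)"
begin

sublocale E: transcendental_elem "\<Omega> s" "K s" "t s" for s by (rule trans_s)

lemma el_t: "el t" unfolding el_def by simp

abbreviation "Fs s \<equiv> transcendental_elem.Fr (\<Omega> s) (K s) (t s)"
abbreviation "Ts s \<equiv> transcendental_elem.T (\<Omega> s) (K s) (t s)"
abbreviation "Ps s \<equiv> cring.poly_vals (\<Omega> s) (K s) (t s)"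

lemma poly_vals_K: "U.poly_vals (us K) (ucls D t) n = us (\<lambda>s. Ps s n)"
  by (rule poly_vals_us[OF E.K_carrier el_t])

lemma trans_U: "transcendental_elem U (us K) (ucls D t)"
proof (rule U.transcendental_elemI)
  show "subfield (us K) U" by (rule subfield_us) (simp add: E.K_subfield)
  show "ucls D t \<in> carrier U" using el_t by simp
  fix n p k assume p: "p \<in> U.poly_vals (us K) (ucls D t) n" and k: "k \<in> us K"
    and eq: "p \<otimes>\<^bsub>U\<^esub> ucls D t \<oplus>\<^bsub>U\<^esub> k = \<zero>\<^bsub>U\<^esub>"
  have pc: "p \<in> carrier U" using p poly_vals_K us_carrier by blast
  have kc: "k \<in> carrier U" using k us_carrier by blast
  obtain f where f: "el f" "p = ucls D f" using carrier_U_cases[OF pc] .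
  obtain g where g: "el g" "k = ucls D g" using carrier_U_cases[OF kc] .
  have 1: "eventually (\<lambda>s. f s \<in> Ps s n) D" using p unfolding poly_vals_K f(2) us_iff[OF f(1)] .
  have 2: "eventually (\<lambda>s. g s \<in> K s) D" using k unfolding g(2) us_iff[OF g(1)] .
  have 3: "eventually (\<lambda>s. f s \<otimes>\<^bsub>\<Omega> s\<^esub> t s \<oplus>\<^bsub>\<Omega> s\<^esub> g s = \<zero>\<^bsub>\<Omega> s\<^esub>) D"
    using eq unfolding f(2) g(2) mult_U add_U zero_U ucls_eq_iff .
  have "eventually (\<lambda>s. f s = \<zero>\<^bsub>\<Omega> s\<^esub>) D"
    using 1 2 3 by eventually_elim (rule E.horner_zero(1)[OF subsetD[OF E.P_T]])
  moreover have "eventually (\<lambda>s. g s = \<zero>\<^bsub>\<Omega> s\<^esub>) D"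
    using 1 2 3 by eventually_elim (rule E.horner_zero(2)[OF subsetD[OF E.P_T]])
  ultimately show "p = \<zero>\<^bsub>U\<^esub> \<and> k = \<zero>\<^bsub>U\<^esub>" unfolding f(2) g(2) zero_U ucls_eq_iff by simp
qed

text \<open>From here on the facts about bounded degree are available twice: as \<open>E\<close> in
  every component and as \<open>V\<close> in the ultraproduct.\<close>

sublocale V: transcendental_elem U "us K" "ucls D t" by (rule trans_U)

text \<open>In general there is no converse: an element of K[t] has a degree, whereas polynomials
  chosen in the components may have degrees without a common bound.\<close>

lemma T_U_ev:
  assumes "el f" "ucls D f \<in> V.T" shows "eventually (\<lambda>s. f s \<in> Ts s) D"
proof -
  obtain n where "ucls D f \<in> U.poly_vals (us K) (ucls D t) n" using V.T_in_P[OF assms(2)] .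
  then have "eventually (\<lambda>s. f s \<in> Ps s n) D" unfolding poly_vals_K us_iff[OF assms(1)] .
  then show ?thesis by eventually_elim (rule subsetD[OF E.P_T])
qed

lemma Fs_subfield: "subfield (Fs s) (\<Omega> s)" by (rule E.Fr_subfield)
lemma Fs_carrier: "Fs s \<subseteq> carrier (\<Omega> s)" using subfieldE(3)[OF Fs_subfield] .

lemma Fr_U_us: "V.Fr \<subseteq> us Fs"
proof
  fix x assume "x \<in> V.Fr"
  then have x: "x \<in> carrier U" and "\<exists>b \<in> V.T. b \<noteq> \<zero>\<^bsub>U\<^esub> \<and> b \<otimes>\<^bsub>U\<^esub> x \<in> V.T"
    unfolding V.Fr_scale by auto
  then obtain b where b: "b \<in> V.T" "b \<noteq> \<zero>\<^bsub>U\<^esub>" "b \<otimes>\<^bsub>U\<^esub> x \<in> V.T" by blast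
  have bc: "b \<in> carrier U" using subsetD[OF V.T_carrier b(1)] .
  obtain f where f: "el f" "x = ucls D f" using carrier_U_cases[OF x] .
  obtain g where g: "el g" "b = ucls D g" using carrier_U_cases[OF bc] .
  have "eventually (\<lambda>s. g s \<in> Ts s) D" using T_U_ev[OF g(1)] b(1) g(2) by simp
  moreover have "eventually (\<lambda>s. g s \<noteq> \<zero>\<^bsub>\<Omega> s\<^esub>) D" using b(2) unfolding g(2) zero_U ucls_eq_iff ev_not .
  moreover have "eventually (\<lambda>s. g s \<otimes>\<^bsub>\<Omega> s\<^esub> f s \<in> Ts s) D"
    using T_U_ev[OF el_ops(3)[OF g(1) f(1)]] b(3) f(2) g(2) mult_U by simp
  ultimately have "eventually (\<lambda>s. f s \<in> Fs s) D"
    by eventually_elim (use E.Fr_scale elD[OF f(1)] in auto)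
  then show "x \<in> us Fs" unfolding f(2) us_iff[OF f(1)] .
qed

abbreviation poly_sum :: "nat \<Rightarrow> (nat \<Rightarrow> 'b) \<Rightarrow> 's \<Rightarrow> 'b" where
  "poly_sum n c s \<equiv> \<Oplus>\<^bsub>\<Omega> s\<^esub> i\<in>{..n}. c i \<otimes>\<^bsub>\<Omega> s\<^esub> (t s [^]\<^bsub>\<Omega> s\<^esub> i)"

text \<open>Identifies the embedded field with the fraction field of K[t] in U, so that explicit
  quotients of sums disappear from the later arguments.\<close>

lemma ratfun_embed_eq: "ratfun_embed D \<Omega> K t = V.Fr"
proof (intro equalityI subsetI)
  fix x assume "x \<in> ratfun_embed D \<Omega> K t"
  then obtain n :: nat and a b where x: "x = ucls D (\<lambda>s. poly_sum n (\<lambda>i. a i s) s \<otimes>\<^bsub>\<Omega> s\<^esub> inv\<^bsub>\<Omega> s\<^esub> (poly_sum n (\<lambda>i. b i s) s))"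
    and ab: "\<forall>i s. a i s \<in> K s \<and> b i s \<in> K s" and nz: "\<exists>i\<le>n. eventually (\<lambda>s. b i s \<noteq> \<zero>\<^bsub>\<Omega> s\<^esub>) D"
    unfolding ratfun_embed_def by (elim CollectE exE conjE) (rule that, assumption, assumption, blast)
  define f where "f s = poly_sum n (\<lambda>i. a i s) s" for s
  define g where "g s = poly_sum n (\<lambda>i. b i s) s" for s
  have fP: "f s \<in> Ps s n" for s unfolding f_def E.P_eq_finsum using ab by (intro CollectI exI[of _ "\<lambda>i. a i s"]) auto
  have gP: "g s \<in> Ps s n" for s unfolding g_def E.P_eq_finsum using ab by (intro CollectI exI[of _ "\<lambda>i. b i s"]) auto
  have elf: "el f" "el g" unfolding el_def using subsetD[OF E.P_carrier fP] subsetD[OF E.P_carrier gP] by auto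
  have T: "ucls D f \<in> V.T" "ucls D g \<in> V.T"
    using subsetD[OF V.P_T, of _ n] unfolding poly_vals_K using us_iff[OF elf(1)] us_iff[OF elf(2)] fP gP by simp_all
  obtain i where i: "i \<le> n" "eventually (\<lambda>s. b i s \<noteq> \<zero>\<^bsub>\<Omega> s\<^esub>) D" using nz by blast
  have nz': "eventually (\<lambda>s. g s \<noteq> \<zero>\<^bsub>\<Omega> s\<^esub>) D"
    using i(2)
  proof eventually_elim
    case (elim s)
    then show ?case using E.finsum_eq_zero_imp[of "\<lambda>i. b i s" s n i] ab i(1) unfolding g_def by auto
  qed
  then have nzU: "ucls D g \<noteq> \<zero>\<^bsub>U\<^esub>" unfolding zero_U ucls_eq_iff ev_not .
  \<comment> \<open>The inverse in the definition takes junk values where the denominator vanishes; off that set,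
    which is negligible, it agrees with a representative h of the inverse in the ultraproduct.\<close>
  note inv = V.T_nonzero_inv[OF T(2) nzU]
  obtain h where h: "el h" "inv\<^bsub>U\<^esub> (ucls D g) = ucls D h" using carrier_U_cases[OF inv(2)] .
  have "eventually (\<lambda>s. g s \<otimes>\<^bsub>\<Omega> s\<^esub> h s = \<one>\<^bsub>\<Omega> s\<^esub>) D"
    using inv(3) unfolding h(2) mult_U one_U ucls_eq_iff .
  then have "eventually (\<lambda>s. f s \<otimes>\<^bsub>\<Omega> s\<^esub> inv\<^bsub>\<Omega> s\<^esub> g s = f s \<otimes>\<^bsub>\<Omega> s\<^esub> h s) D"
  proof eventually_elim
    case (elim s)
    then have "inv\<^bsub>\<Omega> s\<^esub> g s = h s" using F.comm_inv_char[of "g s" s "h s"] elD elf h(1) by simp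
    then show ?case by simp
  qed
  then have "x = ucls D f \<otimes>\<^bsub>U\<^esub> inv\<^bsub>U\<^esub> (ucls D g)"
    unfolding x f_def[symmetric] g_def[symmetric] h(2) mult_U ucls_eq_iff .
  then show "x \<in> V.Fr" using V.FrI[OF T nzU] by simp
next
  fix x assume "x \<in> V.Fr"
  then obtain A B where AB: "A \<in> V.T" "B \<in> V.T" "B \<noteq> \<zero>\<^bsub>U\<^esub>" "x = A \<otimes>\<^bsub>U\<^esub> inv\<^bsub>U\<^esub> B" unfolding V.Fr_def by blast
  note inv = V.T_nonzero_inv[OF AB(2,3)]
  obtain m where m: "A \<in> U.poly_vals (us K) (ucls D t) m" using V.T_in_P[OF AB(1)] .
  obtain m' where m': "B \<in> U.poly_vals (us K) (ucls D t) m'" using V.T_in_P[OF AB(2)] .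
  \<comment> \<open>The definition of the embedding uses one n for numerator and
    denominator.\<close>
  define n where "n = max m m'"
  have ABn: "A \<in> us (\<lambda>s. Ps s n)" "B \<in> us (\<lambda>s. Ps s n)"
    using subsetD[OF V.P_mono[of m n] m] subsetD[OF V.P_mono[of m' n] m'] unfolding n_def poly_vals_K by simp_all
  obtain f where f: "el f" "A = ucls D f" using carrier_U_cases[OF subsetD[OF V.T_carrier AB(1)]] .
  obtain g where g: "el g" "B = ucls D g" using carrier_U_cases[OF inv(1)] .
  obtain h where h: "el h" "inv\<^bsub>U\<^esub> B = ucls D h" using carrier_U_cases[OF inv(2)] .
  have P: "eventually (\<lambda>s. f s \<in> Ps s n) D" "eventually (\<lambda>s. g s \<in> Ps s n) D"
    using ABn unfolding f(2) g(2) us_iff[OF f(1)] us_iff[OF g(1)] .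
  \<comment> \<open>Coefficients must lie in \<open>K s\<close> at every index. Where the
    representative is not a polynomial of degree at most n they are set to zero.\<close>
  have coeffs: "\<exists>a. (\<forall>i. a i \<in> K s) \<and> (f s \<in> Ps s n \<longrightarrow> f s = poly_sum n a s)" for f s
  proof (cases "f s \<in> Ps s n")
    case True
    then show ?thesis unfolding E.P_eq_finsum by blast
  next
    case False
    then show ?thesis using E.K_ring(2)[of s] by (intro exI[of _ "\<lambda>_. \<zero>\<^bsub>\<Omega> s\<^esub>"]) simp
  qed
  have "\<exists>a. \<forall>s. (\<forall>i. a s i \<in> K s) \<and> (f s \<in> Ps s n \<longrightarrow> f s = poly_sum n (a s) s)" for f
    by (rule choice, rule allI, rule coeffs)
  note coeffs' = this
  obtain a where a: "\<forall>s. (\<forall>i. a s i \<in> K s) \<and> (f s \<in> Ps s n \<longrightarrow> f s = poly_sum n (a s) s)"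
    using coeffs' by (rule exE)
  obtain b where b: "\<forall>s. (\<forall>i. b s i \<in> K s) \<and> (g s \<in> Ps s n \<longrightarrow> g s = poly_sum n (b s) s)"
    using coeffs' by (rule exE)
  have gh: "eventually (\<lambda>s. g s \<otimes>\<^bsub>\<Omega> s\<^esub> h s = \<one>\<^bsub>\<Omega> s\<^esub>) D"
    using inv(3) unfolding h(2) unfolding g(2) mult_U one_U ucls_eq_iff .
  have "eventually (\<lambda>s. f s \<otimes>\<^bsub>\<Omega> s\<^esub> h s = poly_sum n (a s) s \<otimes>\<^bsub>\<Omega> s\<^esub> inv\<^bsub>\<Omega> s\<^esub> (poly_sum n (b s) s)) D"
    using P gh
  proof eventually_elim
    case (elim s)
    then have "inv\<^bsub>\<Omega> s\<^esub> g s = h s" using F.comm_inv_char[of "g s" s "h s"] elD g h(1) by simp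
    then show ?case using a b elim by metis
  qed
  then have "x = ucls D (\<lambda>s. poly_sum n (a s) s \<otimes>\<^bsub>\<Omega> s\<^esub> inv\<^bsub>\<Omega> s\<^esub> (poly_sum n (b s) s))"
    unfolding AB(4) h(2) f(2) mult_U ucls_eq_iff .
  \<comment> \<open>The position of a nonzero coefficient may vary with s, but there are only n + 1
    positions, so one of them serves for almost all s.\<close>
  moreover have "\<exists>i\<le>n. eventually (\<lambda>s. b s i \<noteq> \<zero>\<^bsub>\<Omega> s\<^esub>) D"
  proof -
    have "eventually (\<lambda>s. g s \<noteq> \<zero>\<^bsub>\<Omega> s\<^esub>) D" using AB(3) unfolding g(2) zero_U ucls_eq_iff ev_not .
    then have "eventually (\<lambda>s. \<exists>i \<in> {..n}. b s i \<noteq> \<zero>\<^bsub>\<Omega> s\<^esub>) D"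
      using P(2)
    proof eventually_elim
      case (elim s)
      show ?case
      proof (rule ccontr)
        assume "\<not> ?thesis"
        then have "poly_sum n (b s) s = \<zero>\<^bsub>\<Omega> s\<^esub>"
          by (intro F.add.finprod_one_eqI) auto
        then show False using elim b by metis
      qed
    qed
    then show ?thesis using ev_bex_finite[of "{..n}" "\<lambda>i s. b s i \<noteq> \<zero>\<^bsub>\<Omega> s\<^esub>"] by auto
  qed
  ultimately show "x \<in> ratfun_embed D \<Omega> K t" unfolding ratfun_embed_def
    using a b by (intro CollectI exI[of _ n] exI[of _ "\<lambda>i s. a s i"] exI[of _ "\<lambda>i s. b s i"]) auto
qed

lemma map_ucls_surj:
  "set xs \<subseteq> carrier U \<Longrightarrow> \<exists>fs. (\<forall>f \<in> set fs. el f) \<and> xs = map (ucls D) fs"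
proof (induction xs)
  case (Cons x xs)
  then obtain fs where fs: "\<forall>f \<in> set fs. el f" "xs = map (ucls D) fs" by auto
  have "x \<in> carrier U" using Cons.prems by simp
  then obtain f where "el f" "x = ucls D f" by (rule carrier_U_cases)
  with fs show ?case by (intro exI[of _ "f # fs"]) auto
qed simp

text \<open>What is transferred is the absence of relations of degree at most B, together with the
  multiplication table. In each component \<open>free_over_T\<close> then removes the degree
  bound.\<close>

lemma ev_independent_of_T_closed:
  assumes fs: "\<forall>f \<in> set fs. el f" and ind: "U.independent V.Fr (map (ucls D) fs)"
    and closed: "\<And>f g. f \<in> set fs \<Longrightarrow> g \<in> set fs \<Longrightarrow>
      ucls D f \<otimes>\<^bsub>U\<^esub> ucls D g \<in> U.Span V.T (map (ucls D) fs)"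
  shows "eventually (\<lambda>s. ring.independent (\<Omega> s) (Fs s) (vals fs s)) D"
proof -
  define W where "W = (\<lambda>(f, g). ucls D f \<otimes>\<^bsub>U\<^esub> ucls D g) ` (set fs \<times> set fs)"
  have "finite W" "W \<subseteq> U.Span V.T (map (ucls D) fs)" unfolding W_def using closed by auto
  then obtain c where c: "W \<subseteq> U.Span (V.P c) (map (ucls D) fs)" using V.finite_Span_T_in_P by blast
  \<comment> \<open>For M entries, (M - 1)(B + c + 1) = (M - 1)(B + 1) + (M - 1) c, and this is the
    least B for which M (B + 1) is larger.\<close>
  define B where "B = (length fs - 1) * c"
  have "V.P B \<subseteq> V.Fr" using V.P_T V.T_in_Fr by (rule subset_trans)
  then have "U.free_over (us (\<lambda>s. Ps s B)) (map (ucls D) fs)"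
    using V.independent_imp_free_over[OF _ ind] unfolding poly_vals_K by blast
  then have free: "eventually (\<lambda>s. cring.free_over (\<Omega> s) (Ps s B) (vals fs s)) D"
    unfolding free_over_us[OF E.P_carrier fs] .
  have "eventually (\<lambda>s. f s \<otimes>\<^bsub>\<Omega> s\<^esub> g s \<in> ring.Span (\<Omega> s) (Ps s c) (vals fs s)) D"
    if "f \<in> set fs" "g \<in> set fs" for f g
  proof -
    have e: "el (\<lambda>s. f s \<otimes>\<^bsub>\<Omega> s\<^esub> g s)" using that fs by blast
    have "ucls D (\<lambda>s. f s \<otimes>\<^bsub>\<Omega> s\<^esub> g s) \<in> us (\<lambda>s. ring.Span (\<Omega> s) (Ps s c) (vals fs s))"
      using c that unfolding W_def poly_vals_K Span_us[OF E.P_carrier fs] mult_U[symmetric] by auto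
    then show ?thesis unfolding us_iff[OF e] .
  qed
  then have "eventually (\<lambda>s. \<forall>f \<in> set fs. \<forall>g \<in> set fs.
      f s \<otimes>\<^bsub>\<Omega> s\<^esub> g s \<in> ring.Span (\<Omega> s) (Ps s c) (vals fs s)) D"
    by (intro eventually_ball_finite ballI) auto
  with free show ?thesis
  proof eventually_elim
    case (elim s)
    have vc: "set (vals fs s) \<subseteq> carrier (\<Omega> s)" using vals_carrier[OF fs] .
    show ?case
    \<comment> \<open>For the empty list the strict inequality fails, but independence is
      trivial.\<close>
    proof (cases "fs = []")
      case False
      then have l: "length fs = Suc (length fs - 1)" by simp
      have "cring.free_over (\<Omega> s) (Ts s) (vals fs s)"
      proof (rule E.free_over_T[OF vc _ elim(1)])
        show "(length (vals fs s) - 1) * (B + c + 1) < length (vals fs s) * (B + 1)"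
          unfolding length_map by (subst (2) l) (simp add: B_def algebra_simps)
      qed (use elim(2) in auto)
      then show ?thesis by (rule E.free_over_T_imp_independent[OF vc])
    qed simp
  qed
qed

text \<open>The finite extension E supplies the closure under multiplication that
  \<open>ev_independent_of_T_closed\<close> requires. A list outside every finite extension can lose
  independence in all components.\<close>

lemma ev_independent:
  assumes E: "subfield E U" "U.dimension M V.Fr E"
    and fs: "\<forall>f \<in> set fs. el f" "set (map (ucls D) fs) \<subseteq> E" and ind: "U.independent V.Fr (map (ucls D) fs)"
  shows "eventually (\<lambda>s. ring.independent (\<Omega> s) (Fs s) (vals fs s)) D"
proof -
  \<comment> \<open>A full basis has all its products in its own span, so the list is completed to
    one; the added vectors are dropped at the end.\<close>
  obtain Vs where Vs: "U.independent V.Fr (Vs @ map (ucls D) fs)" "U.Span V.Fr (Vs @ map (ucls D) fs) = E"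
    using U.complete_base[OF V.Fr_subfield E(2) ind fs(2)] by blast
  have "set Vs \<subseteq> carrier U" using U.independent_in_carrier[OF Vs(1)] by simp
  then obtain gs where gs: "\<forall>g \<in> set gs. el g" "Vs = map (ucls D) gs" using map_ucls_surj by blast
  define hs where "hs = gs @ fs"
  define bs where "bs = map (ucls D) hs"
  have hs: "\<forall>h \<in> set hs. el h" unfolding hs_def using gs fs by auto
  have bsc: "set bs \<subseteq> carrier U" unfolding bs_def using map_ucls_carrier[OF hs] .
  have bs: "U.independent V.Fr bs" "U.Span V.Fr bs = E" using Vs unfolding bs_def hs_def gs(2) by simp_all
  have bsE: "set bs \<subseteq> E" using U.Span_base_incl[OF V.Fr_subfield bsc] bs(2) by simp
  define W where "W = (\<lambda>(x, y). x \<otimes>\<^bsub>U\<^esub> y) ` (set bs \<times> set bs)"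
  have "finite W" "W \<subseteq> U.Span V.Fr bs"
    unfolding W_def bs(2) using bsE subringE(6)[OF subfieldE(1)[OF E(1)]] by auto
  \<comment> \<open>b clears the denominators of all products. After scaling the basis by b, the
    product (u b)(v b) = (b u v) b is again in the K[t]-span of the scaled basis.\<close>
  then obtain b where b: "b \<in> V.T" "b \<noteq> \<zero>\<^bsub>U\<^esub>" "\<forall>x \<in> W. b \<otimes>\<^bsub>U\<^esub> x \<in> U.Span V.T bs"
    using V.finite_Span_Fr_scale[OF _ bsc] by blast
  have bc: "b \<in> carrier U" using subsetD[OF V.T_carrier b(1)] .
  obtain \<beta> where \<beta>: "el \<beta>" "b = ucls D \<beta>" using carrier_U_cases[OF bc] .
  define hs' where "hs' = map (\<lambda>h s. h s \<otimes>\<^bsub>\<Omega> s\<^esub> \<beta> s) hs"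
  have map_hs': "map (ucls D) hs' = map (\<lambda>x. x \<otimes>\<^bsub>U\<^esub> b) bs" unfolding hs'_def bs_def \<beta>(2) by (simp add: mult_U)
  have "eventually (\<lambda>s. ring.independent (\<Omega> s) (Fs s) (vals hs' s)) D"
  proof (rule ev_independent_of_T_closed)
    show "\<forall>f \<in> set hs'. el f" unfolding hs'_def using hs \<beta>(1) by auto
    show "U.independent V.Fr (map (ucls D) hs')" unfolding map_hs'
      by (rule U.independent_map_mult[OF V.Fr_subfield bc b(2) bs(1)])
    fix f g assume "f \<in> set hs'" "g \<in> set hs'"
    then have "ucls D f \<in> set (map (ucls D) hs')" "ucls D g \<in> set (map (ucls D) hs')" by simp_all
    then obtain u v where uv: "u \<in> set bs" "v \<in> set bs" "ucls D f = u \<otimes>\<^bsub>U\<^esub> b" "ucls D g = v \<otimes>\<^bsub>U\<^esub> b"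
      unfolding map_hs' by auto
    have c: "u \<in> carrier U" "v \<in> carrier U" using uv bsc by auto
    have "ucls D f \<otimes>\<^bsub>U\<^esub> ucls D g = (b \<otimes>\<^bsub>U\<^esub> (u \<otimes>\<^bsub>U\<^esub> v)) \<otimes>\<^bsub>U\<^esub> b"
      unfolding uv(3,4) using c bc by (simp add: U.m_ac)
    moreover have "b \<otimes>\<^bsub>U\<^esub> (u \<otimes>\<^bsub>U\<^esub> v) \<in> U.Span V.T bs" using b(3) uv unfolding W_def by auto
    ultimately show "ucls D f \<otimes>\<^bsub>U\<^esub> ucls D g \<in> U.Span V.T (map (ucls D) hs')"
      unfolding map_hs' U.Span_map_mult[OF V.T_carrier bsc bc] by blast
  qed
  then show ?thesis
  proof eventually_elim
    case (elim s)
    have "vals hs' s = map (\<lambda>x. x \<otimes>\<^bsub>\<Omega> s\<^esub> \<beta> s) (vals hs s)" unfolding hs'_def by simp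
    then have "ring.independent (\<Omega> s) (Fs s) (vals hs s)"
      using F.independent_map_multD[OF Fs_subfield elD[OF \<beta>(1)] vals_carrier[OF hs]] elim by simp
    then show ?case unfolding hs_def using F.independent_split(1)[OF Fs_subfield] by simp
  qed
qed

end

section \<open>Finite extensions and separability\<close>

context field
begin

text \<open>Such a span is a finite-dimensional K-algebra inside a field. Each of its elements x is
  therefore algebraic, and the inverse of a nonzero x already lies in K[x].\<close>

lemma Span_subfieldI:
  assumes K: "subfield K R" and ws: "set ws \<subseteq> carrier R"
    and one: "\<one> \<in> Span K ws" and closed: "\<And>u v. u \<in> set ws \<Longrightarrow> v \<in> set ws \<Longrightarrow> u \<otimes> v \<in> Span K ws"
  shows "subfield (Span K ws) R" "K \<subseteq> Span K ws"
proof -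
  note Kr = subringE[OF subfieldE(1)[OF K]]
  have Ksg: "subgroup K (add_monoid R)" using subring.axioms(1)[OF subfieldE(1)[OF K]] .
  note S = add.subgroupE[OF Span_is_subgroup[OF Ksg ws]]
  have mult: "x \<otimes> y \<in> Span K ws" if "x \<in> Span K ws" "y \<in> Span K ws" for x y
  proof -
    have yc: "y \<in> carrier R" using that S(1) by blast
    have "w \<otimes> y \<in> Span K ws" if w: "w \<in> set ws" for w
    proof -
      have wc: "w \<in> carrier R" using w ws by blast
      have "y \<otimes> w \<in> Span K ws"
        by (rule Span_mult[OF Kr(1) Kr(1) Ksg Kr(6) ws ws wc closed[OF _ w] \<open>y \<in> Span K ws\<close>])
      then show ?thesis using m_comm[OF yc wc] by simp
    qed
    then show ?thesis using Span_mult[OF Kr(1) Kr(1) Ksg Kr(6) ws ws yc _ that(1)] by blast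
  qed
  have sr: "subring (Span K ws) R"
    using S one mult by (intro subringI) auto
  show KS: "K \<subseteq> Span K ws"
  proof
    fix k assume k: "k \<in> K"
    then have "k \<otimes> \<one> \<in> Span K ws" using Span_smult_closed[OF K ws] one by blast
    then show "k \<in> Span K ws" using k Kr(1) by auto
  qed
  show "subfield (Span K ws) R"
  proof (rule subfieldI'[OF sr])
    fix x assume x: "x \<in> Span K ws - {\<zero>}"
    have xc: "x \<in> carrier R" using x S(1) by blast
    have "(algebraic over K) x"
      using finite_dimension_imp_algebraic[OF K sr Span_finite_dimension[OF K ws]] x by blast
    then have "subfield (simple_extension K x) R" using simple_extension_is_subfield[OF K xc] by simp
    moreover have "x \<in> simple_extension K x" using simple_extension_mem[OF subfieldE(1)[OF K] xc] .
    ultimately have "inv x \<in> simple_extension K x" using subfield_m_inv(1)[of _ x] x by blast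
    moreover have "simple_extension K x \<subseteq> Span K ws"
      using simple_extension_subring_incl[OF sr KS] x by blast
    ultimately show "inv x \<in> Span K ws" by blast
  qed
qed

lemma finite_dimension_over_intermediate:
  assumes "subfield K R" "subfield E R" "subfield L R" "K \<subseteq> E" "E \<subseteq> L" "dimension n K L"
  shows "\<exists>m. dimension m E L"
proof -
  obtain us where us: "set us \<subseteq> carrier R" "Span K us = L" using exists_base[OF assms(1,6)] by blast
  have usL: "set us \<subseteq> L" using Span_base_incl[OF assms(1) us(1)] us(2) by simp
  have Lsg: "subgroup L (add_monoid R)" using subring.axioms(1)[OF subfieldE(1)[OF assms(3)]] .
  have "Span E us \<subseteq> L"
    by (rule Span_least[OF Lsg]) (use subringE(6)[OF subfieldE(1)[OF assms(3)]] usL assms(5) in blast)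
  moreover have "L \<subseteq> Span E us" using Span_mono[OF assms(4), of us] us(2) by simp
  ultimately have "Span E us = L" by (rule equalityI)
  then show ?thesis using Span_dimension_le[OF assms(2) us(1)] by auto
qed

lemma dimension_intermediate_dvd:
  assumes "subfield K R" "subfield E R" "subfield L R" "K \<subseteq> E" "E \<subseteq> L" "dimension n K L" "dimension m K E"
  shows "m dvd n"
proof -
  obtain k where "dimension k E L" using finite_dimension_over_intermediate[OF assms(1-6)] by blast
  then have "dimension (m * k) K L" using telescopic_base[OF assms(1,2,7)] by blast
  then show ?thesis using dimension_is_inj[OF assms(1,6)] by simp
qed

end

section \<open>The binomial theorem and the Frobenius map\<close>

context cring
begin

lemma binomial_expansion:
  assumes x: "x \<in> carrier R" and y: "y \<in> carrier R"
  shows "(x \<oplus> y) [^] (n::nat) = (\<Oplus>k\<in>{..n}. [(n choose k)] \<cdot> (x [^] k \<otimes> y [^] (n - k)))"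
proof (induction n)
  case 0
  show ?case using x y by (subst finsum_0) auto
next
  case (Suc n)
  define f where "f k = x [^] Suc k \<otimes> y [^] (n - k)" for k
  define S where "S = (\<Oplus>k\<in>{..n}. [(n choose k)] \<cdot> (x [^] k \<otimes> y [^] (n - k)))"
  have S: "S \<in> carrier R" unfolding S_def using x y by auto
  have fc [simp]: "f k \<in> carrier R" for k unfolding f_def using x y by auto
  have xS: "x \<otimes> S = (\<Oplus>k\<in>{..n}. [(n choose k)] \<cdot> f k)"
  proof -
    have "x \<otimes> S = (\<Oplus>k\<in>{..n}. x \<otimes> ([(n choose k)] \<cdot> (x [^] k \<otimes> y [^] (n - k))))"
      unfolding S_def using x y by (intro finsum_rdistr) auto
    also have "\<dots> = (\<Oplus>k\<in>{..n}. [(n choose k)] \<cdot> f k)"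
      using x y by (intro finsum_cong') (auto simp: f_def add_pow_rdistr m_ac)
    finally show ?thesis .
  qed
  have yS: "y \<otimes> S = (\<Oplus>k\<in>{..n}. [(n choose Suc k)] \<cdot> f k) \<oplus> y [^] Suc n"
  proof -
    define g where "g k = [(n choose k)] \<cdot> (x [^] k \<otimes> y [^] (Suc n - k))" for k
    have gc [simp]: "g k \<in> carrier R" for k unfolding g_def using x y by auto
    have "y \<otimes> S = (\<Oplus>k\<in>{..n}. y \<otimes> ([(n choose k)] \<cdot> (x [^] k \<otimes> y [^] (n - k))))"
      unfolding S_def using x y by (intro finsum_rdistr) auto
    also have "\<dots> = (\<Oplus>k\<in>{..n}. g k)"
      using x y by (intro finsum_cong') (auto simp: g_def add_pow_rdistr m_ac Suc_diff_le)
    also have "\<dots> = (\<Oplus>k\<in>{..Suc n}. g k)"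
    proof -
      have "g (Suc n) = \<zero>" unfolding g_def by (simp add: binomial_eq_0 del: nat_pow_Suc)
      then show ?thesis using finsum_closed[of g "{..n}"] by (simp add: Pi_def)
    qed
    also have "\<dots> = (\<Oplus>k\<in>{..n}. g (Suc k)) \<oplus> g 0" by (intro finsum_Suc2) auto
    also have "g 0 = y [^] Suc n" unfolding g_def using x y by simp
    also have "(\<Oplus>k\<in>{..n}. g (Suc k)) = (\<Oplus>k\<in>{..n}. [(n choose Suc k)] \<cdot> f k)"
      using x y by (intro finsum_cong') (auto simp: g_def f_def)
    finally show ?thesis .
  qed
  have "(x \<oplus> y) [^] Suc n = x \<otimes> S \<oplus> y \<otimes> S"
    using Suc x y S unfolding S_def[symmetric] by (simp add: m_comm[of S] l_distr r_distr)
  also have "\<dots> = ((\<Oplus>k\<in>{..n}. [(n choose k)] \<cdot> f k) \<oplus> (\<Oplus>k\<in>{..n}. [(n choose Suc k)] \<cdot> f k)) \<oplus> y [^] Suc n"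
    unfolding xS yS using y by (intro a_assoc[symmetric]) auto
  also have "(\<Oplus>k\<in>{..n}. [(n choose k)] \<cdot> f k) \<oplus> (\<Oplus>k\<in>{..n}. [(n choose Suc k)] \<cdot> f k)
      = (\<Oplus>k\<in>{..n}. [(n choose k)] \<cdot> f k \<oplus> [(n choose Suc k)] \<cdot> f k)"
    by (intro finsum_addf[symmetric]) auto
  also have "\<dots> = (\<Oplus>k\<in>{..n}. [(Suc n choose Suc k)] \<cdot> (x [^] Suc k \<otimes> y [^] (Suc n - Suc k)))"
    using x y by (intro finsum_cong') (auto simp: f_def add.nat_pow_mult)
  also have "y [^] Suc n = [(Suc n choose 0)] \<cdot> (x [^] (0::nat) \<otimes> y [^] (Suc n - 0))" using y by simp
  also have "(\<Oplus>k\<in>{..n}. [(Suc n choose Suc k)] \<cdot> (x [^] Suc k \<otimes> y [^] (Suc n - Suc k)))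
       \<oplus> [(Suc n choose 0)] \<cdot> (x [^] (0::nat) \<otimes> y [^] (Suc n - 0))
     = (\<Oplus>k\<in>{..Suc n}. [(Suc n choose k)] \<cdot> (x [^] k \<otimes> y [^] (Suc n - k)))"
    using x y by (intro finsum_Suc2[symmetric]) auto
  finally show ?case .
qed

lemma add_pow_eq_zero_of_dvd:
  assumes "[p] \<cdot> \<one> = \<zero>" "(p::nat) dvd m" "z \<in> carrier R"
  shows "[m] \<cdot> z = \<zero>"
proof -
  obtain k where m: "m = p * k" using assms(2) by blast
  have "[m] \<cdot> z = [p] \<cdot> (\<one> \<otimes> ([k] \<cdot> z))" unfolding m using assms(3) by (simp add: add.nat_pow_pow mult.commute)
  also have "\<dots> = ([p] \<cdot> \<one>) \<otimes> ([k] \<cdot> z)" using assms(3) by (intro add_pow_ldistr[symmetric]) auto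
  finally show ?thesis using assms by simp
qed

text \<open>The inner binomial coefficients are multiples of p. The identity is stated for
  commutative rings because it is also applied in a polynomial ring.\<close>

lemma frobenius_add:
  assumes p: "prime (p::nat)" "[p] \<cdot> \<one> = \<zero>" and x: "x \<in> carrier R" and y: "y \<in> carrier R"
  shows "(x \<oplus> y) [^] p = x [^] p \<oplus> y [^] p"
proof -
  obtain n where n: "p = Suc (Suc n)" using prime_ge_2_nat[OF p(1)] by (metis add_2_eq_Suc le_Suc_ex)
  define f where "f k = [(p choose k)] \<cdot> (x [^] k \<otimes> y [^] (p - k))" for k
  have fc: "f k \<in> carrier R" for k unfolding f_def using x y by auto
  have z: "f k = \<zero>" if "0 < k" "k < p" for k
    unfolding f_def using that x y by (intro add_pow_eq_zero_of_dvd[OF p(2)] dvd_choose_prime p(1)) auto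
  have "(x \<oplus> y) [^] p = (\<Oplus>k\<in>{..p}. f k)" unfolding f_def by (rule binomial_expansion[OF x y])
  also have "\<dots> = f (Suc (Suc n)) \<oplus> (\<Oplus>k\<in>{..Suc n}. f k)" unfolding n using fc by (intro finsum_Suc) auto
  also have "(\<Oplus>k\<in>{..Suc n}. f k) = (\<Oplus>k\<in>{..n}. f (Suc k)) \<oplus> f 0" using fc by (intro finsum_Suc2) auto
  also have "(\<Oplus>k\<in>{..n}. f (Suc k)) = \<zero>" by (intro add.finprod_one_eqI) (use z n in auto)
  finally show ?thesis unfolding n[symmetric] using fc[of 0] x y by (simp add: f_def)
qed

end

section \<open>Formal derivatives of coefficient lists\<close>

context ring
begin

text \<open>Lists start with the leading coefficient, so the length of the tail is the exponent of
  the head. The result is not normalized: in positive characteristic it may have leading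
  zeros.\<close>

fun dlist :: "'a list \<Rightarrow> 'a list" where
  "dlist [] = []"
| "dlist (c # q) = (if q = [] then [] else ([length q] \<cdot> c) # dlist q)"

text \<open>The value of the derivative, read off the list in a way that ignores leading zeros. For
  the constant term the exponent 0 - 1 is truncated, harmlessly, since the factor in front is
  0.\<close>

fun dval :: "'a list \<Rightarrow> 'a \<Rightarrow> 'a" where
  "dval [] a = \<zero>"
| "dval (c # q) a = [length q] \<cdot> (c \<otimes> a [^] (length q - 1)) \<oplus> dval q a"

lemma length_dlist: "length (dlist q) = length q - 1"
  by (induction q) auto

lemma eval_dlist:
  assumes "set q \<subseteq> carrier R" "a \<in> carrier R"
  shows "eval (dlist q) a = dval q a"
  using assms(1) by (induction q) (use assms(2) in \<open>auto simp: length_dlist add_pow_ldistr\<close>)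

lemma dval_closed: "set q \<subseteq> carrier R \<Longrightarrow> a \<in> carrier R \<Longrightarrow> dval q a \<in> carrier R"
  by (induction q) auto

lemma dlist_coeff:
  "set (dlist q) \<subseteq> {\<zero>} \<Longrightarrow> 0 < i \<Longrightarrow> i < length q \<Longrightarrow> [i] \<cdot> coeff q i = \<zero>"
  by (induction q) (auto split: if_splits)

lemma dval_normalize:
  "set q \<subseteq> carrier R \<Longrightarrow> a \<in> carrier R \<Longrightarrow> dval (normalize q) a = dval q a"
  by (induction q) (auto simp: dval_closed)

lemma dval_replicate:
  "set q \<subseteq> carrier R \<Longrightarrow> a \<in> carrier R \<Longrightarrow> dval (replicate n \<zero> @ q) a = dval q a"
  by (induction n) (auto simp: dval_closed)

end

context cring
begin

lemma dval_map2:
  assumes "a \<in> carrier R"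
  shows "length p = length q \<Longrightarrow> set p \<subseteq> carrier R \<Longrightarrow> set q \<subseteq> carrier R \<Longrightarrow>
    dval (map2 (\<oplus>) p q) a = dval p a \<oplus> dval q a"
proof (induction p q rule: list_induct2)
  case (Cons c p d q)
  have "c \<in> carrier R" "d \<in> carrier R" "dval p a \<in> carrier R" "dval q a \<in> carrier R"
    using Cons.prems assms dval_closed by auto
  then show ?case using Cons assms by (simp add: l_distr add.nat_pow_distrib a_ac)
qed simp

lemma dval_poly_add:
  assumes "a \<in> carrier R" "set p \<subseteq> carrier R" "set q \<subseteq> carrier R"
  shows "dval (poly_add p q) a = dval p a \<oplus> dval q a"
proof -
  have *: "dval (poly_add p q) a = dval p a \<oplus> dval q a"
    if "length q \<le> length p" "set p \<subseteq> carrier R" "set q \<subseteq> carrier R" for p q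
  proof -
    define q' where "q' = replicate (length p - length q) \<zero> @ q"
    have q': "length p = length q'" "set q' \<subseteq> carrier R" "dval q' a = dval q a"
      unfolding q'_def using that dval_replicate[OF that(3) assms(1)] by auto
    have "set (map2 (\<oplus>) p q') \<subseteq> carrier R" using that(2) q'(2) by (fastforce dest: set_zip_leftD set_zip_rightD)
    then have "dval (normalize (map2 (\<oplus>) p q')) a = dval p a \<oplus> dval q' a"
      using dval_normalize[OF _ assms(1)] dval_map2[OF assms(1) q'(1) that(2) q'(2)] by simp
    then show ?thesis using that(1) q'(3) unfolding q'_def by simp
  qed
  show ?thesis
  proof (cases "length q \<le> length p")
    case True
    then show ?thesis using * assms by blast
  next
    case False
    then have "dval (poly_add p q) a = dval q a \<oplus> dval p a"
      using *[of p q] *[of q p] assms by simp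
    then show ?thesis using a_comm dval_closed assms by simp
  qed
qed

lemma dval_smult:
  assumes "a \<in> carrier R" "c \<in> carrier R"
  shows "set q \<subseteq> carrier R \<Longrightarrow> dval (map (\<lambda>b. c \<otimes> b) q) a = c \<otimes> dval q a"
  by (induction q) (use assms in \<open>auto simp: r_distr dval_closed add_pow_rdistr m_assoc\<close>)

text \<open>The product rule for multiplication by X, since an appended zero shifts all exponents by
  one.\<close>

lemma dval_append_zero:
  assumes "a \<in> carrier R"
  shows "set q \<subseteq> carrier R \<Longrightarrow> dval (q @ [\<zero>]) a = dval q a \<otimes> a \<oplus> eval q a"
proof (induction q)
  case (Cons c q)
  have c: "c \<in> carrier R" "dval q a \<in> carrier R" "eval q a \<in> carrier R" "a [^] (length q) \<in> carrier R"
    using Cons.prems assms dval_closed eval_in_carrier by auto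
  have IH: "dval (q @ [\<zero>]) a = dval q a \<otimes> a \<oplus> eval q a" using Cons by simp
  have step: "[Suc (length q)] \<cdot> (c \<otimes> a [^] length q)
      = ([length q] \<cdot> (c \<otimes> a [^] (length q - 1))) \<otimes> a \<oplus> c \<otimes> a [^] length q"
  proof (cases q)
    case (Cons d q')
    have "([length q] \<cdot> (c \<otimes> a [^] (length q - 1))) \<otimes> a = [length q] \<cdot> (c \<otimes> a [^] (length q - 1) \<otimes> a)"
      using c assms by (intro add_pow_ldistr) auto
    also have "c \<otimes> a [^] (length q - 1) \<otimes> a = c \<otimes> a [^] length q" using Cons c assms by (simp add: m_assoc)
    finally show ?thesis by simp
  qed (use c assms in simp)
  define u where "u = [length q] \<cdot> (c \<otimes> a [^] (length q - 1))"
  define v where "v = c \<otimes> a [^] length q"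
  have uv: "u \<in> carrier R" "v \<in> carrier R" unfolding u_def v_def using c assms by auto
  have "dval ((c # q) @ [\<zero>]) a = (u \<otimes> a \<oplus> v) \<oplus> (dval q a \<otimes> a \<oplus> eval q a)"
    using step IH unfolding u_def v_def by simp
  also have "\<dots> = (u \<oplus> dval q a) \<otimes> a \<oplus> (v \<oplus> eval q a)" using uv c assms by algebra
  finally show ?case unfolding u_def v_def by simp
qed (use assms in simp)

text \<open>The product rule for (X - a) q at a, where the term with the derivative of q drops
  out.\<close>

lemma dval_linear_mult:
  assumes "a \<in> carrier R" "set q \<subseteq> carrier R"
  shows "dval (poly_mult [\<one>, \<ominus> a] q) a = eval q a"
proof -
  have c: "dval q a \<in> carrier R" "eval q a \<in> carrier R" using assms dval_closed eval_in_carrier by auto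
  have one: "map (\<lambda>b. \<one> \<otimes> b) q = q" using assms(2) by (induction q) auto
  have 1: "set (map (\<lambda>b. \<ominus> a \<otimes> b) q) \<subseteq> carrier R" using assms by auto
  have 2: "set (poly_add (map (\<lambda>b. \<ominus> a \<otimes> b) q) []) \<subseteq> carrier R" using poly_add_in_carrier[OF 1, of "[]"] by (simp del: poly_add.simps)
  have "dval (poly_mult [\<one>, \<ominus> a] q) a = dval (q @ [\<zero>]) a \<oplus> dval (poly_add (map (\<lambda>b. \<ominus> a \<otimes> b) q) []) a"
    using dval_poly_add[OF assms(1) _ 2, of "q @ [\<zero>]"] assms(2) one by (simp del: poly_add.simps)
  also have "\<dots> = (dval q a \<otimes> a \<oplus> eval q a) \<oplus> (\<ominus> a) \<otimes> dval q a"
    using dval_poly_add[OF assms(1) 1, of "[]"] dval_smult[OF assms(1) _ assms(2), of "\<ominus> a"]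
      dval_append_zero[OF assms] assms(1) c by (simp del: poly_add.simps)
  also have "\<dots> = eval q a" using assms(1) c by algebra
  finally show ?thesis .
qed

end

section \<open>Inseparable elements and MacLane's criterion\<close>

context field
begin

text \<open>The constant separable_elem is restricted to rings without record extension; this is the same
  notion without that restriction.\<close>

definition separable_over :: "'a set \<Rightarrow> 'a \<Rightarrow> bool" where
  "separable_over K x \<longleftrightarrow> algebraic K x \<and> (\<forall>a \<in> carrier R. alg_mult (Irr K x) a \<le> 1)"

lemma linear_poly_carrier: "a \<in> carrier R \<Longrightarrow> [\<one>, \<ominus> a] \<in> carrier (poly_ring R)"
  unfolding sym[OF univ_poly_carrier] polynomial_def by auto

lemma poly_ring_carrier_set: "p \<in> carrier (poly_ring R) \<Longrightarrow> set p \<subseteq> carrier R"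
  unfolding sym[OF univ_poly_carrier] polynomial_def by auto

lemma normalize_Nil: "normalize q = [] \<Longrightarrow> set q \<subseteq> {\<zero>}"
  using normalize_trick[of q] by (metis append_Nil2 set_replicate_conv_if subset_refl empty_subsetI)

lemma dlist_subset:
  assumes "subring K R"
  shows "set q \<subseteq> K \<Longrightarrow> set (dlist q) \<subseteq> K"
proof (induction q)
  case (Cons c q)
  have "[n] \<cdot> c \<in> K" for n :: nat
    by (induction n) (use Cons.prems subringE[OF assms] in \<open>auto\<close>)
  then show ?case using Cons by auto
qed simp

text \<open>A multiple root a of the minimal polynomial f is a root of its derivative. Since f is
  irreducible, it is associated to the minimal polynomial of a as well, so the derivative, being
  shorter, has to vanish.\<close>

lemma inseparable_dlist_Irr:
  assumes K: "subfield K R" and x: "x \<in> carrier R" and alg: "algebraic K x" and insep: "\<not> separable_over K x"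
  shows "set (dlist (Irr K x)) \<subseteq> {\<zero>}"
proof -
  define f where "f = Irr K x"
  note sr = subfieldE(1)[OF K]
  have alg': "(algebraic over K) x" using alg by (simp add: over_def)
  note f = IrrE[OF K x alg', folded f_def]
  interpret UP: domain "poly_ring R" using univ_poly_is_domain[OF carrier_is_subring] .
  have fR: "f \<in> carrier (poly_ring R)" using carrier_polynomial_shell[OF sr f(1)] .
  have f0: "f \<noteq> []" using f(2) pirreducibleE(1)[OF sr f(1)] by blast
  obtain a where a: "a \<in> carrier R" "2 \<le> alg_mult f a"
    using insep alg unfolding separable_over_def f_def by force
  define l where "l = [\<one>, \<ominus> a]"
  have l: "l \<in> carrier (poly_ring R)" unfolding l_def by (rule linear_poly_carrier[OF a(1)])
  have "(l [^]\<^bsub>poly_ring R\<^esub> (2::nat)) pdivides f" unfolding l_def by (rule le_alg_mult_imp_pdivides[OF a(1) fR a(2)])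
  then obtain c where c: "c \<in> carrier (poly_ring R)" "f = l [^]\<^bsub>poly_ring R\<^esub> (2::nat) \<otimes>\<^bsub>poly_ring R\<^esub> c"
    unfolding pdivides_def by (rule dividesE)
  define d where "d = l \<otimes>\<^bsub>poly_ring R\<^esub> c"
  have d: "d \<in> carrier (poly_ring R)" unfolding d_def using l c by simp
  have fd: "f = l \<otimes>\<^bsub>poly_ring R\<^esub> d" unfolding d_def c(2) using l c(1) by (simp add: numeral_2_eq_2 UP.m_assoc)
  have hom: "eval (p \<otimes>\<^bsub>poly_ring R\<^esub> q) a = eval p a \<otimes> eval q a"
    if "p \<in> carrier (poly_ring R)" "q \<in> carrier (poly_ring R)" for p q
    using ring_hom_mult[OF eval_is_hom[OF carrier_is_subring a(1)] that] .
  have evc: "eval q a \<in> carrier R" if "q \<in> carrier (poly_ring R)" for q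
    using eval_in_carrier[OF poly_ring_carrier_set[OF that] a(1)] .
  have la: "eval l a = \<zero>" unfolding l_def using a(1) r_neg by simp
  have da: "eval d a = \<zero>" unfolding d_def hom[OF l c(1)] la using evc[OF c(1)] by simp
  have fa: "eval f a = \<zero>" unfolding fd hom[OF l d] da using evc[OF l] by simp
  \<comment> \<open>As f = (X - a) d, the derivative of f takes the value d(a) at a, and d still
    contains a factor X - a.\<close>
  have "dval f a = eval d a"
    unfolding fd univ_poly_mult l_def by (rule dval_linear_mult[OF a(1) poly_ring_carrier_set[OF d]])
  then have "eval (dlist f) a = \<zero>" using da eval_dlist[OF poly_ring_carrier_set[OF fR] a(1)] by simp
  moreover have setf: "set f \<subseteq> K" using f(1) polynomial_incl univ_poly_carrier by blast
  then have dK: "set (dlist f) \<subseteq> K" by (rule dlist_subset[OF sr])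
  ultimately have ev: "eval (normalize (dlist f)) a = \<zero>"
    using eval_normalize[OF _ a(1), of "dlist f"] subfieldE(3)[OF K] by auto
  have nK: "normalize (dlist f) \<in> carrier (K[X])" using normalize_gives_polynomial[OF dK] univ_poly_carrier by blast
  have alga: "(algebraic over K) a" using algebraicI[OF f(1) f0 fa] .
  note g = IrrE[OF K a(1) alga]
  have "Irr K a divides\<^bsub>K[X]\<^esub> f"
    using Irr_minimal[OF K a(1) alga f(1) fa] pdivides_iff_shell[OF K g(1) f(1)] by simp
  moreover have "Irr K a \<notin> Units (K[X])" using g(2) pirreducibleE(2)[OF sr g(1)] by blast
  ultimately have "Irr K a \<sim>\<^bsub>K[X]\<^esub> f" using divides_pirreducible_condition[OF f(2) g(1)] by blast
  then have len: "length (Irr K a) = length f" by (rule associated_polynomials_imp_same_length[OF sr g(1) f(1)])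
  have "normalize (dlist f) = []"
  proof (rule ccontr)
    assume n: "normalize (dlist f) \<noteq> []"
    have "degree (Irr K a) \<le> degree (normalize (dlist f))"
      using pdivides_imp_degree_le[OF sr g(1) nK n] Irr_minimal[OF K a(1) alga nK ev] by blast
    moreover have "length (normalize (dlist f)) \<le> length f - 1" using normalize_length_le[of "dlist f"] length_dlist by simp
    moreover have "length (normalize (dlist f)) > 0" using n by simp
    ultimately show False unfolding len by arith
  qed
  then show ?thesis unfolding f_def by (rule normalize_Nil)
qed

lemma Irr_degree_pos:
  assumes "subfield K R" "x \<in> carrier R" "algebraic K x"
  shows "1 \<le> degree (Irr K x)"
  using pirreducible_degree[OF assms(1) IrrE(1,2)[OF assms(1,2)]] assms(3) by (simp add: over_def)

text \<open>The minimal polynomial is monic, so the top coefficient of its vanishing derivative is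
  its degree, as an element of the field.\<close>

lemma inseparable_imp_char:
  assumes K: "subfield K R" and x: "x \<in> carrier R" and alg: "algebraic K x" and insep: "\<not> separable_over K x"
  shows "\<exists>n::nat. 0 < n \<and> [n] \<cdot> \<one> = \<zero>"
proof -
  define f where "f = Irr K x"
  have f1: "lead_coeff f = \<one>" using IrrE(3)[OF K x] alg unfolding f_def by (simp add: over_def)
  have deg: "1 \<le> degree f" unfolding f_def by (rule Irr_degree_pos[OF K x alg])
  then have "coeff f (degree f) = \<one>" using f1 lead_coeff_simp[of f] by force
  then have "[degree f] \<cdot> \<one> = \<zero>"
    using dlist_coeff[OF inseparable_dlist_Irr[OF assms], folded f_def, of "degree f"] deg by simp
  then show ?thesis using deg by (intro exI[of _ "degree f"]) simp
qed

lemma char_prime_exists: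
  assumes "[(n::nat)] \<cdot> \<one> = \<zero>" "n > 0"
  shows "\<exists>p::nat. prime p \<and> [p] \<cdot> \<one> = \<zero>"
  using assms
proof (induction n rule: less_induct)
  case (less n)
  have "n \<noteq> 1" using less.prems one_not_zero by auto
  then obtain p where p: "prime p" "p dvd n" using prime_factor_nat by blast
  then obtain m where m: "n = p * m" by blast
  have "([p] \<cdot> \<one>) \<otimes> ([m] \<cdot> \<one>) = [p] \<cdot> (\<one> \<otimes> ([m] \<cdot> \<one>))" by (intro add_pow_ldistr) auto
  also have "\<dots> = [n] \<cdot> \<one>" unfolding m by (simp add: add.nat_pow_pow mult.commute)
  finally have "[p] \<cdot> \<one> = \<zero> \<or> [m] \<cdot> \<one> = \<zero>" using less.prems(1) integral by simp
  then show ?case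
  proof
    assume "[m] \<cdot> \<one> = \<zero>"
    moreover have "m < n" "0 < m" using m less.prems(2) prime_gt_1_nat[OF p(1)] by auto
    ultimately show ?case using less.IH by blast
  qed (use p in blast)
qed

lemma char_dvd:
  assumes p: "prime (p::nat)" "[p] \<cdot> \<one> = \<zero>" and c: "c \<in> carrier R" "c \<noteq> \<zero>" "[(i::nat)] \<cdot> c = \<zero>"
  shows "p dvd i"
proof (rule ccontr)
  assume "\<not> p dvd i"
  then have "coprime i p" using p(1) prime_imp_coprime coprime_commute by blast
  moreover have "i \<noteq> 0" using \<open>\<not> p dvd i\<close> by (metis dvd_0_right)
  ultimately obtain u v where uv: "i * u = p * v + 1"
    using bezout_nat[of i p] by (auto simp: coprime_iff_gcd_eq_1)
  have "[(i * u)] \<cdot> c = \<zero>" using c by (simp flip: add.nat_pow_pow add: mult.commute)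
  moreover have "[(p * v)] \<cdot> c = \<zero>" using add_pow_eq_zero_of_dvd[OF p(2) _ c(1)] by simp
  ultimately show False using uv c by (simp add: add.nat_pow_mult[symmetric])
qed

text \<open>A polynomial in which only exponents divisible by p occur is c(X^p) for a shorter coefficient
  list c.\<close>

lemma eval_contraction:
  assumes x: "x \<in> carrier R" and p: "0 < (p::nat)"
  shows "length q = Suc (p * m) \<Longrightarrow> set q \<subseteq> carrier R \<Longrightarrow> (\<And>i. i < length q \<Longrightarrow> \<not> p dvd i \<Longrightarrow> coeff q i = \<zero>) \<Longrightarrow>
    \<exists>cs. length cs = Suc m \<and> set cs \<subseteq> set q \<and> hd cs = hd q \<and>
      eval q x = combine cs (map (\<lambda>y. y [^] p) (exp_base x (Suc m)))"
proof (induction m arbitrary: q)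
  case 0
  then obtain c where "q = [c]" "c \<in> carrier R" by (auto simp: length_Suc_conv)
  then show ?case using x by (intro exI[of _ "[c]"]) (auto simp: exp_base_def nat_pow_one)
next
  case (Suc m)
  obtain c r where q: "q = c # r" using Suc.prems(1) by (cases q) auto
  have c: "c \<in> carrier R" "set r \<subseteq> carrier R" using Suc.prems(2) q by auto
  have lr: "length r = p + p * m" using Suc.prems(1) q by simp
  \<comment> \<open>The p - 1 coefficients strictly between the exponents p (m + 1) and p m. All of
    them vanish.\<close>
  define zs where "zs = take (p - 1) r"
  define q' where "q' = drop (p - 1) r"
  have r: "r = zs @ q'" unfolding zs_def q'_def by simp
  have lz: "length zs = p - 1" unfolding zs_def using lr by simp
  have lq: "length q' = Suc (p * m)" unfolding q'_def using lr p by simp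
  have "zs ! j = \<zero>" if j: "j < p - 1" for j
  proof -
    \<comment> \<open>The exponent that belongs to entry j of \<open>zs\<close>, strictly between
      two consecutive multiples of p.\<close>
    define i where "i = p * m + (p - 1 - j)"
    have "i < length q" "length q - 1 - i = Suc j" unfolding i_def using q lr j by auto
    then have "coeff q i = q ! Suc j" using coeff_nth by metis
    moreover have "\<not> p dvd i"
    proof
      assume "p dvd i"
      then have "p dvd (p - 1 - j)" unfolding i_def by (simp add: dvd_add_right_iff)
      then show False using j by (auto dest: dvd_imp_le)
    qed
    ultimately have "q ! Suc j = \<zero>" using Suc.prems(3)[OF \<open>i < length q\<close>] by simp
    then show ?thesis using q r lz j by (simp add: nth_append)
  qed
  then have zs: "zs = replicate (p - 1) \<zero>" using lz by (intro nth_equalityI) auto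
  have q'c: "set q' \<subseteq> carrier R" using c r by auto
  have "coeff q' i = \<zero>" if "i < length q'" "\<not> p dvd i" for i
  proof -
    have "coeff q i = coeff q' i" using append_coeff[of "c # zs" q'] that(1) q r by simp
    then show ?thesis using Suc.prems(3)[of i] that q r by simp
  qed
  then obtain cs where cs: "length cs = Suc m" "set cs \<subseteq> set q'" "hd cs = hd q'"
    "eval q' x = combine cs (map (\<lambda>y. y [^] p) (exp_base x (Suc m)))"
    using Suc.IH[OF lq q'c] by blast
  have "eval q x = c \<otimes> x [^] (p + p * m) \<oplus> eval q' x"
    using q lr r zs eval_replicate[OF q'c x, of "p - 1"] by simp
  moreover have "(x [^] Suc m) [^] p = x [^] (p + p * m)" using x nat_pow_pow[OF x, of "Suc m" p] by (simp add: algebra_simps)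
  moreover have "exp_base x (Suc (Suc m)) = x [^] Suc m # exp_base x (Suc m)" unfolding exp_base_def by simp
  ultimately have "eval q x = combine (c # cs) (map (\<lambda>y. y [^] p) (exp_base x (Suc (Suc m))))"
    using cs(4) by (simp del: nat_pow_Suc)
  then show ?case using cs(1,2) q r by (intro exI[of _ "c # cs"]) auto
qed

text \<open>As the derivative of the minimal polynomial vanishes, only exponents divisible by p
  occur and the degree is p m. The minimal equation is thus a relation among the p-th powers of 1,
  x, ..., x^m, while these elements themselves are independent because m is below the
  degree.\<close>

lemma inseparable_imp_frobenius_dependent:
  assumes p: "prime (p::nat)" "[p] \<cdot> \<one> = \<zero>"
    and K: "subfield K R" and x: "x \<in> carrier R" and alg: "algebraic K x" and insep: "\<not> separable_over K x"
  shows "\<exists>n. independent K (exp_base x n) \<and> dependent K (map (\<lambda>y. y [^] p) (exp_base x n))"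
proof -
  define f where "f = Irr K x"
  have alg': "(algebraic over K) x" using alg by (simp add: over_def)
  note f = IrrE[OF K x alg', folded f_def]
  have setf: "set f \<subseteq> K" using f(1) polynomial_incl univ_poly_carrier by blast
  then have setfc: "set f \<subseteq> carrier R" using subfieldE(3)[OF K] by blast
  define k where "k = degree f"
  have deg: "1 \<le> k" unfolding k_def f_def by (rule Irr_degree_pos[OF K x alg])
  then have lf: "length f = Suc k" unfolding k_def by simp
  have z: "[i] \<cdot> coeff f i = \<zero>" if "0 < i" "i < length f" for i
    using dlist_coeff[OF inseparable_dlist_Irr[OF K x alg insep]] that unfolding f_def by blast
  have ndvd: "coeff f i = \<zero>" if "i < length f" "\<not> p dvd i" for i
    using char_dvd[OF p _ _ z] that setfc coeff_in_carrier by (metis dvd_0_right gr0I)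
  have "coeff f k = \<one>" using lead_coeff_simp[of f] lf f(3) unfolding k_def by (metis length_0_conv nat.distinct(1))
  then have "p dvd k" using ndvd[of k] lf by force
  then obtain m where m: "k = p * m" by blast
  then have m1: "1 \<le> m" using deg by (cases m) auto
  have "Suc m \<le> 2 * m" using m1 by simp
  also have "\<dots> \<le> k" unfolding m using prime_ge_2_nat[OF p(1)] by (intro mult_right_mono) auto
  finally have Sm: "Suc m \<le> k" .
  have "independent K (exp_base x k)" using exp_base_independent[OF K x alg'] unfolding k_def f_def .
  moreover have "exp_base x k = take (k - Suc m) (exp_base x k) @ exp_base x (Suc m)"
    using append_take_drop_id[of "k - Suc m" "exp_base x k"] drop_exp_base[of "k - Suc m" x k] Sm by simp
  ultimately have ind: "independent K (exp_base x (Suc m))" using independent_split(1)[OF K] by metis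
  obtain cs where cs: "length cs = Suc m" "set cs \<subseteq> set f" "hd cs = hd f"
    "eval f x = combine cs (map (\<lambda>y. y [^] p) (exp_base x (Suc m)))"
    using eval_contraction[OF x _ _ setfc ndvd, of p m] prime_gt_0_nat[OF p(1)] lf m by auto
  have "dependent K (map (\<lambda>y. y [^] p) (exp_base x (Suc m)))"
  proof (rule non_trivial_combine_imp_dependent[OF K])
    show "set cs \<subseteq> K" using cs(2) setf by blast
    show "combine cs (map (\<lambda>y. y [^] p) (exp_base x (Suc m))) = \<zero>" using cs(4) f(4) by simp
    have "hd cs \<in> set cs" using cs(1) by (intro hd_in_set) auto
    then have "\<one> \<in> set cs" using cs(3) f(3) by simp
    then show "\<not> set (take (length (map (\<lambda>y. y [^] p) (exp_base x (Suc m)))) cs) \<subseteq> {\<zero>}"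
      using cs(1) one_not_zero by (auto simp: exp_base_def)
  qed
  with ind show ?thesis by blast
qed

text \<open>The minimal polynomial of x over K(x^p) divides (X - x)^p, and it divides the minimal polynomial
  over K, of which x is a simple root.  Hence it is X - x.\<close>

lemma separable_imp_mem_frobenius_extension:
  assumes p: "prime (p::nat)" "[p] \<cdot> \<one> = \<zero>"
    and K: "subfield K R" and x: "x \<in> carrier R" and sep: "separable_over K x"
  shows "x \<in> simple_extension K (x [^] p)"
proof -
  define y where "y = x [^] p"
  have y: "y \<in> carrier R" unfolding y_def using x by simp
  have alg: "(algebraic over K) x" using sep unfolding separable_over_def over_def by blast
  have sx: "subring (simple_extension K x) R" using simple_extension_is_subring[OF subfieldE(1)[OF K] x] .
  have "x [^] n \<in> simple_extension K x" for n :: nat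
    by (induction n) (use simple_extension_mem[OF subfieldE(1)[OF K] x] subringE(3,6)[OF sx] in auto)
  then have algy: "(algebraic over K) y" unfolding y_def using simple_extesion_mem_imp_algebraic[OF K x alg] by blast
  define E where "E = simple_extension K y"
  have E: "subfield E R" unfolding E_def using simple_extension_is_subfield[OF K y] algy by blast
  have KE: "K \<subseteq> E" unfolding E_def by (rule simple_extension_incl[OF subfieldE(3)[OF K] y])
  have yE: "y \<in> E" unfolding E_def by (rule simple_extension_mem[OF subfieldE(1)[OF K] y])
  have algE: "(algebraic over E) x" using algebraic_mono[OF KE alg] .
  note Er = subfieldE(1)[OF E]
  note g = IrrE[OF E x algE] and f = IrrE[OF K x alg]
  define G where "G = Irr E x"
  define Q where "Q = Irr K x"
  interpret UP: domain "poly_ring R" using univ_poly_is_domain[OF carrier_is_subring] .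
  interpret UE: domain "E[X]" using univ_poly_is_domain[OF Er] .
  have GR: "G \<in> carrier (poly_ring R)" unfolding G_def using carrier_polynomial_shell[OF Er g(1)] .
  have QR: "Q \<in> carrier (poly_ring R)" unfolding Q_def using carrier_polynomial_shell[OF subfieldE(1)[OF K] f(1)] .
  have Q0: "Q \<noteq> []" unfolding Q_def using f(2) pirreducibleE(1)[OF subfieldE(1)[OF K] f(1)] by blast
  have G0: "G \<noteq> []" unfolding G_def using g(2) pirreducibleE(1)[OF Er g(1)] by blast
  have QE: "Q \<in> carrier (E[X])" using f(1) KE unfolding Q_def univ_poly_carrier[symmetric] polynomial_def by auto
  have GQ: "G pdivides Q" unfolding G_def using Irr_minimal[OF E x algE QE] f(4) unfolding Q_def by blast
  define l where "l = [\<one>, \<ominus> x]"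
  have l: "l \<in> carrier (poly_ring R)" unfolding l_def by (rule linear_poly_carrier[OF x])
  \<comment> \<open>The sign comes from (x - x)^p = 0, an argument that includes p = 2.\<close>
  have mx: "(\<ominus> x) [^] p = \<ominus> y"
  proof -
    have "(x \<oplus> \<ominus> x) [^] p = y \<oplus> (\<ominus> x) [^] p" unfolding y_def using frobenius_add[OF p x] x by simp
    moreover have "(x \<oplus> \<ominus> x) [^] p = \<zero>" using x r_neg prime_gt_0_nat[OF p(1)] by (simp add: nat_pow_zero)
    ultimately show ?thesis using x y by (metis a_comm add.inv_closed minus_equality nat_pow_closed)
  qed
  have pc: "ring_hom_ring R (poly_ring R) poly_of_const"
    using canonical_embedding_ring_hom[OF carrier_is_subring] by simp
  then interpret C: ring_hom_ring R "poly_ring R" poly_of_const .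
  have addpow: "[n] \<cdot>\<^bsub>poly_ring R\<^esub> \<one>\<^bsub>poly_ring R\<^esub> = poly_of_const ([n] \<cdot> \<one>)" for n :: nat
    by (induction n) (auto simp: C.hom_add[symmetric])
  have Up: "[p] \<cdot>\<^bsub>poly_ring R\<^esub> \<one>\<^bsub>poly_ring R\<^esub> = \<zero>\<^bsub>poly_ring R\<^esub>" unfolding addpow p(2) by simp
  have Xc: "X \<in> carrier (poly_ring R)" by (rule var_closed(1)[OF carrier_is_subring])
  have lX: "l = X \<oplus>\<^bsub>poly_ring R\<^esub> poly_of_const (\<ominus> x)"
    unfolding l_def var_def poly_of_const_def univ_poly_add using x by (auto simp: a_comm)
  have lp: "l [^]\<^bsub>poly_ring R\<^esub> p = X [^]\<^bsub>poly_ring R\<^esub> p \<oplus>\<^bsub>poly_ring R\<^esub> poly_of_const (\<ominus> y)"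
    unfolding lX UP.frobenius_add[OF p(1) Up Xc C.hom_closed[OF add.inv_closed[OF x]]]
    using C.hom_nat_pow[of "\<ominus> x" p] x mx by simp
  have "X [^]\<^bsub>poly_ring R\<^esub> p = X [^]\<^bsub>E[X]\<^esub> p"
    unfolding unitary_monom_eq_var_pow[OF carrier_is_subring, symmetric] unitary_monom_eq_var_pow[OF Er, symmetric] by simp
  then have "X [^]\<^bsub>poly_ring R\<^esub> p \<in> carrier (E[X])" using var_pow_closed[OF Er] by simp
  moreover have "poly_of_const (\<ominus> y) \<in> carrier (E[X])"
    using subringE(5)[OF Er yE] normalize_gives_polynomial[of "[\<ominus> y]" E]
    unfolding poly_of_const_def univ_poly_carrier by simp
  ultimately have lpE: "l [^]\<^bsub>poly_ring R\<^esub> p \<in> carrier (E[X])"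
    unfolding lp using UE.a_closed unfolding univ_poly_add by blast
  have lx: "eval l x = \<zero>" unfolding l_def using x r_neg by simp
  note ehom = eval_is_hom[OF carrier_is_subring x]
  have lpx: "eval (l [^]\<^bsub>poly_ring R\<^esub> n) x = \<zero>" if n: "0 < n" for n :: nat
  proof -
    obtain j where "n = Suc j" using gr0_implies_Suc[OF n] by blast
    then have "eval (l [^]\<^bsub>poly_ring R\<^esub> n) x = eval (l [^]\<^bsub>poly_ring R\<^esub> j) x \<otimes> eval l x"
      using ring_hom_mult[OF ehom] l by simp
    then show ?thesis using lx ring_hom_closed[OF ehom] l by simp
  qed
  have Glp: "G pdivides (l [^]\<^bsub>poly_ring R\<^esub> p)"
    unfolding G_def using Irr_minimal[OF E x algE lpE] lpx prime_gt_0_nat[OF p(1)] by blast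
  have "is_root G x" unfolding is_root_def using x g(4) G0 unfolding G_def by blast
  then have "l pdivides G" unfolding l_def by (rule is_root_imp_pdivides[OF GR])
  then obtain H where H: "H \<in> carrier (poly_ring R)" "G = l \<otimes>\<^bsub>poly_ring R\<^esub> H"
    unfolding pdivides_def by (rule dividesE)
  \<comment> \<open>A second factor X - x of G would occur twice in the minimal polynomial over K,
    against separability.\<close>
  have nl: "\<not> l pdivides H"
  proof
    assume "l pdivides H"
    then obtain J where J: "J \<in> carrier (poly_ring R)" "H = l \<otimes>\<^bsub>poly_ring R\<^esub> J" unfolding pdivides_def by (rule dividesE)
    obtain A where A: "A \<in> carrier (poly_ring R)" "Q = G \<otimes>\<^bsub>poly_ring R\<^esub> A" using GQ unfolding pdivides_def by (rule dividesE)
    have "Q = (l [^]\<^bsub>poly_ring R\<^esub> (2::nat)) \<otimes>\<^bsub>poly_ring R\<^esub> (J \<otimes>\<^bsub>poly_ring R\<^esub> A)"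
      unfolding A(2) H(2) J(2) using l J(1) A(1) by (simp add: numeral_2_eq_2 UP.m_assoc)
    then have "(l [^]\<^bsub>poly_ring R\<^esub> (2::nat)) pdivides Q" unfolding pdivides_def using J(1) A(1) by (intro dividesI) auto
    then have "2 \<le> alg_mult Q x" unfolding l_def by (rule alg_multE(2)[OF x QR Q0])
    then show False using sep x unfolding separable_over_def Q_def by force
  qed
  have lirr: "pirreducible (carrier R) l"
    unfolding l_def by (rule degree_one_imp_pirreducible[OF carrier_is_subfield linear_poly_carrier[OF x]]) simp
  obtain A where A: "A \<in> carrier (poly_ring R)" "l [^]\<^bsub>poly_ring R\<^esub> p = G \<otimes>\<^bsub>poly_ring R\<^esub> A"
    using Glp unfolding pdivides_def by (rule dividesE)
  \<comment> \<open>Since l is irreducible and does not divide H, the equation l^p = H (l A) makes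
    l^p divide l A. Comparing degrees leaves degree 0 for H, so G is linear.\<close>
  have "l [^]\<^bsub>poly_ring R\<^esub> p = H \<otimes>\<^bsub>poly_ring R\<^esub> (l \<otimes>\<^bsub>poly_ring R\<^esub> A)"
    unfolding A(2) H(2) using l H(1) A(1) by (simp add: UP.m_ac)
  moreover have "(l [^]\<^bsub>poly_ring R\<^esub> p) pdivides (l [^]\<^bsub>poly_ring R\<^esub> p)"
    unfolding pdivides_def using l by (intro UP.divides_refl) auto
  ultimately have "(l [^]\<^bsub>poly_ring R\<^esub> p) pdivides (H \<otimes>\<^bsub>poly_ring R\<^esub> (l \<otimes>\<^bsub>poly_ring R\<^esub> A))" by simp
  then have "(l [^]\<^bsub>poly_ring R\<^esub> p) pdivides (l \<otimes>\<^bsub>poly_ring R\<^esub> A)"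
    using pirreducible_pow_pdivides_iff[OF carrier_is_subfield l H(1) _ lirr nl] l A(1) by simp
  moreover have lp0: "l [^]\<^bsub>poly_ring R\<^esub> p \<noteq> []" using polynomial_pow_not_zero[OF l] unfolding l_def by simp
  then have lA0: "l \<otimes>\<^bsub>poly_ring R\<^esub> A \<noteq> []" "H \<noteq> []"
    using \<open>l [^]\<^bsub>poly_ring R\<^esub> p = H \<otimes>\<^bsub>poly_ring R\<^esub> (l \<otimes>\<^bsub>poly_ring R\<^esub> A)\<close> H(1) l A(1)
      UP.r_null[of H] UP.l_null[of "l \<otimes>\<^bsub>poly_ring R\<^esub> A"] UP.m_closed unfolding univ_poly_zero by force+
  ultimately have d1: "degree (l [^]\<^bsub>poly_ring R\<^esub> p) \<le> degree (l \<otimes>\<^bsub>poly_ring R\<^esub> A)"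
    using pdivides_imp_degree_le[OF carrier_is_subring _ _ lA0(1)] l A(1) by simp
  have deg_mult: "degree (u \<otimes>\<^bsub>poly_ring R\<^esub> v) = degree u + degree v"
    if "u \<in> carrier (poly_ring R)" "v \<in> carrier (poly_ring R)" "u \<noteq> []" "v \<noteq> []" for u v
    using poly_mult_degree_eq[OF carrier_is_subring] that unfolding univ_poly_mult univ_poly_carrier by simp
  have "degree (l [^]\<^bsub>poly_ring R\<^esub> p) = degree H + degree (l \<otimes>\<^bsub>poly_ring R\<^esub> A)"
    unfolding \<open>l [^]\<^bsub>poly_ring R\<^esub> p = H \<otimes>\<^bsub>poly_ring R\<^esub> (l \<otimes>\<^bsub>poly_ring R\<^esub> A)\<close>
    using deg_mult[OF H(1) UP.m_closed[OF l A(1)] lA0(2,1)] .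
  then have "degree H = 0" using d1 by simp
  then have "degree G = 1" unfolding H(2) using deg_mult[OF l H(1) _ lA0(2)] unfolding l_def by simp
  then obtain b where "G = [\<one>, b]" "b \<in> E"
    using g(1,3) unfolding G_def univ_poly_carrier[symmetric] polynomial_def
    by (cases "Irr E x" rule: list.exhaust; cases "tl (Irr E x)"; cases "tl (tl (Irr E x))") auto
  then have b: "x \<oplus> b = \<zero>" "b \<in> E" using g(4) x subringE(1)[OF Er] unfolding G_def by auto
  then have "x = \<ominus> b" using x subringE(1)[OF Er] minus_equality by (metis subsetD)
  then show ?thesis using subringE(5)[OF Er b(2)] unfolding E_def y_def by simp
qed

text \<open>The p-th powers of the coefficients stay in K but need not exhaust it, so the p-th
  powers only lie in the span of the \<open>map\<close>.\<close>

lemma frobenius_Span: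
  assumes p: "prime (p::nat)" "[p] \<cdot> \<one> = \<zero>" and K: "subfield K R"
  shows "set ws \<subseteq> carrier R \<Longrightarrow> v \<in> Span K ws \<Longrightarrow> v [^] p \<in> Span K (map (\<lambda>y. y [^] p) ws)"
proof (induction ws arbitrary: v)
  case Nil
  then show ?case using prime_gt_0_nat[OF p(1)] by (simp add: nat_pow_zero)
next
  case (Cons w ws)
  then obtain a u where au: "a \<in> K" "u \<in> Span K ws" "v = a \<otimes> w \<oplus> u" unfolding Span_Cons_iff by blast
  have c: "a \<in> carrier R" "w \<in> carrier R" "u \<in> carrier R"
    using au Cons.prems(1) subfieldE(3)[OF K] Span_in_carrier[OF subfieldE(3)[OF K], of ws] by auto
  have "v [^] p = a [^] p \<otimes> w [^] p \<oplus> u [^] p"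
    unfolding au(3) using c frobenius_add[OF p, of "a \<otimes> w" u] by (simp add: nat_pow_distrib)
  moreover have "a [^] n \<in> K" for n :: nat
    by (induction n) (use au(1) subringE(3,6)[OF subfieldE(1)[OF K]] in auto)
  moreover have "u [^] p \<in> Span K (map (\<lambda>y. y [^] p) ws)" using Cons au by simp
  ultimately show ?case unfolding list.map Span_Cons_iff by blast
qed

lemma Span_dimension_less:
  assumes K: "subfield K R"
  shows "set gs \<subseteq> carrier R \<Longrightarrow> dependent K gs \<Longrightarrow> \<exists>m < length gs. dimension m K (Span K gs)"
proof (induction gs)
  case (Cons g gs)
  then have g: "g \<in> carrier R" "set gs \<subseteq> carrier R" by auto
  have eq: "Span K (g # gs) = Span K gs" if "g \<in> Span K gs"
    using mono_Span_subset[OF K, of "g # gs" gs] mono_Span[OF K g(2,1)] that g Span_base_incl[OF K g(2)] by auto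
  show ?case
  proof (cases "g \<in> Span K gs")
    case True
    then show ?thesis using eq Span_dimension_le[OF K g(2)] by (auto simp: less_Suc_eq_le)
  next
    case False
    then have "dependent K gs" using Cons.prems(2) li_Cons g(1) by blast
    then obtain m where "m < length gs" "dimension m K (Span K gs)" using Cons.IH g by blast
    then show ?thesis using Suc_dim[OF g(1) False] by (auto simp: Span_Cons)
  qed
qed simp

text \<open>MacLane's criterion: the p-th powers of a basis of the extension span a field that contains all
  generators, so they form a basis as well.\<close>

lemma frobenius_independent:
  assumes p: "prime (p::nat)" "[p] \<cdot> \<one> = \<zero>" and K: "subfield K R"
    and xs: "set xs \<subseteq> carrier R" "\<And>x. x \<in> set xs \<Longrightarrow> algebraic K x"
      "\<And>x. x \<in> set xs \<Longrightarrow> x \<in> simple_extension K (x [^] p)"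
    and zs: "independent K zs" "set zs \<subseteq> finite_extension K xs"
  shows "independent K (map (\<lambda>y. y [^] p) zs)"
proof -
  define E where "E = finite_extension K xs"
  have alg: "\<And>x. x \<in> set xs \<Longrightarrow> (algebraic over K) x" using xs(2) by (simp add: over_def)
  have E: "subfield E R" unfolding E_def using finite_extension_is_subfield[OF K xs(1) alg] .
  have "finite_dimension K E" unfolding E_def using finite_extension_finite_dimension(1)[OF K xs(1) alg] .
  then obtain n where n: "dimension n K E" by (rule finite_dimensionE')
  obtain Vs where Vs: "length (Vs @ zs) = n" "independent K (Vs @ zs)" "Span K (Vs @ zs) = E"
    using complete_base[OF K n zs(1)] zs(2) unfolding E_def by blast
  define ws where "ws = Vs @ zs"
  define fs where "fs = map (\<lambda>y. y [^] p) ws"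
  have wsc: "set ws \<subseteq> carrier R" unfolding ws_def by (rule independent_in_carrier[OF Vs(2)])
  have fsc: "set fs \<subseteq> carrier R" unfolding fs_def using wsc by auto
  have pow: "v [^] p \<in> Span K fs" if "v \<in> E" for v
    using frobenius_Span[OF p K wsc, of v] that Vs(3) unfolding fs_def ws_def by simp
  have wsE: "set ws \<subseteq> E" using Span_base_incl[OF K wsc] Vs(3) unfolding ws_def by simp
  have one: "\<one> \<in> Span K fs" using pow[OF subringE(3)[OF subfieldE(1)[OF E]]] by (simp add: nat_pow_one)
  have mult: "u \<otimes> v \<in> Span K fs" if "u \<in> set fs" "v \<in> set fs" for u v
  proof -
    obtain a b where ab: "a \<in> set ws" "u = a [^] p" "b \<in> set ws" "v = b [^] p" using \<open>u \<in> set fs\<close> \<open>v \<in> set fs\<close> unfolding fs_def by auto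
    have c: "a \<in> carrier R" "b \<in> carrier R" using ab wsc by auto
    have "u \<otimes> v = (a \<otimes> b) [^] p" unfolding ab(2,4) using c by (simp add: nat_pow_distrib)
    moreover have "a \<otimes> b \<in> E" using ab wsE subringE(6)[OF subfieldE(1)[OF E]] by blast
    ultimately show ?thesis using pow by simp
  qed
  \<comment> \<open>The span of the p-th powers is now a field over K. It contains x^p for each
    generator x, hence x itself by the third hypothesis on \<open>xs\<close>, and so all of
    E.\<close>
  note S = Span_subfieldI[OF K fsc one mult]
  have sr: "subring (Span K fs) R" using subfieldE(1)[OF S(1)] by simp
  have "set xs \<subseteq> Span K fs"
  proof
    fix x assume x: "x \<in> set xs"
    have "x \<in> E" using finite_extension_mem[OF subfieldE(1)[OF K] xs(1)] x unfolding E_def by blast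
    then have "x [^] p \<in> Span K fs" by (rule pow)
    then have "simple_extension K (x [^] p) \<subseteq> Span K fs" using simple_extension_subring_incl[OF sr S(2)] by simp
    then show "x \<in> Span K fs" using xs(3)[OF x] by blast
  qed
  then have ES: "E \<subseteq> Span K fs" unfolding E_def using finite_extension_subring_incl[OF sr S(2)] by simp
  \<comment> \<open>The entries of \<open>fs\<close> are as many as the dimension of E and their
    span contains E, so they cannot be dependent.\<close>
  have "independent K fs"
  proof (rule ccontr)
    assume "dependent K fs"
    then obtain m where m: "m < length fs" "dimension m K (Span K fs)" using Span_dimension_less[OF K fsc] by blast
    have "length ws \<le> m" using independent_length_le_dimension[OF K m(2) Vs(2)] wsE ES unfolding ws_def by auto
    then show False using m(1) unfolding fs_def by simp
  qed
  then show ?thesis unfolding fs_def ws_def using independent_split(1)[OF K] by simp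
qed

text \<open>An inseparable z would have independent powers with dependent p-th powers, which
  MacLane's criterion forbids in an extension generated by separable elements.\<close>

lemma finite_extension_separable:
  assumes K: "subfield K R" and xs: "set xs \<subseteq> carrier R" "\<And>x. x \<in> set xs \<Longrightarrow> separable_over K x"
    and z: "z \<in> finite_extension K xs"
  shows "separable_over K z"
proof (rule ccontr)
  assume insep: "\<not> separable_over K z"
  have alg: "\<And>x. x \<in> set xs \<Longrightarrow> algebraic K x" using xs(2) unfolding separable_over_def by blast
  then have alg': "\<And>x. x \<in> set xs \<Longrightarrow> (algebraic over K) x" by (simp add: over_def)
  have E: "subring (finite_extension K xs) R" using finite_extension_is_subring[OF subfieldE(1)[OF K] xs(1)] .
  have zc: "z \<in> carrier R" using z subringE(1)[OF E] by blast
  have algz: "algebraic K z" using finite_extesion_mem_imp_algebraic[OF K xs(1) alg' z] by (simp add: over_def)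
  obtain p where p: "prime (p::nat)" "[p] \<cdot> \<one> = \<zero>"
    using inseparable_imp_char[OF K zc algz insep] char_prime_exists by blast
  obtain n where n: "independent K (exp_base z n)" "dependent K (map (\<lambda>y. y [^] p) (exp_base z n))"
    using inseparable_imp_frobenius_dependent[OF p K zc algz insep] by blast
  have "z [^] i \<in> finite_extension K xs" for i :: nat
    by (induction i) (use z subringE(3,6)[OF E] in auto)
  then have "set (exp_base z n) \<subseteq> finite_extension K xs" unfolding exp_base_def by auto
  then have "independent K (map (\<lambda>y. y [^] p) (exp_base z n))"
    using frobenius_independent[OF p K xs(1) alg separable_imp_mem_frobenius_extension[OF p K] n(1)] xs by blast
  then show False using n(2) by simp
qed

section \<open>Intermediate fields and bounded degrees\<close>

lemma subfield_Int:
  assumes "subfield K R" "subfield L R"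
  shows "subfield (K \<inter> L) R"
proof (rule subfieldI')
  note k = subringE[OF subfieldE(1)[OF assms(1)]] and l = subringE[OF subfieldE(1)[OF assms(2)]]
  show "subring (K \<inter> L) R"
    by (rule subringI) (use k(1,3,5,6,7) l(1,3,5,6,7) in auto)
  show "inv x \<in> K \<inter> L" if "x \<in> K \<inter> L - {\<zero>}" for x
    using subfield_m_inv(1)[OF assms(1), of x] subfield_m_inv(1)[OF assms(2), of x] that by blast
qed

lemma subfield_dimension_pos:
  assumes "subfield E R" "subfield K R" "dimension n K E"
  shows "0 < n"
proof (rule ccontr)
  assume "\<not> 0 < n"
  then have "E = {\<zero>}" using dimension_zero[OF assms(2)] assms(3) by simp
  then show False using subringE(3)[OF subfieldE(1)[OF assms(1)]] one_not_zero by blast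
qed

lemma subfield_finite_subspace:
  assumes "subfield K R" "subfield V R" "K \<subseteq> V" "V \<subseteq> E" "finite_dimension K E"
  shows "finite_dimension K V"
proof (rule subalbegra_incl_imp_finite_dimension[OF assms(1,5) _ assms(4)])
  show "subalgebra K V R"
    using subring.axioms(1)[OF subfieldE(1)[OF assms(2)]] subringE(6)[OF subfieldE(1)[OF assms(2)]] assms(3)
    by (intro subalgebra.intro subalgebra_axioms.intro) blast+
qed

text \<open>A subextension E of largest degree exhausts L: the degree of E(y) is a multiple of that
  of E and cannot exceed it, so E(y) = E. The bound is a finite set N of degrees because (i)
  supplies it in that form.\<close>

lemma finite_dimension_of_bounded_degrees:
  assumes K: "subfield K R" and L: "subfield L R" "K \<subseteq> L" "\<And>x. x \<in> L \<Longrightarrow> (algebraic over K) x"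
    and fin: "finite N"
    and deg: "\<And>E m. subfield E R \<Longrightarrow> K \<subseteq> E \<Longrightarrow> E \<subseteq> L \<Longrightarrow> dimension m K E \<Longrightarrow> m \<in> N"
  shows "finite_dimension K L"
proof -
  define M where "M = {m. \<exists>E. subfield E R \<and> K \<subseteq> E \<and> E \<subseteq> L \<and> dimension m K E}"
  have "finite M" by (rule finite_subset[OF _ fin]) (use deg M_def in blast)
  moreover have "1 \<in> M" unfolding M_def using K L(2) dimension_one[OF K] by blast
  ultimately have "Max M \<in> M" "\<And>m. m \<in> M \<Longrightarrow> m \<le> Max M" by (auto intro: Max_in)
  then obtain E where E: "subfield E R" "K \<subseteq> E" "E \<subseteq> L" "dimension (Max M) K E" unfolding M_def by blast
  have "y \<in> E" if y: "y \<in> L" for y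
  proof -
    have yc: "y \<in> carrier R" using y subfieldE(3)[OF L(1)] by blast
    have alg: "(algebraic over E) y" using algebraic_mono[OF E(2) L(3)[OF y]] .
    define E' where "E' = simple_extension E y"
    have E': "subfield E' R" unfolding E'_def using simple_extension_is_subfield[OF E(1) yc] alg by blast
    have EE': "E \<subseteq> E'" unfolding E'_def by (rule simple_extension_incl[OF subfieldE(3)[OF E(1)] yc])
    have yE': "y \<in> E'" unfolding E'_def by (rule simple_extension_mem[OF subfieldE(1)[OF E(1)] yc])
    have E'L: "E' \<subseteq> L" unfolding E'_def using simple_extension_subring_incl[OF subfieldE(1)[OF L(1)] E(3) y] .
    have d: "dimension (Max M * degree (Irr E y)) K E'" unfolding E'_def
      by (rule telescopic_base[OF K E(1,4) dimension_simple_extension[OF E(1) yc alg]])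
    then have "Max M * degree (Irr E y) \<in> M" unfolding M_def using E' EE' E'L E(2) by blast
    then have le: "Max M * degree (Irr E y) \<le> Max M" using \<open>\<And>m. m \<in> M \<Longrightarrow> m \<le> Max M\<close> by blast
    obtain ws where ws: "independent K ws" "length ws = Max M" "Span K ws = E"
      using exists_base[OF K E(4)] by blast
    have wsE': "set ws \<subseteq> E'" using Span_base_incl[OF K independent_in_carrier[OF ws(1)]] ws(3) EE' by blast
    have "length ws = Max M * degree (Irr E y)"
      using independent_length_le_dimension[OF K d ws(1) wsE'] le ws(2) le_antisym by metis
    then have "Span K ws = E'" using independent_length_eq_dimension[OF K d ws(1) wsE'] by blast
    then show ?thesis using ws(3) yE' by simp
  qed
  then have "E = L" using E(3) by blast
  then show ?thesis using E(4) finite_dimensionI by blast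
qed

end

text \<open>Every positive n that annihilates the unit is a multiple of the prime p, so p is the
  least one.\<close>

lemma char_ofI:
  assumes "field R" "prime (p::nat)" "[p] \<cdot>\<^bsub>R\<^esub> \<one>\<^bsub>R\<^esub> = \<zero>\<^bsub>R\<^esub>"
  shows "char_of R = p"
proof -
  interpret field R by (rule assms(1))
  have "(LEAST n::nat. n > 0 \<and> [n] \<cdot>\<^bsub>R\<^esub> \<one>\<^bsub>R\<^esub> = \<zero>\<^bsub>R\<^esub>) = p"
  proof (rule Least_equality)
    fix n :: nat assume "n > 0 \<and> [n] \<cdot>\<^bsub>R\<^esub> \<one>\<^bsub>R\<^esub> = \<zero>\<^bsub>R\<^esub>"
    then show "p \<le> n" using char_dvd[OF assms(2,3), of "\<one>\<^bsub>R\<^esub>" n] dvd_imp_le by auto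
  qed (use assms prime_gt_0_nat in auto)
  moreover have "\<exists>n::nat>0. ([n] \<cdot>\<^bsub>R\<^esub> \<one>\<^bsub>R\<^esub> = \<zero>\<^bsub>R\<^esub>)" using assms prime_gt_0_nat by blast
  ultimately show ?thesis unfolding char_of_def by simp
qed

section \<open>Transfer of degrees and of separability\<close>

context ultraproduct
begin

lemma nat_pow_U: "ucls D f [^]\<^bsub>U\<^esub> (n::nat) = ucls D (\<lambda>s. f s [^]\<^bsub>\<Omega> s\<^esub> n)"
  by (induction n) (simp_all add: one_U mult_U)

lemma add_pow_U: "[(n::nat)] \<cdot>\<^bsub>U\<^esub> ucls D f = ucls D (\<lambda>s. [n] \<cdot>\<^bsub>\<Omega> s\<^esub> f s)"
  by (induction n) (simp_all add: zero_U add_U)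

lemma ev_char:
  assumes "[(p::nat)] \<cdot>\<^bsub>U\<^esub> \<one>\<^bsub>U\<^esub> = \<zero>\<^bsub>U\<^esub>"
  shows "eventually (\<lambda>s. [p] \<cdot>\<^bsub>\<Omega> s\<^esub> \<one>\<^bsub>\<Omega> s\<^esub> = \<zero>\<^bsub>\<Omega> s\<^esub>) D"
  using assms unfolding one_U add_pow_U zero_U ucls_eq_iff .

lemma us_mono: "eventually (\<lambda>s. A s \<subseteq> B s) D \<Longrightarrow> us A \<subseteq> us B"
proof
  fix x assume AB: "eventually (\<lambda>s. A s \<subseteq> B s) D" and x: "x \<in> us A"
  obtain f where f: "el f" "x = ucls D f" using carrier_U_cases[OF subsetD[OF us_carrier x]] .
  have "eventually (\<lambda>s. f s \<in> A s) D" using x unfolding f(2) us_iff[OF f(1)] .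
  with AB have "eventually (\<lambda>s. f s \<in> B s) D" by eventually_elim blast
  then show "x \<in> us B" unfolding f(2) us_iff[OF f(1)] .
qed

lemma separable_elem_U: "separable_elem U F x \<longleftrightarrow> U.separable_over F x"
  unfolding separable_elem_def U.separable_over_def by simp

lemma separable_elem_s: "separable_elem (\<Omega> s) F x \<longleftrightarrow> field.separable_over (\<Omega> s) F x"
  unfolding separable_elem_def F.separable_over_def by simp

end

context ultra_ratfun
begin

text \<open>For almost all s a basis of E becomes a basis of a field between \<open>Fs s\<close> and
  \<open>L s\<close>, and the tower law gives divisibility. That the components span a field comes
  down to finitely many memberships, those of the unit and of the products of basis
  elements.\<close>

lemma ev_degree_dvd:
  assumes E: "subfield E U" "V.Fr \<subseteq> E" "E \<subseteq> us L" "U.dimension m V.Fr E"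
    and L: "eventually (\<lambda>s. subfield (L s) (\<Omega> s) \<and> Fs s \<subseteq> L s) D"
    and n: "eventually (\<lambda>s. ring.dimension (\<Omega> s) (n s) (Fs s) (L s)) D"
  shows "eventually (\<lambda>s. m dvd n s) D"
proof -
  obtain ws where ws: "set ws \<subseteq> carrier U" "U.independent V.Fr ws" "length ws = m" "U.Span V.Fr ws = E"
    using U.exists_base[OF V.Fr_subfield E(4)] by blast
  obtain fs where fs: "\<forall>f \<in> set fs. el f" "ws = map (ucls D) fs" using map_ucls_surj[OF ws(1)] by blast
  have wsE: "set ws \<subseteq> E" using U.Span_base_incl[OF V.Fr_subfield ws(1)] ws(4) by simp
  have lfs: "length fs = m" using ws(3) fs(2) by simp
  have "eventually (\<lambda>s. ring.independent (\<Omega> s) (Fs s) (vals fs s)) D"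
    using ev_independent[OF E(1,4) fs(1)] wsE ws(2) unfolding fs(2) by blast
  \<comment> \<open>This direction uses only the inclusion of K(t) in the ultraproduct of the
    \<open>Fs\<close>: a representation over K(t) gives one in almost every component.\<close>
  moreover have ES: "eventually (\<lambda>s. g s \<in> ring.Span (\<Omega> s) (Fs s) (vals fs s)) D"
    if "el g" "ucls D g \<in> E" for g
  proof -
    have "ucls D g \<in> U.Span (us Fs) (map (ucls D) fs)"
      using subsetD[OF U.Span_mono[OF Fr_U_us]] that(2) ws(4) unfolding fs(2) by blast
    then show ?thesis unfolding Span_us[OF Fs_carrier fs(1)] us_iff[OF that(1)] .
  qed
  have "eventually (\<lambda>s. \<one>\<^bsub>\<Omega> s\<^esub> \<in> ring.Span (\<Omega> s) (Fs s) (vals fs s)) D"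
    by (rule ES[OF el_ops(1)]) (use subringE(3)[OF subfieldE(1)[OF E(1)]] one_U in simp)
  moreover have "eventually (\<lambda>s. \<forall>f \<in> set fs. \<forall>g \<in> set fs.
      f s \<otimes>\<^bsub>\<Omega> s\<^esub> g s \<in> ring.Span (\<Omega> s) (Fs s) (vals fs s)) D"
  proof (intro eventually_ball_finite ballI)
    fix f g assume fg: "f \<in> set fs" "g \<in> set fs"
    have "ucls D f \<in> E" "ucls D g \<in> E" using wsE fg unfolding fs(2) by auto
    then have "ucls D (\<lambda>s. f s \<otimes>\<^bsub>\<Omega> s\<^esub> g s) \<in> E"
      unfolding mult_U[symmetric] using subringE(6)[OF subfieldE(1)[OF E(1)]] by blast
    then show "eventually (\<lambda>s. f s \<otimes>\<^bsub>\<Omega> s\<^esub> g s \<in> ring.Span (\<Omega> s) (Fs s) (vals fs s)) D"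
      using ES[of "\<lambda>s. f s \<otimes>\<^bsub>\<Omega> s\<^esub> g s"] fs(1) fg by blast
  qed auto
  moreover have "eventually (\<lambda>s. \<forall>f \<in> set fs. f s \<in> L s) D"
  proof (intro eventually_ball_finite ballI)
    fix f assume f: "f \<in> set fs"
    then have "el f" "ucls D f \<in> us L" using fs(1) wsE E(3) unfolding fs(2) by auto
    then show "eventually (\<lambda>s. f s \<in> L s) D" using us_iff by simp
  qed auto
  ultimately show ?thesis
    using L n
  proof eventually_elim
    case (elim s)
    have vc: "set (vals fs s) \<subseteq> carrier (\<Omega> s)" using vals_carrier[OF fs(1)] .
    define Es where "Es = ring.Span (\<Omega> s) (Fs s) (vals fs s)"
    have L: "subfield (L s) (\<Omega> s)" "Fs s \<subseteq> L s" using elim(5) by auto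
    have Es: "subfield Es (\<Omega> s)" "Fs s \<subseteq> Es"
      using F.Span_subfieldI[OF Fs_subfield vc elim(2)] elim(3) unfolding Es_def by auto
    have "Es \<subseteq> L s" unfolding Es_def
      by (rule F.Span_least[OF subring.axioms(1)[OF subfieldE(1)[OF L(1)]]])
        (use subringE(6)[OF subfieldE(1)[OF L(1)]] L(2) elim(4) in auto)
    moreover have "ring.dimension (\<Omega> s) m (Fs s) Es"
      using F.dimension_independent[OF elim(1)] lfs unfolding Es_def by simp
    ultimately show ?case using F.dimension_intermediate_dvd[OF Fs_subfield Es(1) L(1) Es(2) _ elim(6)] by blast
  qed
qed

text \<open>An inseparable x has powers that are independent over K(t) although their p-th powers
  are dependent. Independence descends to the components by \<open>ev_independent\<close>,
  separability there preserves it under p-th powers, and the result returns to the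
  ultraproduct.\<close>

lemma separable_of_ev_separable:
  assumes x: "x \<in> us L" "U.algebraic V.Fr x"
    and sep: "eventually (\<lambda>s. \<forall>y \<in> L s. field.separable_over (\<Omega> s) (Fs s) y) D"
  shows "U.separable_over V.Fr x"
proof (rule ccontr)
  assume insep: "\<not> U.separable_over V.Fr x"
  have xc: "x \<in> carrier U" using x(1) us_carrier by blast
  obtain f where f: "el f" "x = ucls D f" using carrier_U_cases[OF xc] .
  obtain p :: nat where p: "prime p" "[p] \<cdot>\<^bsub>U\<^esub> \<one>\<^bsub>U\<^esub> = \<zero>\<^bsub>U\<^esub>"
    using U.inseparable_imp_char[OF V.Fr_subfield xc x(2) insep] U.char_prime_exists by blast
  obtain n where n: "U.independent V.Fr (U.exp_base x n)"
    "\<not> U.independent V.Fr (map (\<lambda>y. y [^]\<^bsub>U\<^esub> p) (U.exp_base x n))"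
    using U.inseparable_imp_frobenius_dependent[OF p V.Fr_subfield xc x(2) insep] by blast
  \<comment> \<open>Representatives of the powers of x in the order of \<open>exp_base\<close>,
    highest exponent first.\<close>
  define fs where "fs = map (\<lambda>i s. f s [^]\<^bsub>\<Omega> s\<^esub> i) (rev [0..<n])"
  define gs where "gs = map (\<lambda>h s. h s [^]\<^bsub>\<Omega> s\<^esub> p) fs"
  have fs: "\<forall>h \<in> set fs. el h" unfolding fs_def using f(1) by auto
  have gs: "\<forall>h \<in> set gs. el h" unfolding gs_def using fs by auto
  have fsU: "map (ucls D) fs = U.exp_base x n"
    unfolding fs_def U.exp_base_def f(2) by (simp add: nat_pow_U)
  have gsU: "map (ucls D) gs = map (\<lambda>y. y [^]\<^bsub>U\<^esub> p) (U.exp_base x n)"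
    unfolding gs_def fsU[symmetric] by (simp add: nat_pow_U)
  have alg: "(U.algebraic over V.Fr) x" using x(2) by (simp add: over_def)
  define E where "E = U.simple_extension V.Fr x"
  have E: "subfield E U" unfolding E_def using U.simple_extension_is_subfield[OF V.Fr_subfield xc] alg by blast
  have xE: "x \<in> E" unfolding E_def by (rule U.simple_extension_mem[OF subfieldE(1)[OF V.Fr_subfield] xc])
  have "x [^]\<^bsub>U\<^esub> i \<in> E" for i :: nat
    by (induction i) (use xE subringE(3,6)[OF subfieldE(1)[OF E]] in auto)
  then have "set (map (ucls D) fs) \<subseteq> E" unfolding fsU U.exp_base_def by auto
  then have "eventually (\<lambda>s. ring.independent (\<Omega> s) (Fs s) (vals fs s)) D"
    using ev_independent[OF E U.dimension_simple_extension[OF V.Fr_subfield xc alg, folded E_def] fs] n(1) fsU by simp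
  moreover have "eventually (\<lambda>s. f s \<in> L s) D" using x(1) unfolding f(2) us_iff[OF f(1)] .
  ultimately have "eventually (\<lambda>s. cring.free_over (\<Omega> s) (Fs s) (vals gs s)) D"
    using sep ev_char[OF p(2)]
  proof eventually_elim
    case (elim s)
    have fc: "f s \<in> carrier (\<Omega> s)" using elD[OF f(1)] .
    have sep: "field.separable_over (\<Omega> s) (Fs s) (f s)" using elim by blast
    then have alg: "ring.algebraic (\<Omega> s) (Fs s) (f s)" unfolding F.separable_over_def by blast
    have sub: "subring (ring.simple_extension (\<Omega> s) (Fs s) (f s)) (\<Omega> s)"
      using F.simple_extension_is_subring[OF subfieldE(1)[OF Fs_subfield] fc] .
    have "f s [^]\<^bsub>\<Omega> s\<^esub> i \<in> ring.simple_extension (\<Omega> s) (Fs s) (f s)" for i :: nat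
      by (induction i) (use F.simple_extension_mem[OF subfieldE(1)[OF Fs_subfield] fc] subringE(3,6)[OF sub] in auto)
    then have "set (vals fs s) \<subseteq> ring.finite_extension (\<Omega> s) (Fs s) [f s]" unfolding fs_def by auto
    then have "ring.independent (\<Omega> s) (Fs s) (map (\<lambda>y. y [^]\<^bsub>\<Omega> s\<^esub> p) (vals fs s))"
      using F.frobenius_independent[OF p(1) elim(4) Fs_subfield, of "[f s]"] fc alg elim(1)
        F.separable_imp_mem_frobenius_extension[OF p(1) elim(4) Fs_subfield fc sep] by (simp del: map_map)
    moreover have "map (\<lambda>y. y [^]\<^bsub>\<Omega> s\<^esub> p) (vals fs s) = vals gs s" unfolding gs_def by simp
    ultimately show ?case using E.independent_imp_free_over[OF subset_refl] by simp
  qed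
  \<comment> \<open>The way back needs no degree bound: freeness over the full ultraproduct of the
    \<open>Fs\<close> restricts to its subset K[t], and clearing denominators then yields
    independence over K(t).\<close>
  then have "U.free_over (us Fs) (map (ucls D) gs)" unfolding free_over_us[OF Fs_carrier gs] .
  then have "U.free_over V.T (map (ucls D) gs)"
    by (rule U.free_over_mono[rotated]) (use V.T_in_Fr Fr_U_us in blast)
  then have "U.independent V.Fr (map (ucls D) gs)"
    by (rule V.free_over_T_imp_independent[OF map_ucls_carrier[OF gs]])
  then show False using n(2) gsU by simp
qed

end

section \<open>The algebraic and the separable part of the ultraproduct\<close>

theorem mainTheorem7:
  fixes D :: "'s filter"
    and \<Omega> :: "'s \<Rightarrow> 'b ring"
    and K :: "'s \<Rightarrow> 'b set"
    and t :: "'s \<Rightarrow> 'b"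
    and L :: "'s \<Rightarrow> 'b set"
  assumes S_inf: "infinite (UNIV :: 's set)"
    and D_ultra: "is_ultrafilter D"
    and D_nonpr: "nonprincipal D"
    and K_field: "\<And>s. subfield (K s) (\<Omega> s)"
    and t_in: "\<And>s. t s \<in> carrier (\<Omega> s)"
    and t_trans: "\<And>s. ring.transcendental (\<Omega> s) (K s) (t s)"
    and \<Omega>_closure: "\<And>s. algebraic_closure (\<Omega> s) (ratfun_field (\<Omega> s) (K s) (t s))"
    and L_ext: "eventually (\<lambda>s. subfield (L s) (\<Omega> s)
                   \<and> ratfun_field (\<Omega> s) (K s) (t s) \<subseteq> L s
                   \<and> (\<forall>x\<in>L s. \<not> ring.transcendental (\<Omega> s) (ratfun_field (\<Omega> s) (K s) (t s)) x)) D"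
  shows
   "(let U = ultraprod D \<Omega>; F = ratfun_embed D \<Omega> K t; \<LL> = ultraset D \<Omega> L;
         Lalg = \<LL> \<inter> alg_closure_in U F; Lsep = \<LL> \<inter> sep_closure_in U F
     in
      ((\<exists>n :: 's \<Rightarrow> nat.
          eventually (\<lambda>s. ring.dimension (\<Omega> s) (n s) (ratfun_field (\<Omega> s) (K s) (t s)) (L s)) D
          \<and> finite {k :: nat. k > 0 \<and> eventually (\<lambda>s. k dvd n s) D})
        \<longrightarrow> (subfield Lalg U \<and> F \<subseteq> Lalg \<and> ring.finite_dimension U F Lalg)
          \<and> (subfield Lsep U \<and> F \<subseteq> Lsep \<and> ring.finite_dimension U F Lsep
             \<and> (\<forall>x\<in>Lsep. separable_elem U F x)))
    \<and> (eventually (\<lambda>s. \<forall>x\<in>L s. separable_elem (\<Omega> s) (ratfun_field (\<Omega> s) (K s) (t s)) x) D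
        \<longrightarrow> (\<forall>x\<in>Lalg. separable_elem U F x) \<and> Lalg = Lsep)
    \<and> ((\<nexists>p :: nat. prime p \<and> eventually (\<lambda>s. char_of (\<Omega> s) = p) D)
        \<longrightarrow> (\<forall>x\<in>Lalg. separable_elem U F x) \<and> Lalg = Lsep))"
proof -
  have fields: "field (\<Omega> s)" for s using \<Omega>_closure[of s] by (rule algebraic_closure.axioms(1))
  interpret ultra_ratfun D \<Omega> K t
  proof (intro ultra_ratfun.intro ultraproduct.intro ultra_ratfun_axioms.intro D_ultra fields)
    show "transcendental_elem (\<Omega> s) (K s) (t s)" for s
      by (intro transcendental_elem.intro transcendental_elem_axioms.intro fields K_field t_in t_trans)
  qed
  have rf: "ratfun_field (\<Omega> s) (K s) (t s) = Fs s" for s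
    unfolding ratfun_field_def by (rule E.generate_field_eq_Fr)
  define LL where "LL = us L"
  define Lalg where "Lalg = LL \<inter> alg_closure_in U V.Fr"
  define Lsep where "Lsep = LL \<inter> sep_closure_in U V.Fr"
  have Lsep_eq: "Lsep = {x \<in> Lalg. U.separable_over V.Fr x}"
    unfolding Lsep_def Lalg_def sep_closure_in_def separable_elem_U by blast
  have L': "eventually (\<lambda>s. subfield (L s) (\<Omega> s) \<and> Fs s \<subseteq> L s) D"
    using L_ext unfolding rf by (rule eventually_mono) blast
  have Lalg: "subfield Lalg U"
    unfolding Lalg_def LL_def alg_closure_in_def
    using U.subfield_Int[OF subfield_us U.subfield_of_algebraics[OF V.Fr_subfield]] L'
    by (simp add: over_def eventually_conj_iff)
  have Lalg_alg: "U.algebraic V.Fr x" if "x \<in> Lalg" for x using that unfolding Lalg_def alg_closure_in_def by blast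
  have FL: "V.Fr \<subseteq> Lalg"
  proof
    fix x assume x: "x \<in> V.Fr"
    have "us Fs \<subseteq> us L" by (rule us_mono) (use L' in \<open>simp add: eventually_conj_iff\<close>)
    then have "x \<in> LL" unfolding LL_def using Fr_U_us x by blast
    moreover have "U.algebraic V.Fr x"
      using U.algebraic_self[OF subfieldE(1)[OF V.Fr_subfield] x] by (simp add: over_def)
    ultimately show "x \<in> Lalg" unfolding Lalg_def alg_closure_in_def using subfieldE(3)[OF V.Fr_subfield] x by blast
  qed
  \<comment> \<open>The field axioms for the separable part are reduced to the fields generated by
    one or two of its elements, which by this fact lie entirely inside it.\<close>
  have ext: "z \<in> Lsep" if xs: "set xs \<subseteq> Lsep" and z: "z \<in> U.finite_extension V.Fr xs" for z xs
  proof -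
    have xs': "set xs \<subseteq> carrier U" using xs subfieldE(3)[OF Lalg] unfolding Lsep_eq by blast
    have "U.separable_over V.Fr z"
      by (rule U.finite_extension_separable[OF V.Fr_subfield xs' _ z]) (use xs Lsep_eq in blast)
    moreover have "z \<in> Lalg"
      using U.finite_extension_subring_incl[OF subfieldE(1)[OF Lalg] FL, of xs] xs z unfolding Lsep_eq by blast
    ultimately show ?thesis unfolding Lsep_eq by blast
  qed
  have FLs: "V.Fr \<subseteq> Lsep" using ext[of "[]"] by auto
  have Lsep: "subfield Lsep U"
  proof (rule U.subfieldI')
    have mem: "subfield (U.finite_extension V.Fr xs) U" "set xs \<subseteq> U.finite_extension V.Fr xs"
      "U.finite_extension V.Fr xs \<subseteq> Lsep" if xs: "set xs \<subseteq> Lsep" for xs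
    proof -
      have xs': "set xs \<subseteq> carrier U" using xs subfieldE(3)[OF Lalg] unfolding Lsep_eq by blast
      show "subfield (U.finite_extension V.Fr xs) U"
        by (rule U.finite_extension_is_subfield[OF V.Fr_subfield xs'])
          (use xs Lalg_alg Lsep_eq in \<open>auto simp: over_def\<close>)
      show "set xs \<subseteq> U.finite_extension V.Fr xs" by (rule U.finite_extension_mem[OF subfieldE(1)[OF V.Fr_subfield] xs'])
      show "U.finite_extension V.Fr xs \<subseteq> Lsep" using ext[OF xs] by blast
    qed
    show "subring Lsep U"
    proof (rule U.subringI)
      show "Lsep \<subseteq> carrier U" unfolding Lsep_eq using subfieldE(3)[OF Lalg] by blast
      show "\<one>\<^bsub>U\<^esub> \<in> Lsep" using FLs subringE(3)[OF subfieldE(1)[OF V.Fr_subfield]] by blast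
      show "\<ominus>\<^bsub>U\<^esub> x \<in> Lsep" if "x \<in> Lsep" for x
        using mem[of "[x]"] subringE(5)[OF subfieldE(1)[OF mem(1)[of "[x]"]], of x] that by auto
      show "x \<otimes>\<^bsub>U\<^esub> y \<in> Lsep" if "x \<in> Lsep" "y \<in> Lsep" for x y
        using mem(2,3)[of "[x, y]"] subringE(6)[OF subfieldE(1)[OF mem(1)[of "[x, y]"]], of x y] that by auto
      show "x \<oplus>\<^bsub>U\<^esub> y \<in> Lsep" if "x \<in> Lsep" "y \<in> Lsep" for x y
        using mem(2,3)[of "[x, y]"] subringE(7)[OF subfieldE(1)[OF mem(1)[of "[x, y]"]], of x y] that by auto
    qed
    show "inv\<^bsub>U\<^esub> x \<in> Lsep" if "x \<in> Lsep - {\<zero>\<^bsub>U\<^esub>}" for x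
      using mem(2,3)[of "[x]"] U.subfield_m_inv(1)[OF mem(1)[of "[x]"], of x] that by auto
  qed
  \<comment> \<open>Every finite subextension has a positive degree dividing \<open>n s\<close> for
    almost all s, so its degree belongs to the set that is finite by hypothesis.\<close>
  have i: "U.finite_dimension V.Fr Lalg"
    if n: "eventually (\<lambda>s. ring.dimension (\<Omega> s) (n s) (Fs s) (L s)) D"
      and fin: "finite {k :: nat. k > 0 \<and> eventually (\<lambda>s. k dvd n s) D}" for n
  proof (rule U.finite_dimension_of_bounded_degrees[OF V.Fr_subfield Lalg FL _ fin])
    show "(U.algebraic over V.Fr) x" if "x \<in> Lalg" for x using Lalg_alg[OF that] by (simp add: over_def)
    fix E m assume E: "subfield E U" "V.Fr \<subseteq> E" "E \<subseteq> Lalg" "U.dimension m V.Fr E"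
    have "E \<subseteq> us L" using E(3) unfolding Lalg_def LL_def by blast
    then show "m \<in> {k. k > 0 \<and> eventually (\<lambda>s. k dvd n s) D}"
      using ev_degree_dvd[OF E(1,2) _ E(4) L' n] U.subfield_dimension_pos[OF E(1) V.Fr_subfield E(4)] by blast
  qed
  have ii: "U.separable_over V.Fr x"
    if "eventually (\<lambda>s. \<forall>x\<in>L s. separable_elem (\<Omega> s) (Fs s) x) D" "x \<in> Lalg" for x
    using separable_of_ev_separable[of x L] that(1) Lalg_alg[OF that(2)] that(2)
    unfolding separable_elem_s Lalg_def LL_def by blast
  \<comment> \<open>An inseparable element yields a prime p that vanishes in U, and this equation
    holds in almost all components.\<close>
  have iii: "U.separable_over V.Fr x"
    if np: "\<nexists>p :: nat. prime p \<and> eventually (\<lambda>s. char_of (\<Omega> s) = p) D" and x: "x \<in> Lalg" for x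
  proof (rule ccontr)
    assume insep: "\<not> U.separable_over V.Fr x"
    have xc: "x \<in> carrier U" using x subfieldE(3)[OF Lalg] by blast
    obtain p :: nat where p: "prime p" "[p] \<cdot>\<^bsub>U\<^esub> \<one>\<^bsub>U\<^esub> = \<zero>\<^bsub>U\<^esub>"
      using U.inseparable_imp_char[OF V.Fr_subfield xc Lalg_alg[OF x] insep] U.char_prime_exists by blast
    have "eventually (\<lambda>s. char_of (\<Omega> s) = p) D"
      using ev_char[OF p(2)] by (rule eventually_mono) (rule char_ofI[OF fields p(1)])
    then show False using np p(1) by blast
  qed
  have eq: "Lalg = Lsep" if "\<forall>x \<in> Lalg. U.separable_over V.Fr x" using that unfolding Lsep_eq by blast
  have fin_sep: "U.finite_dimension V.Fr Lsep" if "U.finite_dimension V.Fr Lalg"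
    by (rule U.subfield_finite_subspace[OF V.Fr_subfield Lsep FLs _ that]) (auto simp: Lsep_eq)
  show ?thesis
    unfolding Let_def ratfun_embed_eq rf separable_elem_U
    unfolding LL_def[symmetric] Lalg_def[symmetric] Lsep_def[symmetric]
    using Lalg FL i Lsep FLs fin_sep ii iii eq Lsep_eq by blast
qed

end
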